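(* Let $G$ be a word-representable split graph. Then $\mathcal{R}(G)=3$ if and only if $G$ contains an induced subgraph isomorphic to a graph in $\mathcal{C}_3$, i.e. to $F_0$, to an even $k$-sun for some even $k\ge4$, or to $F_1(k)$ or $F_2(k)$ for some odd $k\ge5$.
   Context: A split graph is a graph whose vertex set can be partitioned into a clique and an independent set. A graph $G=(V,E)$ is word-representable if there is a word $w$ over $V$ (a finite sequence of elements of $V$) such that for all distinct $a,b\in V$, $ab\in E$ iff $a$ and $b$ alternate in $w$ (i.e. the subsequence of $w$ formed by all occurrences of $a$ and $b$ is $abab\cdots$ or $baba\cdots$). A word is $k$-uniform if each letter occurs exactly $k$ times; $\mathcal{R}(G)$ is the least $k$ such that a $k$-uniform word represents $G$. The graphs (split graphs with clique $C$, independent set $I$, and listed neighbourhoods): $F_0$: $C=\{0,c_1,c_2,c_3,c_4\}$, $I=\{a_1,a_2,a_3\}$, $N(a_1)=\{0,c_2,c_3\}$, $N(a_2)=\{0,c_3,c_4\}$, $N(a_3)=\{0,c_1,c_4\}$. Even $k$-sun ($k\ge4$ even): $C=\{c_1,\dots,c_k\}$, $I=\{a_1,\dots,a_k\}$, $N(a_i)=\{c_i,c_{i+1}\}$ ($1\le i\le k-1$), $N(a_k)=\{c_1,c_k\}$. $F_1(k)$ ($k\ge5$ odd): $C=\{c_1,\dots,c_{k-1}\}$, $I=\{b_1,b_2,a_1,\dots,a_{k-2}\}$, $N(b_1)=\{c_1,\dots,c_{k-2}\}$, $N(b_2)=\{c_2,\dots,c_{k-1}\}$, $N(a_i)=\{c_i,c_{i+1}\}$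 ($1\le i\le k-2$). $F_2(k)$ ($k\ge5$ odd): $C=\{c_1,\dots,c_k\}$, $I=\{b,a_1,\dots,a_{k-1}\}$, $N(b)=\{c_2,\dots,c_{k-1}\}$, $N(a_i)=\{c_i,c_{i+1}\}$ ($1\le i\le k-1$). $\mathcal{C}_3$ is the family of all these graphs. *)

theory Defs
  imports Main
begin

definition simple_graph :: "'a set \<Rightarrow> ('a \<Rightarrow> 'a \<Rightarrow> bool) \<Rightarrow> bool" where
  "simple_graph V E \<longleftrightarrow> finite V \<and> (\<forall>x\<in>V. \<forall>y\<in>V. E x y \<longrightarrow> E y x) \<and> (\<forall>x\<in>V. \<not> E x x)"

definition is_clique :: "('a \<Rightarrow> 'a \<Rightarrow> bool) \<Rightarrow> 'a set \<Rightarrow> bool" where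
  "is_clique E S \<longleftrightarrow> (\<forall>x\<in>S. \<forall>y\<in>S. x \<noteq> y \<longrightarrow> E x y)"

definition is_indep :: "('a \<Rightarrow> 'a \<Rightarrow> bool) \<Rightarrow> 'a set \<Rightarrow> bool" where
  "is_indep E S \<longleftrightarrow> (\<forall>x\<in>S. \<forall>y\<in>S. \<not> E x y)"

definition split_graph :: "'a set \<Rightarrow> ('a \<Rightarrow> 'a \<Rightarrow> bool) \<Rightarrow> bool" where
  "split_graph V E \<longleftrightarrow> (\<exists>C I. C \<union> I = V \<and> C \<inter> I = {} \<and> is_clique E C \<and> is_indep E I)"

definition has_induced_copy ::
  "'a set \<Rightarrow> ('a \<Rightarrow> 'a \<Rightarrow> bool) \<Rightarrow> 'b set \<Rightarrow> ('b \<Rightarrow> 'b \<Rightarrow> bool) \<Rightarrow> bool" where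
  "has_induced_copy V E VH EH \<longleftrightarrow>
     (\<exists>f. inj_on f VH \<and> f ` VH \<subseteq> V \<and>
          (\<forall>x\<in>VH. \<forall>y\<in>VH. x \<noteq> y \<longrightarrow> (EH x y \<longleftrightarrow> E (f x) (f y))))"

definition alternate :: "'a list \<Rightarrow> 'a \<Rightarrow> 'a \<Rightarrow> bool" where
  "alternate w a b \<longleftrightarrow>
     (let u = filter (\<lambda>x. x = a \<or> x = b) w in \<forall>i. Suc i < length u \<longrightarrow> u ! i \<noteq> u ! Suc i)"

definition represents :: "'a set \<Rightarrow> ('a \<Rightarrow> 'a \<Rightarrow> bool) \<Rightarrow> 'a list \<Rightarrow> bool" where
  "represents V E w \<longleftrightarrow> set w = V \<and>
     (\<forall>a\<in>V. \<forall>b\<in>V. a \<noteq> b \<longrightarrow> (E a b \<longleftrightarrow> alternate w a b))"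

definition word_representable :: "'a set \<Rightarrow> ('a \<Rightarrow> 'a \<Rightarrow> bool) \<Rightarrow> bool" where
  "word_representable V E \<longleftrightarrow> (\<exists>w. represents V E w)"

definition uniform :: "nat \<Rightarrow> 'a set \<Rightarrow> 'a list \<Rightarrow> bool" where
  "uniform k V w \<longleftrightarrow> (\<forall>v\<in>V. count_list w v = k)"

definition rep_num :: "'a set \<Rightarrow> ('a \<Rightarrow> 'a \<Rightarrow> bool) \<Rightarrow> nat" where
  "rep_num V E = (LEAST k. \<exists>w. represents V E w \<and> uniform k V w)"

datatype vtx = Zero | Cv nat | Av nat | Bv nat

text \<open>Split graph with clique Cs, independent set Is and neighbourhoods N of the
  vertices of Is (N x \<subseteq> Cs).\<close>
definition sg_V :: "vtx set \<Rightarrow> vtx set \<Rightarrow> vtx set" where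
  "sg_V Cs Is = Cs \<union> Is"

definition sg_E :: "vtx set \<Rightarrow> vtx set \<Rightarrow> (vtx \<Rightarrow> vtx set) \<Rightarrow> vtx \<Rightarrow> vtx \<Rightarrow> bool" where
  "sg_E Cs Is N x y \<longleftrightarrow> x \<noteq> y \<and>
     ((x \<in> Cs \<and> y \<in> Cs) \<or> (x \<in> Is \<and> y \<in> Cs \<and> y \<in> N x) \<or> (y \<in> Is \<and> x \<in> Cs \<and> x \<in> N y))"

definition F0_C :: "vtx set" where "F0_C = {Zero, Cv 1, Cv 2, Cv 3, Cv 4}"
definition F0_I :: "vtx set" where "F0_I = {Av 1, Av 2, Av 3}"
definition F0_N :: "vtx \<Rightarrow> vtx set" where
  "F0_N x = (if x = Av 1 then {Zero, Cv 2, Cv 3}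
             else if x = Av 2 then {Zero, Cv 3, Cv 4}
             else if x = Av 3 then {Zero, Cv 1, Cv 4} else {})"

definition sun_C :: "nat \<Rightarrow> vtx set" where "sun_C k = Cv ` {1..k}"
definition sun_I :: "nat \<Rightarrow> vtx set" where "sun_I k = Av ` {1..k}"
definition sun_N :: "nat \<Rightarrow> vtx \<Rightarrow> vtx set" where
  "sun_N k x = (case x of Av i \<Rightarrow> if 1 \<le> i \<and> i \<le> k - 1 then {Cv i, Cv (i+1)}
                                  else if i = k then {Cv 1, Cv k} else {}
                      | _ \<Rightarrow> {})"

definition F1_C :: "nat \<Rightarrow> vtx set" where "F1_C k = Cv ` {1..k-1}"
definition F1_I :: "nat \<Rightarrow> vtx set" where "F1_I k = {Bv 1, Bv 2} \<union> Av ` {1..k-2}"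
definition F1_N :: "nat \<Rightarrow> vtx \<Rightarrow> vtx set" where
  "F1_N k x = (case x of Bv j \<Rightarrow> if j = 1 then Cv ` {1..k-2} else if j = 2 then Cv ` {2..k-1} else {}
                     | Av i \<Rightarrow> if 1 \<le> i \<and> i \<le> k - 2 then {Cv i, Cv (i+1)} else {}
                     | _ \<Rightarrow> {})"

definition F2_C :: "nat \<Rightarrow> vtx set" where "F2_C k = Cv ` {1..k}"
definition F2_I :: "nat \<Rightarrow> vtx set" where "F2_I k = {Bv 1} \<union> Av ` {1..k-1}"
definition F2_N :: "nat \<Rightarrow> vtx \<Rightarrow> vtx set" where
  "F2_N k x = (case x of Bv j \<Rightarrow> if j = 1 then Cv ` {2..k-1} else {}
                     | Av i \<Rightarrow> if 1 \<le> i \<and> i \<le> k - 1 then {Cv i, Cv (i+1)} else {}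
                     | _ \<Rightarrow> {})"

definition contains_C3 :: "'a set \<Rightarrow> ('a \<Rightarrow> 'a \<Rightarrow> bool) \<Rightarrow> bool" where
  "contains_C3 V E \<longleftrightarrow>
     has_induced_copy V E (sg_V F0_C F0_I) (sg_E F0_C F0_I F0_N)
   \<or> (\<exists>k. even k \<and> 4 \<le> k \<and>
        has_induced_copy V E (sg_V (sun_C k) (sun_I k)) (sg_E (sun_C k) (sun_I k) (sun_N k)))
   \<or> (\<exists>k. odd k \<and> 5 \<le> k \<and>
        has_induced_copy V E (sg_V (F1_C k) (F1_I k)) (sg_E (F1_C k) (F1_I k) (F1_N k)))
   \<or> (\<exists>k. odd k \<and> 5 \<le> k \<and>
        has_induced_copy V E (sg_V (F2_C k) (F2_I k)) (sg_E (F2_C k) (F2_I k) (F2_N k)))"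

end

theory Submission
  imports Defs "HOL-Library.Product_Lexorder"
begin

text \<open>Let \<open>C\<close> be a maximal clique of the split graph and \<open>I\<close> the rest. The occurrences of \<open>C\<close> in a
  representing word repeat one fixed permutation, so \<open>C\<close> is cyclically ordered, and comparing letter
  counts of prefixes shows that every neighbourhood \<open>N(x)\<close> with \<open>x \<in> I\<close> is an arc of this cycle
  and that two such arcs never overlap at both ends. Conversely, such an arrangement of arcs yields
  a 3-uniform word, by cutting the cycle at one gap and at a second gap avoided by all arcs through
  the cut.

  For 2-uniform words put \<open>C\<close> on a circle of length \<open>2m\<close>, each clique vertex sitting on two antipodal
  points. Every arc has two antipodal lifts there, and a 2-uniform word is a choice of one lift per
  arc such that no two chosen lifts overlap. The choice is impossible only if there is an odd closed
  walk of overlapping arcs. A shortest one is an induced cycle of the overlap graph: three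
  mutually overlapping arcs give \<open>F\<^sub>0\<close>, a cycle without containments winds once around \<open>C\<close> and
  gives an even sun, and a containment forces one or two arcs to contain nearly all others, which
  gives \<open>F\<^sub>2\<close> or \<open>F\<^sub>1\<close>. In the other direction, in a chord diagram overlapping nonadjacent
  vertices of \<open>I\<close> that miss a clique chord lie on opposite sides of it, and following the sides
  along the path of the \<open>a\<^sub>i\<close> gives a parity contradiction in each graph of the family.\<close>

section \<open>Alternation of letters\<close>

text \<open>The obstruction is the parity of \<open>n + D / m\<close>, for \<open>n\<close> the
  length of a closed walk of overlapping arcs and \<open>D / m\<close> its number of turns around
  the clique: each step forces the antipodal lift, and each turn is half of the double circle. This
  explains the parities in the family. A cycle of length at least four without containments makes
  exactly one turn, so \<open>n\<close> is even and a sun appears; a triangle or a containment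
  forces \<open>D = 0\<close>, so \<open>n\<close> is odd and \<open>F_0\<close>, \<open>F_1\<close>
  or \<open>F_2\<close> appears. More turns are impossible, and a step has a well-defined
  displacement at all, because two arcs never overlap at both ends: if an arc overlaps one lift of
  another arc, it is disjoint from all its other lifts. The clique is maximal so that no
  neighbourhood is all of \<open>C\<close>; arcs are then shorter than the period, and distinct
  lifts of one arc stay disjoint. In the converse direction the same parity counts changes of side
  along the path of the \<open>a_i\<close>.\<close>

lemma alternate_iff_successively:
  "alternate w a b \<longleftrightarrow> successively (\<noteq>) (filter (\<lambda>x. x = a \<or> x = b) w)"
  unfolding alternate_def Let_def successively_conv_nth by auto

definition cnt :: "'a list \<Rightarrow> 'a \<Rightarrow> nat \<Rightarrow> int" where
  "cnt w a n = int (count_list (take n w) a)"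

lemma cnt_0 [simp]: "cnt w a 0 = 0"
  by (simp add: cnt_def)

lemma cnt_Cons_Suc [simp]: "cnt (c # w) a (Suc n) = (if c = a then 1 else 0) + cnt w a n"
  by (simp add: cnt_def)

lemma cnt_Nil [simp]: "cnt [] a n = 0"
  by (simp add: cnt_def)

lemma all_nat_split: "(\<forall>n::nat. P n) \<longleftrightarrow> P 0 \<and> (\<forall>n. P (Suc n))"
  by (metis not0_implies_Suc)

lemma hd_filter_pair:
  assumes "filter (\<lambda>x. x = a \<or> x = b) w \<noteq> []"
  shows "hd (filter (\<lambda>x. x = a \<or> x = b) w) = a \<or> hd (filter (\<lambda>x. x = a \<or> x = b) w) = b"
  using hd_in_set[OF assms] by simp

lemma successively_neq_Cons:
  assumes "xs = [] \<or> hd xs = a \<or> hd xs = b" "a \<noteq> b"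
  shows "successively (\<noteq>) (a # xs) \<longleftrightarrow> successively (\<noteq>) xs \<and> (xs = [] \<or> hd xs = b)"
  using assms by (cases xs) auto

text \<open>The two equivalences need a joint induction: removing a leading \<open>a\<close> turns
  the case where \<open>a\<close> comes first into the case where \<open>b\<close> comes first, and
  conversely.\<close>

lemma successively_filter_cnt:
  assumes "a \<noteq> b"
  shows "(successively (\<noteq>) (filter (\<lambda>x. x = a \<or> x = b) w) \<and>
            (filter (\<lambda>x. x = a \<or> x = b) w = [] \<or> hd (filter (\<lambda>x. x = a \<or> x = b) w) = a)
          \<longleftrightarrow> (\<forall>n. cnt w b n \<le> cnt w a n \<and> cnt w a n \<le> cnt w b n + 1)) \<and>
         (successively (\<noteq>) (filter (\<lambda>x. x = a \<or> x = b) w) \<and>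
            (filter (\<lambda>x. x = a \<or> x = b) w = [] \<or> hd (filter (\<lambda>x. x = a \<or> x = b) w) = b)
          \<longleftrightarrow> (\<forall>n. cnt w a n \<le> cnt w b n \<and> cnt w b n \<le> cnt w a n + 1))"
proof (induction w)
  case Nil
  then show ?case by simp
next
  case (Cons c w)
  let ?f = "filter (\<lambda>x. x = a \<or> x = b) w"
  have hd: "?f \<noteq> [] \<Longrightarrow> hd ?f = a \<or> hd ?f = b"
    by (rule hd_filter_pair)
  consider "c = a" | "c = b" | "c \<noteq> a" "c \<noteq> b" by blast
  then show ?case
  proof cases
    case 1
    have L: "(\<forall>n. cnt (c # w) b n \<le> cnt (c # w) a n \<and> cnt (c # w) a n \<le> cnt (c # w) b n + 1) \<longleftrightarrow>
      (\<forall>n. cnt w a n \<le> cnt w b n \<and> cnt w b n \<le> cnt w a n + 1)"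
      by (subst all_nat_split) (use 1 assms in \<open>auto simp: algebra_simps\<close>)
    have R: "\<not> (\<forall>n. cnt (c # w) a n \<le> cnt (c # w) b n \<and> cnt (c # w) b n \<le> cnt (c # w) a n + 1)"
      by (subst all_nat_split) (use 1 assms in \<open>auto intro!: exI[of _ 0]\<close>)
    have F: "filter (\<lambda>x. x = a \<or> x = b) (c # w) = a # ?f"
      using 1 by simp
    have S: "successively (\<noteq>) (a # ?f) \<longleftrightarrow> successively (\<noteq>) ?f \<and> (?f = [] \<or> hd ?f = b)"
      by (rule successively_neq_Cons) (use hd assms in blast)+
    show ?thesis
      unfolding F L S using R Cons.IH assms by (simp del: successively.simps)
  next
    case 2
    have L: "(\<forall>n. cnt (c # w) a n \<le> cnt (c # w) b n \<and> cnt (c # w) b n \<le> cnt (c # w) a n + 1) \<longleftrightarrow>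
      (\<forall>n. cnt w b n \<le> cnt w a n \<and> cnt w a n \<le> cnt w b n + 1)"
      by (subst all_nat_split) (use 2 assms in \<open>auto simp: algebra_simps\<close>)
    have R: "\<not> (\<forall>n. cnt (c # w) b n \<le> cnt (c # w) a n \<and> cnt (c # w) a n \<le> cnt (c # w) b n + 1)"
      by (subst all_nat_split) (use 2 assms in \<open>auto intro!: exI[of _ 0]\<close>)
    have F: "filter (\<lambda>x. x = a \<or> x = b) (c # w) = b # ?f"
      using 2 by simp
    have S: "successively (\<noteq>) (b # ?f) \<longleftrightarrow> successively (\<noteq>) ?f \<and> (?f = [] \<or> hd ?f = a)"
      by (rule successively_neq_Cons) (use hd assms in blast)+
    show ?thesis
      unfolding F L S using R Cons.IH assms by (simp del: successively.simps)
  next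
    case 3
    have L: "(\<forall>n. cnt (c # w) b n \<le> cnt (c # w) a n \<and> cnt (c # w) a n \<le> cnt (c # w) b n + 1) \<longleftrightarrow>
      (\<forall>n. cnt w b n \<le> cnt w a n \<and> cnt w a n \<le> cnt w b n + 1)"
      by (subst all_nat_split) (use 3 assms in auto)
    have R: "(\<forall>n. cnt (c # w) a n \<le> cnt (c # w) b n \<and> cnt (c # w) b n \<le> cnt (c # w) a n + 1) \<longleftrightarrow>
      (\<forall>n. cnt w a n \<le> cnt w b n \<and> cnt w b n \<le> cnt w a n + 1)"
      by (subst all_nat_split) (use 3 assms in auto)
    show ?thesis
      using L R Cons.IH 3 by simp
  qed
qed

text \<open>The offset \<open>q\<close> absorbs which letter comes first; \<open>n = 0\<close>
  leaves only the values 0 and 1. With an existential offset the counts may be shifted by constants,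
  which is what makes them comparable all around the clique.\<close>

lemma alternate_iff_cnt:
  assumes "a \<noteq> b"
  shows "alternate w a b \<longleftrightarrow> (\<exists>q. \<forall>n. cnt w b n \<le> cnt w a n + q \<and> cnt w a n + q \<le> cnt w b n + 1)"
proof -
  let ?f = "filter (\<lambda>x. x = a \<or> x = b) w"
  have hd: "?f = [] \<or> hd ?f = a \<or> hd ?f = b"
    using hd_filter_pair[of a b w] by blast
  have "alternate w a b \<longleftrightarrow> (\<forall>n. cnt w b n \<le> cnt w a n \<and> cnt w a n \<le> cnt w b n + 1) \<or>
     (\<forall>n. cnt w a n \<le> cnt w b n \<and> cnt w b n \<le> cnt w a n + 1)"
    unfolding alternate_iff_successively using successively_filter_cnt[OF assms, of w] hd by argo
  also have "\<dots> \<longleftrightarrow> (\<exists>q. \<forall>n. cnt w b n \<le> cnt w a n + q \<and> cnt w a n + q \<le> cnt w b n + 1)"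
  proof
    assume "(\<forall>n. cnt w b n \<le> cnt w a n \<and> cnt w a n \<le> cnt w b n + 1) \<or>
     (\<forall>n. cnt w a n \<le> cnt w b n \<and> cnt w b n \<le> cnt w a n + 1)"
    then show "\<exists>q. \<forall>n. cnt w b n \<le> cnt w a n + q \<and> cnt w a n + q \<le> cnt w b n + 1"
    proof
      assume "\<forall>n. cnt w b n \<le> cnt w a n \<and> cnt w a n \<le> cnt w b n + 1"
      then show ?thesis by (intro exI[of _ 0]) simp
    next
      assume "\<forall>n. cnt w a n \<le> cnt w b n \<and> cnt w b n \<le> cnt w a n + 1"
      then show ?thesis by (intro exI[of _ 1]) simp
    qed
  next
    assume "\<exists>q. \<forall>n. cnt w b n \<le> cnt w a n + q \<and> cnt w a n + q \<le> cnt w b n + 1"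
    then obtain q where q: "\<And>n. cnt w b n \<le> cnt w a n + q \<and> cnt w a n + q \<le> cnt w b n + 1" by blast
    have "q = 0 \<or> q = 1" using q[of 0] by auto
    then show "(\<forall>n. cnt w b n \<le> cnt w a n \<and> cnt w a n \<le> cnt w b n + 1) \<or>
     (\<forall>n. cnt w a n \<le> cnt w b n \<and> cnt w b n \<le> cnt w a n + 1)"
      using q by (metis add.right_neutral add_le_cancel_right)
  qed
  finally show ?thesis .
qed

lemma hd_filter_iff:
  assumes "a \<noteq> b"
  shows "(filter (\<lambda>x. x = a \<or> x = b) w = [] \<or> hd (filter (\<lambda>x. x = a \<or> x = b) w) = b) \<longleftrightarrow>
    (\<forall>j < length w. w ! j = a \<longrightarrow> (\<exists>l < j. w ! l = b))"
proof (induction w)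
  case Nil
  then show ?case by simp
next
  case (Cons c w)
  have "(\<forall>j < length (c # w). (c # w) ! j = a \<longrightarrow> (\<exists>l < j. (c # w) ! l = b)) \<longleftrightarrow>
    (c \<noteq> a \<and> (\<forall>j < length w. w ! j = a \<longrightarrow> c = b \<or> (\<exists>l < j. w ! l = b)))"
    by (simp add: all_nat_split[of "\<lambda>n. n < Suc (length w) \<longrightarrow> _ n"] Ex_less_Suc2)
  then show ?case using Cons.IH assms by auto
qed

lemma alternate_iff_between:
  assumes "a \<noteq> b"
  shows "alternate w a b \<longleftrightarrow>
    (\<forall>j < length w. \<forall>i < j. w ! i = a \<and> w ! j = a \<longrightarrow> (\<exists>l < j. i < l \<and> w ! l = b)) \<and>
    (\<forall>j < length w. \<forall>i < j. w ! i = b \<and> w ! j = b \<longrightarrow> (\<exists>l < j. i < l \<and> w ! l = a))"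
  unfolding alternate_iff_successively
proof (induction w)
  case Nil
  then show ?case by simp
next
  case (Cons c w)
  have step: "(\<forall>j < length (c # w). \<forall>i < j. (c # w) ! i = a' \<and> (c # w) ! j = a' \<longrightarrow>
        (\<exists>l < j. i < l \<and> (c # w) ! l = b')) \<longleftrightarrow>
     (\<forall>j < length w. \<forall>i < j. w ! i = a' \<and> w ! j = a' \<longrightarrow> (\<exists>l < j. i < l \<and> w ! l = b')) \<and>
     (c = a' \<longrightarrow> (\<forall>j < length w. w ! j = a' \<longrightarrow> (\<exists>l < j. w ! l = b')))" for a' b'
    by (simp add: all_nat_split[of "\<lambda>n. n < Suc _ \<longrightarrow> _ n"] Ex_less_Suc2 All_less_Suc2) blast
  have sw: "filter (\<lambda>x. x = b \<or> x = a) w = filter (\<lambda>x. x = a \<or> x = b) w"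
    by (rule filter_cong) auto
  note ha = hd_filter_iff[OF assms, of w] and hb = hd_filter_iff[OF assms[symmetric], of w, unfolded sw]
  have hd: "filter (\<lambda>x. x = a \<or> x = b) w = [] \<or> hd (filter (\<lambda>x. x = a \<or> x = b) w) = a
     \<or> hd (filter (\<lambda>x. x = a \<or> x = b) w) = b"
    using hd_filter_pair[of a b w] by blast
  show ?case
  proof -
    let ?f = "filter (\<lambda>x. x = a \<or> x = b) w"
    consider "c = a" | "c = b" | "c \<noteq> a" "c \<noteq> b" by blast
    then show ?thesis
    proof cases
      case 1
      then have F: "filter (\<lambda>x. x = a \<or> x = b) (c # w) = a # ?f" by simp
      have S: "successively (\<noteq>) (a # ?f) \<longleftrightarrow> successively (\<noteq>) ?f \<and> (?f = [] \<or> hd ?f = b)"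
        by (rule successively_neq_Cons) (use hd assms in blast)+
      show ?thesis unfolding step F S ha Cons.IH using 1 assms by blast
    next
      case 2
      then have F: "filter (\<lambda>x. x = a \<or> x = b) (c # w) = b # ?f" by simp
      have S: "successively (\<noteq>) (b # ?f) \<longleftrightarrow> successively (\<noteq>) ?f \<and> (?f = [] \<or> hd ?f = a)"
        by (rule successively_neq_Cons) (use hd assms in blast)+
      show ?thesis unfolding step F S hb Cons.IH using 2 assms by blast
    next
      case 3
      then show ?thesis unfolding step using Cons.IH by simp
    qed
  qed
qed

text \<open>A word is specified by giving each occurrence a key in any linear order and reading the
  letters in sorted order. Lexicographic tuples can then serve as positions, their later components
  breaking ties inside a gap.\<close>

lemma word_of_keys:
  fixes kp :: "'a \<Rightarrow> nat \<Rightarrow> 'k :: linorder"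
  assumes fin: "finite V" and n: "0 < n"
    and mono: "\<And>v i. v \<in> V \<Longrightarrow> Suc i < n \<Longrightarrow> kp v i < kp v (Suc i)"
    and disj: "\<And>u v i j. u \<in> V \<Longrightarrow> v \<in> V \<Longrightarrow> u \<noteq> v \<Longrightarrow> i < n \<Longrightarrow> j < n \<Longrightarrow> kp u i \<noteq> kp v j"
  obtains w where "set w = V" "uniform n V w"
    "\<And>a b. a \<in> V \<Longrightarrow> b \<in> V \<Longrightarrow> a \<noteq> b \<Longrightarrow> alternate w a b \<longleftrightarrow>
       (\<forall>i. Suc i < n \<longrightarrow> (\<exists>j < n. kp a i < kp b j \<and> kp b j < kp a (Suc i))) \<and>
       (\<forall>i. Suc i < n \<longrightarrow> (\<exists>j < n. kp b i < kp a j \<and> kp a j < kp b (Suc i)))"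
proof -
  have less: "kp v i < kp v j" if "v \<in> V" "i < j" "j < n" for v i j
    using that(2,3)
  proof (induction j)
    case (Suc j)
    then show ?case
      using mono[OF that(1), of j] by (cases "i = j") (auto intro: less_trans)
  qed simp
  have less_iff: "kp v i < kp v j \<longleftrightarrow> i < j" if "v \<in> V" "i < n" "j < n" for v i j
    using less[OF that(1)] that by (metis linorder_neqE_nat order_less_asym)
  have eq_iff: "kp v i = kp v j \<longleftrightarrow> i = j" if "v \<in> V" "i < n" "j < n" for v i j
    using less_iff[OF that] less_iff[OF that(1,3,2)] by (metis nat_neq_iff order_less_irrefl)
  define S where "S = (\<lambda>(v, i). kp v i) ` (V \<times> {..<n})"
  have finS: "finite S" using fin by (simp add: S_def)
  have inj: "inj_on (\<lambda>(v, i). kp v i) (V \<times> {..<n})"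
    by (rule inj_onI) (auto, metis disj, metis disj eq_iff)
  define l where "l = (\<lambda>p. fst (the_inv_into (V \<times> {..<n}) (\<lambda>(v, i). kp v i) p))"
  have l: "l (kp v i) = v" if "v \<in> V" "i < n" for v i
    using the_inv_into_f_f[OF inj, of "(v, i)"] that by (simp add: l_def)
  define ks where "ks = sorted_list_of_set S"
  have ks: "sorted_wrt (<) ks" "set ks = S" "distinct ks"
    using finS by (simp_all add: ks_def)
  define w where "w = map l ks"
  have nth_less: "ks ! i < ks ! j \<longleftrightarrow> i < j" if "i < length ks" "j < length ks" for i j
    using ks(1) that by (metis linorder_neqE_nat order_less_asym sorted_wrt_nth_less)
  have idx: "\<exists>p < length ks. ks ! p = kp v i" if "v \<in> V" "i < n" for v i
    using that ks(2) by (metis (no_types, lifting) S_def image_eqI in_set_conv_nth case_prod_conv lessThan_iff mem_Sigma_iff)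
  have nthk: "\<exists>i < n. ks ! p = kp (w ! p) i \<and> w ! p \<in> V" if "p < length ks" for p
  proof -
    have "ks ! p \<in> S" using that ks(2) by force
    then obtain v i where "v \<in> V" "i < n" "ks ! p = kp v i" by (auto simp: S_def)
    then show ?thesis using l that by (auto simp: w_def)
  qed
  have len: "length w = length ks" by (simp add: w_def)
  have setw: "set w = V"
    unfolding w_def using ks(2) l n by (auto simp: S_def image_iff) 
  have unif: "uniform n V w"
    unfolding uniform_def
  proof
    fix v assume v: "v \<in> V"
    have "count_list w v = length (filter (\<lambda>p. l p = v) ks)"
      by (simp add: w_def count_list_eq_length_filter filter_map comp_def eq_commute)
    also have "\<dots> = card (set (filter (\<lambda>p. l p = v) ks))"
      using ks(3) by (metis distinct_card distinct_filter)
    also have "set (filter (\<lambda>p. l p = v) ks) = kp v ` {..<n}"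
      using ks(2) v l by (auto simp: S_def)
    also have "card \<dots> = n"
      using eq_iff[OF v] by (subst card_image) (auto simp: inj_on_def)
    finally show "count_list w v = n" .
  qed
  have between: "(\<forall>j < length w. \<forall>i < j. w ! i = a \<and> w ! j = a \<longrightarrow> (\<exists>l < j. i < l \<and> w ! l = b)) \<longleftrightarrow>
      (\<forall>i. Suc i < n \<longrightarrow> (\<exists>j < n. kp a i < kp b j \<and> kp b j < kp a (Suc i)))"
    if ab: "a \<in> V" "b \<in> V" for a b
  proof (intro iffI allI impI)
    fix i assume H: "\<forall>j < length w. \<forall>i < j. w ! i = a \<and> w ! j = a \<longrightarrow> (\<exists>l < j. i < l \<and> w ! l = b)"
      and i: "Suc i < n"
    obtain p where p: "p < length ks" "ks ! p = kp a i" using idx[OF ab(1), of i] i by auto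
    obtain q where q: "q < length ks" "ks ! q = kp a (Suc i)" using idx[OF ab(1), of "Suc i"] i by auto
    have pq: "p < q" using nth_less[OF p(1) q(1)] less[OF ab(1), of i "Suc i"] i p q by simp
    have "w ! p = a" "w ! q = a" using p q l ab i by (simp_all add: w_def)
    then obtain r where r: "r < q" "p < r" "w ! r = b" using H pq q(1) len by metis
    have rl: "r < length ks" using r q by simp
    obtain j where "j < n" "ks ! r = kp b j" using nthk[OF rl] r by auto
    then show "\<exists>j < n. kp a i < kp b j \<and> kp b j < kp a (Suc i)"
      using nth_less[OF p(1) rl] nth_less[OF rl q(1)] r p q by auto
  next
    fix q p assume H: "\<forall>i. Suc i < n \<longrightarrow> (\<exists>j < n. kp a i < kp b j \<and> kp b j < kp a (Suc i))"
      and q: "q < length w" and pq: "p < q" and e: "w ! p = a \<and> w ! q = a"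
    obtain i where i: "i < n" "ks ! p = kp a i" using nthk[of p] pq q len e by auto
    obtain j where j: "j < n" "ks ! q = kp a j" using nthk[of q] q len e by auto
    have ij: "i < j" using less_iff[OF ab(1) i(1) j(1)] nth_less[of p q] i j pq q len by simp
    obtain k where k: "k < n" "kp a i < kp b k" "kp b k < kp a (Suc i)" using H ij j by (metis Suc_lessI less_trans)
    have "kp a (Suc i) \<le> kp a j" using ij less[OF ab(1), of "Suc i" j] j by (cases "Suc i = j") auto
    then have k2: "kp b k < kp a j" using k by simp
    obtain r where r: "r < length ks" "ks ! r = kp b k" using idx[OF ab(2) k(1)] by auto
    have "w ! r = b" using r l ab k by (simp add: w_def)
    moreover have "p < r" "r < q" using nth_less[of p r] nth_less[of r q] r k k2 i j pq q len by auto
    ultimately show "\<exists>l < q. p < l \<and> w ! l = b" by blast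
  qed
  show ?thesis
  proof (rule that[OF setw unif])
    fix a b assume "a \<in> V" "b \<in> V" "a \<noteq> b"
    then show "alternate w a b \<longleftrightarrow>
       (\<forall>i. Suc i < n \<longrightarrow> (\<exists>j < n. kp a i < kp b j \<and> kp b j < kp a (Suc i))) \<and>
       (\<forall>i. Suc i < n \<longrightarrow> (\<exists>j < n. kp b i < kp a j \<and> kp a j < kp b (Suc i)))"
      using alternate_iff_between[of a b w] between[of a b] between[of b a] by simp
  qed
qed

section \<open>Chord diagrams of 2-uniform words\<close>

text \<open>A chord is the pair of positions of a letter occurring twice; \<open>misses\<close> also demands four
  distinct endpoints, so it is not the negation of \<open>crosses\<close>.\<close>
definition crosses :: "int \<times> int \<Rightarrow> int \<times> int \<Rightarrow> bool" where
  "crosses a b \<longleftrightarrow> fst a < fst b \<and> fst b < snd a \<and> snd a < snd b \<or> fst b < fst a \<and> fst a < snd b \<and> snd b < snd a"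

definition misses :: "int \<times> int \<Rightarrow> int \<times> int \<Rightarrow> bool" where
  "misses a b \<longleftrightarrow> snd a < fst b \<or> snd b < fst a \<or> fst a < fst b \<and> snd b < snd a \<or> fst b < fst a \<and> snd a < snd b"

text \<open>One endpoint of \<open>x\<close> suffices: the relation is applied to chords
  \<open>x\<close> that miss \<open>d\<close>, whose two endpoints lie on the same side.\<close>

definition inside :: "int \<times> int \<Rightarrow> int \<times> int \<Rightarrow> bool" where
  "inside d x \<longleftrightarrow> fst d < fst x \<and> fst x < snd d"

text \<open>As \<open>x\<close> misses the crossing chords \<open>d\<close> and \<open>q\<close>,
  both lie on one side of \<open>x\<close>, and \<open>x\<close> cuts off one endpoint each of
  \<open>p\<close> and \<open>c\<close>; likewise \<open>y\<close> cuts off one endpoint each of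
  \<open>c\<close> and \<open>q\<close>. On the same side of \<open>d\<close> they would cut off the
  same endpoint of \<open>c\<close>, each together with an endpoint that the other leaves out, and
  so would cross.\<close>

lemma overlapping_opposite_sides:
  assumes "crosses d p" "crosses d c" "crosses d q" "crosses p c" "crosses c q" "crosses p q"
    "crosses x p" "crosses x c" "misses x q" "misses x d" 
    "crosses y c" "crosses y q" "misses y p" "misses y d" "misses x y"
    "fst x < snd x" "fst y < snd y"
  shows "inside d x \<noteq> inside d y"
  using assms unfolding crosses_def misses_def inside_def by (smt (z3))

text \<open>When \<open>x\<close> and \<open>y\<close> together meet every clique chord, no single chord separates them; their
  sides are compared through \<open>z\<close>, which misses both reference chords.\<close>
lemma overlapping_sides_across:
  assumes "crosses c d" "crosses c e" "crosses d e"
    "crosses x e" "crosses x d" "misses x c"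
    "crosses y e" "crosses y c" "misses y d"
    "crosses z e" "misses z c" "misses z d"
    "misses x y" "fst x < snd x" "fst y < snd y" "fst z < snd z"
  shows "(inside c x = inside c z) \<noteq> (inside d y = inside d z)"
  using assms unfolding crosses_def misses_def inside_def by (smt (z3))

text \<open>Both \<open>x\<close> and \<open>z\<close> cut off a single endpoint of
  \<open>e\<close>. The two endpoints of \<open>e\<close> lie in opposite quadrants of
  \<open>c\<close> and \<open>d\<close>, so exchanging them changes the side with respect to both
  chords.\<close>

lemma same_quadrant_sides:
  assumes "crosses c d" "crosses c e" "crosses d e"
    "crosses x e" "misses x d" "misses x c"
    "crosses z e" "misses z c" "misses z d"
    "fst x < snd x" "fst z < snd z"
  shows "(inside c x = inside c z) = (inside d x = inside d z)"
  using assms unfolding crosses_def misses_def inside_def by (smt (z3))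

text \<open>As \<open>v\<close> misses \<open>p\<close> and \<open>q\<close>, it cuts off one of two
  antipodal pairs, each made of an endpoint of \<open>c\<close> and one of \<open>d\<close>. The
  conditions on sides put \<open>x\<close> around an endpoint of \<open>d\<close> from one pair and
  \<open>y\<close> around the endpoint of \<open>c\<close> from the other pair, so whichever pair
  \<open>v\<close> takes, it crosses \<open>x\<close> or \<open>y\<close>.\<close>

lemma no_closing_chord:
  assumes "crosses c d" "crosses c p" "crosses c q" "crosses d p" "crosses d q" "p = q \<or> crosses p q"
    "crosses y c" "crosses y p" "misses y d" 
    "crosses x q" "crosses x d" "misses x c" 
    "crosses v c" "crosses v d" "misses v p" "misses v q"
    "misses z c" "misses z d" "crosses z p"
    "misses x y" "misses x v" "misses y v" "fst x < snd x" "fst y < snd y" "fst v < snd v" "fst z < snd z"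
    "misses y q" "misses x p" "inside c x \<noteq> inside c z" "inside d y \<noteq> inside d z"
  shows False
  using assms unfolding crosses_def misses_def inside_def by (smt (z3))

lemma alternating_parity:
  fixes lo hi :: nat and P :: "nat \<Rightarrow> bool"
  assumes "\<And>i. lo \<le> i \<Longrightarrow> i < hi \<Longrightarrow> P i \<noteq> P (Suc i)" "lo \<le> j" "j \<le> hi"
  shows "P j = P lo \<longleftrightarrow> even (j - lo)"
proof -
  have "lo + d \<le> hi \<Longrightarrow> P (lo + d) = P lo \<longleftrightarrow> even d" for d
  proof (induction d)
    case (Suc d)
    then show ?case using assms(1)[of "lo + d"] by auto
  qed simp
  from this[of "j - lo"] show ?thesis using assms(2,3) by simp
qed

lemma two_uniform_chords:
  assumes rep: "represents V E w" and uni: "uniform 2 V w"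
  obtains ch :: "'a \<Rightarrow> int \<times> int" where "\<And>v. v \<in> V \<Longrightarrow> fst (ch v) < snd (ch v)"
    "\<And>a b. a \<in> V \<Longrightarrow> b \<in> V \<Longrightarrow> a \<noteq> b \<Longrightarrow> E a b \<Longrightarrow> crosses (ch a) (ch b)"
    "\<And>a b. a \<in> V \<Longrightarrow> b \<in> V \<Longrightarrow> a \<noteq> b \<Longrightarrow> \<not> E a b \<Longrightarrow> misses (ch a) (ch b)"
proof -
  have ex: "\<exists>i j. i < j \<and> j < length w \<and> (\<forall>l < length w. w ! l = v \<longleftrightarrow> l = i \<or> l = j)" if "v \<in> V" for v
  proof -
    have "count_list w v = 2" using uni that by (simp add: uniform_def)
    then have "card {i. i < length w \<and> v = w ! i} = 2"
      by (simp add: count_list_eq_length_filter length_filter_conv_card)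
    then obtain i j where ij: "i \<noteq> j" "{i. i < length w \<and> v = w ! i} = {i, j}"
      by (auto simp: card_2_iff)
    have mem: "l < length w \<and> w ! l = v \<longleftrightarrow> l = i \<or> l = j" for l
      using ij(2)[unfolded set_eq_iff, rule_format, of l] by auto
    have len: "i < length w" "j < length w"
      using mem[of i] mem[of j] by simp_all
    have eq: "\<forall>l < length w. w ! l = v \<longleftrightarrow> l = i \<or> l = j"
      using mem by metis
    have eq': "\<forall>l < length w. w ! l = v \<longleftrightarrow> l = j \<or> l = i"
      using mem by metis
    from ij(1) consider "i < j" | "j < i" by linarith
    then show ?thesis using len eq eq' by cases meson+
  qed
  then have "\<forall>v\<in>V. \<exists>p. fst p < snd p \<and> snd p < length w \<and> (\<forall>l < length w. w ! l = v \<longleftrightarrow> l = fst p \<or> l = snd p)"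
    by (metis fst_conv snd_conv)
  from bchoice[OF this] obtain p where
    p: "\<forall>v\<in>V. fst (p v) < snd (p v) \<and> snd (p v) < length w \<and>
      (\<forall>l < length w. w ! l = v \<longleftrightarrow> l = fst (p v) \<or> l = snd (p v))" ..
  define f where "f v = fst (p v)" for v
  define g where "g v = snd (p v)" for v
  have fg: "f v < g v" "g v < length w" if "v \<in> V" for v
    using p that by (simp_all add: f_def g_def)
  have nth: "w ! l = v \<longleftrightarrow> l = f v \<or> l = g v" if "v \<in> V" "l < length w" for v l
    using p that by (simp add: f_def g_def)
  have at: "w ! f v = v" "w ! g v = v" "f v < length w" if "v \<in> V" for v
    using nth[OF that] fg[OF that] by auto
  have dist: "f a \<noteq> f b" "f a \<noteq> g b" "g a \<noteq> f b" "g a \<noteq> g b" if "a \<in> V" "b \<in> V" "a \<noteq> b" for a b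
    using at that by metis+
  have alt: "alternate w a b \<longleftrightarrow>
     (f a < f b \<and> f b < g a \<or> f a < g b \<and> g b < g a) \<and> (f b < f a \<and> f a < g b \<or> f b < g a \<and> g a < g b)"
    if ab: "a \<in> V" "b \<in> V" "a \<noteq> b" for a b
  proof -
    have 1: "(\<forall>j < length w. \<forall>i < j. w ! i = a \<and> w ! j = a \<longrightarrow> (\<exists>l < j. i < l \<and> w ! l = b)) \<longleftrightarrow>
       (f a < f b \<and> f b < g a \<or> f a < g b \<and> g b < g a)" if ab: "a \<in> V" "b \<in> V" for a b
    proof
      assume "\<forall>j < length w. \<forall>i < j. w ! i = a \<and> w ! j = a \<longrightarrow> (\<exists>l < j. i < l \<and> w ! l = b)"
      then obtain l where l: "l < g a" "f a < l" "w ! l = b"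
        using fg[OF ab(1)] at[OF ab(1)] by blast
      then have "l = f b \<or> l = g b" using nth[OF ab(2), of l] fg[OF ab(1)] by simp
      then show "f a < f b \<and> f b < g a \<or> f a < g b \<and> g b < g a" using l by auto
    next
      assume R: "f a < f b \<and> f b < g a \<or> f a < g b \<and> g b < g a"
      show "\<forall>j < length w. \<forall>i < j. w ! i = a \<and> w ! j = a \<longrightarrow> (\<exists>l < j. i < l \<and> w ! l = b)"
      proof (intro allI impI)
        fix j i assume ij: "j < length w" "i < j" "w ! i = a \<and> w ! j = a"
        have "i = f a" "j = g a"
          using nth[OF ab(1), of i] nth[OF ab(1), of j] fg(1)[OF ab(1)] ij by auto
        then show "\<exists>l < j. i < l \<and> w ! l = b" using R at[OF ab(2)] by blast
      qed
    qed
    show ?thesis using alternate_iff_between[OF ab(3), of w] 1[of a b] 1[of b a] ab by simp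
  qed
  show ?thesis
  proof (rule that[of "\<lambda>v. (int (f v), int (g v))"])
    fix a b assume ab: "a \<in> V" "b \<in> V" "a \<noteq> b"
    have E: "E a b \<longleftrightarrow> alternate w a b" using rep ab by (simp add: represents_def)
    note d = dist[OF ab] fg(1)[OF ab(1)] fg(1)[OF ab(2)]
    show "crosses (int (f a), int (g a)) (int (f b), int (g b))" if "E a b"
      using that[unfolded E alt[OF ab]] d unfolding crosses_def fst_conv snd_conv by linarith
    show "misses (int (f a), int (g a)) (int (f b), int (g b))" if "\<not> E a b"
      using that[unfolded E alt[OF ab]] d unfolding misses_def fst_conv snd_conv by linarith
  qed (use fg in simp)
qed

section \<open>Parity of side changes in the four kinds of forbidden graphs\<close>

lemma no_chords_F0:
  assumes c: "\<And>i j. i < 5 \<Longrightarrow> j < 5 \<Longrightarrow> i \<noteq> j \<Longrightarrow> crosses (c i) (c (j :: nat))"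
    and a: "\<And>i. i \<in> {1..3} \<Longrightarrow> fst (a i) < snd (a (i :: nat))"
    and aa: "\<And>i j. i \<in> {1..3} \<Longrightarrow> j \<in> {1..3} \<Longrightarrow> i \<noteq> j \<Longrightarrow> misses (a i) (a j)"
    and ac: "\<And>j. j \<in> {0, 2, 3} \<Longrightarrow> crosses (a 1) (c j)" "\<And>j. j \<in> {1, 4} \<Longrightarrow> misses (a 1) (c j)"
      "\<And>j. j \<in> {0, 3, 4} \<Longrightarrow> crosses (a 2) (c j)" "\<And>j. j \<in> {1, 2} \<Longrightarrow> misses (a 2) (c j)"
      "\<And>j. j \<in> {0, 1, 4} \<Longrightarrow> crosses (a 3) (c j)" "\<And>j. j \<in> {2, 3} \<Longrightarrow> misses (a 3) (c j)"
  shows False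
proof -
  have "inside (c 1) (a 1) \<noteq> inside (c 1) (a 2)"
    by (rule overlapping_opposite_sides[of _ "c 2" "c 3" "c 4"]) (simp_all add: c ac a aa del: One_nat_def)
  moreover have "inside (c 2) (a 2) \<noteq> inside (c 2) (a 3)"
    by (rule overlapping_opposite_sides[of _ "c 3" "c 4" "c 1"]) (simp_all add: c ac a aa del: One_nat_def)
  \<comment> \<open>\<open>a 1\<close> and \<open>a 3\<close> share only \<open>c 0\<close>, the
    chord of \<open>Zero\<close>, and together meet all five clique chords. They are compared
    through \<open>a 2\<close>, which misses both \<open>c 1\<close> and \<open>c 2\<close>.\<close>
  moreover have "(inside (c 2) (a 3) = inside (c 2) (a 2)) \<noteq> (inside (c 1) (a 1) = inside (c 1) (a 2))"
    by (rule overlapping_sides_across[of _ _ "c 0"]) (simp_all add: c ac a aa del: One_nat_def)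
  ultimately show False by auto
qed

lemma no_chords_sun:
  fixes k :: nat
  assumes k: "even k" "4 \<le> k"
    and c: "\<And>i j. i \<in> {1..k} \<Longrightarrow> j \<in> {1..k} \<Longrightarrow> i \<noteq> j \<Longrightarrow> crosses (c i) (c j)"
    and a: "\<And>i. i \<in> {1..k} \<Longrightarrow> fst (a i) < snd (a i)"
    and aa: "\<And>i j. i \<in> {1..k} \<Longrightarrow> j \<in> {1..k} \<Longrightarrow> i \<noteq> j \<Longrightarrow> misses (a i) (a j)"
    and ac: "\<And>i j. i \<in> {1..k} \<Longrightarrow> j \<in> {1..k} \<Longrightarrow> j = i \<or> j = Suc i \<or> i = k \<and> j = 1 \<Longrightarrow> crosses (a i) (c j)"
      "\<And>i j. i \<in> {1..k} \<Longrightarrow> j \<in> {1..k} \<Longrightarrow> \<not> (j = i \<or> j = Suc i \<or> i = k \<and> j = 1) \<Longrightarrow> misses (a i) (c j)"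
  shows False
proof -
  have S: "inside (c d) (a i) \<noteq> inside (c d) (a (Suc i))"
    if "d \<in> {1..k}" "i \<in> {1..k}" "Suc (Suc i) \<le> k" "d \<noteq> i" "d \<noteq> Suc i" "d \<noteq> Suc (Suc i)" for d i
    by (rule overlapping_opposite_sides[of _ "c i" "c (Suc i)" "c (Suc (Suc i))"])
      (use that in \<open>auto simp del: One_nat_def intro!: c ac a aa\<close>)
  \<comment> \<open>The chords \<open>a 2\<close>, ..., \<open>a (k - 1)\<close> all miss
    \<open>c 1\<close>, so there are \<open>k - 3\<close> changes of side, an odd number.\<close>
  have "inside (c 1) (a (k - 1)) = inside (c 1) (a 2) \<longleftrightarrow> even (k - 1 - 2)"
    by (rule alternating_parity[where hi = "k - 1" and P = "\<lambda>i. inside (c 1) (a i)", OF S]) (use k in auto)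
  moreover have "odd (k - 1 - 2)" using k by auto
  ultimately have 1: "inside (c 1) (a (k - 1)) \<noteq> inside (c 1) (a 2)" by blast
  have 2: "inside (c k) (a 1) \<noteq> inside (c k) (a 2)" using S[of k 1] k by (simp add: numeral_2_eq_2)
  show False
    by (rule no_closing_chord[of "c 1" "c k" "c 2" "c (k - 1)" "a 1" "a (k - 1)" "a k" "a 2"])
      (use 1 2 k in \<open>auto simp del: One_nat_def intro!: c ac a aa\<close>)
qed

lemma no_chords_F1:
  fixes k :: nat
  assumes k: "odd k" "5 \<le> k"
    and c: "\<And>i j. i \<in> {1..k-1} \<Longrightarrow> j \<in> {1..k-1} \<Longrightarrow> i \<noteq> j \<Longrightarrow> crosses (c i) (c j)"
    and a: "\<And>i. i \<in> {1..k-2} \<Longrightarrow> fst (a i) < snd (a i)"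
    and aa: "\<And>i j. i \<in> {1..k-2} \<Longrightarrow> j \<in> {1..k-2} \<Longrightarrow> i \<noteq> j \<Longrightarrow> misses (a i) (a j)"
    and ac: "\<And>i j. i \<in> {1..k-2} \<Longrightarrow> j \<in> {1..k-1} \<Longrightarrow> j = i \<or> j = Suc i \<Longrightarrow> crosses (a i) (c j)"
      "\<And>i j. i \<in> {1..k-2} \<Longrightarrow> j \<in> {1..k-1} \<Longrightarrow> \<not> (j = i \<or> j = Suc i) \<Longrightarrow> misses (a i) (c j)"
    and b: "fst b1 < snd b1" "fst b2 < snd b2" "misses b1 b2" "misses b2 b1"
      "\<And>i. i \<in> {1..k-2} \<Longrightarrow> misses (a i) b1" "\<And>i. i \<in> {1..k-2} \<Longrightarrow> misses (a i) b2"
      "\<And>i. i \<in> {1..k-2} \<Longrightarrow> misses b2 (a i)"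
      "\<And>j. j \<in> {1..k-2} \<Longrightarrow> crosses b1 (c j)" "misses b1 (c (k - 1))"
      "\<And>j. j \<in> {2..k-1} \<Longrightarrow> crosses b2 (c j)" "misses b2 (c 1)"
  shows False
proof -
  define n where "n = k - 1"
  have n: "4 \<le> n" "even n" "k - 1 = n" "k - 2 = n - 1" using k by (auto simp: n_def)
  note c = c[unfolded n(3,4)] and a = a[unfolded n(3,4)] and aa = aa[unfolded n(3,4)]
    and ac = ac[unfolded n(3,4)] and b = b[unfolded n(3,4)]
  have S: "inside (c d) (a i) \<noteq> inside (c d) (a (Suc i))"
    if "d \<in> {1..n}" "i \<in> {1..n}" "Suc (Suc i) \<le> n" "d \<noteq> i" "d \<noteq> Suc i" "d \<noteq> Suc (Suc i)" for d i
    by (rule overlapping_opposite_sides[of _ "c i" "c (Suc i)" "c (Suc (Suc i))"])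
      (use that in \<open>auto simp del: One_nat_def intro!: c ac a aa\<close>)
  have e: "Suc 1 = 2" "Suc (n - 2) = n - 1" using n by auto
  have 1: "inside (c 1) (a (n - 1)) \<noteq> inside (c 1) (a (n - 2))"
    using S[of 1 "n - 2"] n e by auto
  have 2: "inside (c n) (a 1) \<noteq> inside (c n) (a 2)" using S[of n 1] n by (simp add: numeral_2_eq_2)
  have "inside (c n) (a (n - 2)) = inside (c n) (a 2) \<longleftrightarrow> even (n - 2 - 2)"
    by (rule alternating_parity[where hi = "n - 2" and P = "\<lambda>i. inside (c n) (a i)", OF S]) (use n in auto)
  then have 3: "inside (c n) (a (n - 2)) = inside (c n) (a 2)" using n by auto
  have 4: "(inside (c 1) (a (n - 1)) = inside (c 1) (a (n - 2))) \<noteq> (inside (c n) b1 = inside (c n) (a (n - 2)))"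
    by (rule overlapping_sides_across[of _ _ "c (n - 1)"]) (use n in \<open>auto simp del: One_nat_def intro!: c ac a aa b\<close>)
  have 5: "(inside (c 1) b2 = inside (c 1) (a 2)) \<noteq> (inside (c n) (a 1) = inside (c n) (a 2))"
    by (rule overlapping_sides_across[of _ _ "c 2"]) (use n in \<open>auto simp del: One_nat_def intro!: c ac a aa b\<close>)
  have 6: "(inside (c 1) b2 = inside (c 1) (a 2)) \<noteq> (inside (c n) b1 = inside (c n) (a 2))"
    by (rule overlapping_sides_across[of _ _ "c 2"]) (use n in \<open>auto simp del: One_nat_def intro!: c ac a aa b\<close>)
  \<comment> \<open>By \<open>1\<close> and \<open>4\<close>, \<open>b1\<close> is on the same side
    of \<open>c n\<close> as \<open>a (n - 2)\<close>; by \<open>2\<close>, \<open>5\<close> and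
    \<open>6\<close> it is opposite to \<open>a 2\<close>. But \<open>3\<close> puts
    \<open>a (n - 2)\<close> and \<open>a 2\<close> on the same side.\<close>
  show False using 1 2 3 4 5 6 by auto
qed

lemma no_chords_F2:
  fixes k :: nat
  assumes k: "odd k" "5 \<le> k"
    and c: "\<And>i j. i \<in> {1..k} \<Longrightarrow> j \<in> {1..k} \<Longrightarrow> i \<noteq> j \<Longrightarrow> crosses (c i) (c j)"
    and a: "\<And>i. i \<in> {1..k-1} \<Longrightarrow> fst (a i) < snd (a i)"
    and aa: "\<And>i j. i \<in> {1..k-1} \<Longrightarrow> j \<in> {1..k-1} \<Longrightarrow> i \<noteq> j \<Longrightarrow> misses (a i) (a j)"
    and ac: "\<And>i j. i \<in> {1..k-1} \<Longrightarrow> j \<in> {1..k} \<Longrightarrow> j = i \<or> j = Suc i \<Longrightarrow> crosses (a i) (c j)"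
      "\<And>i j. i \<in> {1..k-1} \<Longrightarrow> j \<in> {1..k} \<Longrightarrow> \<not> (j = i \<or> j = Suc i) \<Longrightarrow> misses (a i) (c j)"
    and b: "fst b < snd b" "\<And>i. i \<in> {1..k-1} \<Longrightarrow> misses (a i) b"
      "\<And>j. j \<in> {2..k-1} \<Longrightarrow> crosses b (c j)" "misses b (c 1)" "misses b (c k)"
  shows False
proof -
  have S: "inside (c d) (a i) \<noteq> inside (c d) (a (Suc i))"
    if "d \<in> {1..k}" "i \<in> {1..k}" "Suc (Suc i) \<le> k" "d \<noteq> i" "d \<noteq> Suc i" "d \<noteq> Suc (Suc i)" for d i
    by (rule overlapping_opposite_sides[of _ "c i" "c (Suc i)" "c (Suc (Suc i))"])
      (use that in \<open>auto simp del: One_nat_def intro!: c ac a aa\<close>)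
  have 1: "inside (c k) (a 1) \<noteq> inside (c k) b"
    by (rule overlapping_opposite_sides[of _ "c 1" "c 2" "c 3"]) (use k in \<open>auto simp del: One_nat_def intro!: c ac a aa b\<close>)
  have 2: "inside (c k) (a 1) \<noteq> inside (c k) (a 2)" using S[of k 1] k by (simp add: numeral_2_eq_2)
  have 3: "(inside (c 1) (a 2) = inside (c 1) b) = (inside (c k) (a 2) = inside (c k) b)"
    by (rule same_quadrant_sides[of _ _ "c 2"]) (use k in \<open>auto simp del: One_nat_def intro!: c ac a aa b\<close>)
  have "inside (c 1) (a (k - 1)) = inside (c 1) (a 2) \<longleftrightarrow> even (k - 1 - 2)"
    by (rule alternating_parity[where hi = "k - 1" and P = "\<lambda>i. inside (c 1) (a i)", OF S]) (use k in auto)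
  then have 4: "inside (c 1) (a (k - 1)) = inside (c 1) (a 2)" using k by auto
  have 5: "inside (c 1) (a (k - 1)) \<noteq> inside (c 1) b"
    by (rule overlapping_opposite_sides[of _ "c k" "c (k - 1)" "c (k - 2)"]) (use k in \<open>auto simp del: One_nat_def intro!: c ac a aa b\<close>)
  \<comment> \<open>By \<open>1\<close> and \<open>2\<close>, \<open>b\<close> and
    \<open>a 2\<close> are on the same side of \<open>c k\<close>; by \<open>4\<close> and
    \<open>5\<close> they are on opposite sides of \<open>c 1\<close>. This contradicts
    \<open>3\<close>.\<close>
  show False using 1 2 3 4 5 by auto
qed

section \<open>From induced copies to chord diagrams\<close>

definition chord_model :: "vtx set \<Rightarrow> vtx set \<Rightarrow> (vtx \<Rightarrow> vtx set) \<Rightarrow> (vtx \<Rightarrow> int \<times> int) \<Rightarrow> bool" where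
  "chord_model Cs Is N h \<longleftrightarrow>
     (\<forall>c\<in>Cs. \<forall>c'\<in>Cs. c \<noteq> c' \<longrightarrow> crosses (h c) (h c')) \<and> (\<forall>a\<in>Is. fst (h a) < snd (h a)) \<and>
     (\<forall>a\<in>Is. \<forall>a'\<in>Is. a \<noteq> a' \<longrightarrow> misses (h a) (h a')) \<and>
     (\<forall>a\<in>Is. \<forall>c\<in>Cs. (c \<in> N a \<longrightarrow> crosses (h a) (h c)) \<and> (c \<notin> N a \<longrightarrow> misses (h a) (h c)))"

lemma chord_modelD:
  assumes "chord_model Cs Is N h"
  shows "c \<in> Cs \<Longrightarrow> c' \<in> Cs \<Longrightarrow> c \<noteq> c' \<Longrightarrow> crosses (h c) (h c')"
    "a \<in> Is \<Longrightarrow> fst (h a) < snd (h a)"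
    "a \<in> Is \<Longrightarrow> a' \<in> Is \<Longrightarrow> a \<noteq> a' \<Longrightarrow> misses (h a) (h a')"
    "a \<in> Is \<Longrightarrow> c \<in> Cs \<Longrightarrow> c \<in> N a \<Longrightarrow> crosses (h a) (h c)"
    "a \<in> Is \<Longrightarrow> c \<in> Cs \<Longrightarrow> c \<notin> N a \<Longrightarrow> misses (h a) (h c)"
  using assms by (simp_all add: chord_model_def)

lemma induced_copy_chords:
  assumes copy: "has_induced_copy V E (sg_V Cs Is) (sg_E Cs Is N)" and disj: "Cs \<inter> Is = {}"
    and rep: "represents V E w" and uni: "uniform 2 V w"
  obtains h where "chord_model Cs Is N h"
proof (rule two_uniform_chords[OF rep uni])
  fix ch :: "'a \<Rightarrow> int \<times> int"
  assume ch: "\<And>v. v \<in> V \<Longrightarrow> fst (ch v) < snd (ch v)"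
    "\<And>a b. a \<in> V \<Longrightarrow> b \<in> V \<Longrightarrow> a \<noteq> b \<Longrightarrow> E a b \<Longrightarrow> crosses (ch a) (ch b)"
    "\<And>a b. a \<in> V \<Longrightarrow> b \<in> V \<Longrightarrow> a \<noteq> b \<Longrightarrow> \<not> E a b \<Longrightarrow> misses (ch a) (ch b)"
  from copy obtain f where "inj_on f (Cs \<union> Is) \<and> f ` (Cs \<union> Is) \<subseteq> V \<and>
      (\<forall>x\<in>Cs \<union> Is. \<forall>y\<in>Cs \<union> Is. x \<noteq> y \<longrightarrow> sg_E Cs Is N x y = E (f x) (f y))"
    unfolding has_induced_copy_def sg_V_def by (rule exE)
  then have f: "inj_on f (Cs \<union> Is)" "f ` (Cs \<union> Is) \<subseteq> V"
    "\<And>x y. x \<in> Cs \<union> Is \<Longrightarrow> y \<in> Cs \<union> Is \<Longrightarrow> x \<noteq> y \<Longrightarrow> sg_E Cs Is N x y \<longleftrightarrow> E (f x) (f y)"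
    by simp_all
  have cr: "crosses (ch (f x)) (ch (f y))" if "x \<in> Cs \<union> Is" "y \<in> Cs \<union> Is" "x \<noteq> y" "sg_E Cs Is N x y" for x y
    using that f by (intro ch(2)) (auto dest: inj_onD)
  have mi: "misses (ch (f x)) (ch (f y))" if "x \<in> Cs \<union> Is" "y \<in> Cs \<union> Is" "x \<noteq> y" "\<not> sg_E Cs Is N x y" for x y
    using that f by (intro ch(3)) (auto dest: inj_onD)
  have "chord_model Cs Is N (\<lambda>v. ch (f v))"
    unfolding chord_model_def
  proof (intro conjI ballI impI)
    show "fst (ch (f a)) < snd (ch (f a))" if "a \<in> Is" for a
      using that f(2) by (intro ch(1)) auto
  qed (use disj in \<open>auto intro!: cr mi simp: sg_E_def\<close>)
  then show ?thesis by (rule that)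
qed

lemma contains_C3_not_two_uniform:
  assumes c3: "contains_C3 V E" and rep: "represents V E w" and uni: "uniform 2 V w"
  shows False
  using c3 unfolding contains_C3_def
proof (elim disjE exE conjE)
  assume copy: "has_induced_copy V E (sg_V F0_C F0_I) (sg_E F0_C F0_I F0_N)"
  show False
  proof (rule induced_copy_chords[OF copy _ rep uni])
    show "F0_C \<inter> F0_I = {}" by (auto simp: F0_C_def F0_I_def)
    fix h assume "chord_model F0_C F0_I F0_N h"
    note h = chord_modelD[OF this]
    have I: "Av 1 \<in> F0_I" "Av 2 \<in> F0_I" "Av 3 \<in> F0_I" by (simp_all add: F0_I_def)
    have three: "i = 1 \<or> i = 2 \<or> i = 3" if "i \<in> {1..3}" for i :: nat using that by auto
    let ?c = "\<lambda>i. if i = 0 then Zero else Cv i"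
    have C: "?c i \<in> F0_C" if "i < 5" for i
      using that by (auto simp: F0_C_def less_Suc_eq numeral_eq_Suc)
    show False
    proof (rule no_chords_F0[of "\<lambda>i. h (?c i)" "\<lambda>i. h (Av i)"])
      fix i j :: nat assume "i < 5" "j < 5" "i \<noteq> j"
      then show "crosses (h (?c i)) (h (?c j))" using C by (intro h(1)) auto
    next
      fix i :: nat assume "i \<in> {1..3}"
      then show "fst (h (Av i)) < snd (h (Av i))" using I three by (intro h(2)) metis
    next
      fix i j :: nat assume "i \<in> {1..3}" "j \<in> {1..3}" "i \<noteq> j"
      then show "misses (h (Av i)) (h (Av j))" using I three by (intro h(3)) (metis, metis, simp)
    qed (auto intro!: h(4,5) I simp: F0_C_def F0_N_def simp del: One_nat_def)
  qed
next
  fix k assume k: "even k" "4 \<le> k"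
    and copy: "has_induced_copy V E (sg_V (sun_C k) (sun_I k)) (sg_E (sun_C k) (sun_I k) (sun_N k))"
  show False
  proof (rule induced_copy_chords[OF copy _ rep uni])
    show "sun_C k \<inter> sun_I k = {}" by (auto simp: sun_C_def sun_I_def)
    fix h assume "chord_model (sun_C k) (sun_I k) (sun_N k) h"
    note h = chord_modelD[OF this]
    have C: "Cv i \<in> sun_C k" and I: "Av i \<in> sun_I k" if "i \<in> {1..k}" for i
      using that by (auto simp: sun_C_def sun_I_def)
    have N: "Cv j \<in> sun_N k (Av i) \<longleftrightarrow> j = i \<or> j = Suc i \<or> i = k \<and> j = 1" if "i \<in> {1..k}" "j \<in> {1..k}" for i j
      using that k by (auto simp: sun_N_def)
    have "crosses (h (Cv i)) (h (Cv j))" if "i \<in> {1..k}" "j \<in> {1..k}" "i \<noteq> j" for i j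
      using that by (intro h(1) C) simp_all
    moreover have "fst (h (Av i)) < snd (h (Av i))" if "i \<in> {1..k}" for i
      using that by (intro h(2) I)
    moreover have "misses (h (Av i)) (h (Av j))" if "i \<in> {1..k}" "j \<in> {1..k}" "i \<noteq> j" for i j
      using that by (intro h(3) I) simp_all
    moreover have "crosses (h (Av i)) (h (Cv j))" if "i \<in> {1..k}" "j \<in> {1..k}" "j = i \<or> j = Suc i \<or> i = k \<and> j = 1" for i j
      using that N[OF that(1,2)] by (intro h(4) I C) simp_all
    moreover have "misses (h (Av i)) (h (Cv j))" if "i \<in> {1..k}" "j \<in> {1..k}" "\<not> (j = i \<or> j = Suc i \<or> i = k \<and> j = 1)" for i j
      using that N[OF that(1,2)] by (intro h(5) I C) simp_all
    ultimately show False
      by (rule no_chords_sun[of k "\<lambda>i. h (Cv i)" "\<lambda>i. h (Av i)", OF k])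
  qed
next
  fix k assume k: "odd k" "5 \<le> k"
    and copy: "has_induced_copy V E (sg_V (F1_C k) (F1_I k)) (sg_E (F1_C k) (F1_I k) (F1_N k))"
  show False
  proof (rule induced_copy_chords[OF copy _ rep uni])
    show "F1_C k \<inter> F1_I k = {}" by (auto simp: F1_C_def F1_I_def)
    fix h assume "chord_model (F1_C k) (F1_I k) (F1_N k) h"
    note h = chord_modelD[OF this]
    have C: "Cv i \<in> F1_C k" if "i \<in> {1..k-1}" for i
      using that by (auto simp: F1_C_def)
    have I: "Av i \<in> F1_I k" if "i \<in> {1..k-2}" for i
      using that by (auto simp: F1_I_def)
    have B: "Bv 1 \<in> F1_I k" "Bv 2 \<in> F1_I k" by (auto simp: F1_I_def)
    have N: "Cv j \<in> F1_N k (Av i) \<longleftrightarrow> j = i \<or> j = Suc i" if "i \<in> {1..k-2}" "j \<in> {1..k-1}" for i j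
      using that k by (auto simp: F1_N_def)
    have NB: "Cv j \<in> F1_N k (Bv 1) \<longleftrightarrow> j \<in> {1..k-2}" "Cv j \<in> F1_N k (Bv 2) \<longleftrightarrow> j \<in> {2..k-1}" for j
      by (auto simp: F1_N_def)
    have "crosses (h (Cv i)) (h (Cv j))" if "i \<in> {1..k-1}" "j \<in> {1..k-1}" "i \<noteq> j" for i j
      using that by (intro h(1) C) simp_all
    moreover have "fst (h (Av i)) < snd (h (Av i))" if "i \<in> {1..k-2}" for i
      using that by (intro h(2) I)
    moreover have "misses (h (Av i)) (h (Av j))" if "i \<in> {1..k-2}" "j \<in> {1..k-2}" "i \<noteq> j" for i j
      using that by (intro h(3) I) simp_all
    moreover have "crosses (h (Av i)) (h (Cv j))" if "i \<in> {1..k-2}" "j \<in> {1..k-1}" "j = i \<or> j = Suc i" for i j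
      using that N[OF that(1,2)] by (intro h(4) I C) simp_all
    moreover have "misses (h (Av i)) (h (Cv j))" if "i \<in> {1..k-2}" "j \<in> {1..k-1}" "\<not> (j = i \<or> j = Suc i)" for i j
      using that N[OF that(1,2)] by (intro h(5) I C) simp_all
    moreover have "fst (h (Bv 1)) < snd (h (Bv 1))" "fst (h (Bv 2)) < snd (h (Bv 2))"
      "misses (h (Bv 1)) (h (Bv 2))" "misses (h (Bv 2)) (h (Bv 1))"
      using B by (auto intro!: h(2,3) simp del: One_nat_def)
    moreover have "misses (h (Av i)) (h (Bv 1))" "misses (h (Av i)) (h (Bv 2))" "misses (h (Bv 2)) (h (Av i))"
      if "i \<in> {1..k-2}" for i
      using B I[OF that] by (auto intro!: h(3) simp del: One_nat_def)
    moreover have "crosses (h (Bv 1)) (h (Cv j))" if "j \<in> {1..k-2}" for j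
      using B that NB k by (intro h(4) C) auto
    moreover have "misses (h (Bv 1)) (h (Cv (k - 1)))"
      using B NB(1)[of "k - 1"] k by (intro h(5) C) auto
    moreover have "crosses (h (Bv 2)) (h (Cv j))" if "j \<in> {2..k-1}" for j
      using B that NB(2)[of j] k by (intro h(4) C) auto
    moreover have "misses (h (Bv 2)) (h (Cv 1))"
      using B NB(2)[of 1] k by (intro h(5) C) auto
    ultimately show False
      by (rule no_chords_F1[of k "\<lambda>i. h (Cv i)" "\<lambda>i. h (Av i)" "h (Bv 1)" "h (Bv 2)", OF k])
  qed
next
  fix k assume k: "odd k" "5 \<le> k"
    and copy: "has_induced_copy V E (sg_V (F2_C k) (F2_I k)) (sg_E (F2_C k) (F2_I k) (F2_N k))"
  show False
  proof (rule induced_copy_chords[OF copy _ rep uni])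
    show "F2_C k \<inter> F2_I k = {}" by (auto simp: F2_C_def F2_I_def)
    fix h assume "chord_model (F2_C k) (F2_I k) (F2_N k) h"
    note h = chord_modelD[OF this]
    have C: "Cv i \<in> F2_C k" if "i \<in> {1..k}" for i
      using that by (auto simp: F2_C_def)
    have I: "Av i \<in> F2_I k" if "i \<in> {1..k-1}" for i
      using that by (auto simp: F2_I_def)
    have B: "Bv 1 \<in> F2_I k" by (auto simp: F2_I_def)
    have N: "Cv j \<in> F2_N k (Av i) \<longleftrightarrow> j = i \<or> j = Suc i" if "i \<in> {1..k-1}" "j \<in> {1..k}" for i j
      using that k by (auto simp: F2_N_def)
    have NB: "Cv j \<in> F2_N k (Bv 1) \<longleftrightarrow> j \<in> {2..k-1}" for j
      by (auto simp: F2_N_def)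
    have "crosses (h (Cv i)) (h (Cv j))" if "i \<in> {1..k}" "j \<in> {1..k}" "i \<noteq> j" for i j
      using that by (intro h(1) C) simp_all
    moreover have "fst (h (Av i)) < snd (h (Av i))" if "i \<in> {1..k-1}" for i
      using that by (intro h(2) I)
    moreover have "misses (h (Av i)) (h (Av j))" if "i \<in> {1..k-1}" "j \<in> {1..k-1}" "i \<noteq> j" for i j
      using that by (intro h(3) I) simp_all
    moreover have "crosses (h (Av i)) (h (Cv j))" if "i \<in> {1..k-1}" "j \<in> {1..k}" "j = i \<or> j = Suc i" for i j
      using that N[OF that(1,2)] by (intro h(4) I C) simp_all
    moreover have "misses (h (Av i)) (h (Cv j))" if "i \<in> {1..k-1}" "j \<in> {1..k}" "\<not> (j = i \<or> j = Suc i)" for i j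
      using that N[OF that(1,2)] by (intro h(5) I C) simp_all
    moreover have "fst (h (Bv 1)) < snd (h (Bv 1))"
      using B by (rule h(2))
    moreover have "misses (h (Av i)) (h (Bv 1))" if "i \<in> {1..k-1}" for i
      using B I[OF that] by (auto intro!: h(3) simp del: One_nat_def)
    moreover have "crosses (h (Bv 1)) (h (Cv j))" if "j \<in> {2..k-1}" for j
      using B that NB[of j] k by (intro h(4) C) auto
    moreover have "misses (h (Bv 1)) (h (Cv 1))" "misses (h (Bv 1)) (h (Cv k))"
      using B NB[of 1] NB[of k] k by (auto intro!: h(5) C simp del: One_nat_def)
    ultimately show False
      by (rule no_chords_F2[of k "\<lambda>i. h (Cv i)" "\<lambda>i. h (Av i)" "h (Bv 1)", OF k])
  qed
qed

lemma contains_C3_nonadjacent: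
  assumes "contains_C3 V E"
  obtains a b where "a \<in> V" "b \<in> V" "a \<noteq> b" "\<not> E a b"
proof -
  note found = that
  have *: thesis if copy: "has_induced_copy V E (sg_V Cs Is) (sg_E Cs Is N)" and "Cs \<inter> Is = {}"
    and "Av 1 \<in> Is" "Av 2 \<in> Is" for Cs Is N
  proof -
    from copy obtain f where "inj_on f (Cs \<union> Is) \<and> f ` (Cs \<union> Is) \<subseteq> V \<and>
        (\<forall>x\<in>Cs \<union> Is. \<forall>y\<in>Cs \<union> Is. x \<noteq> y \<longrightarrow> sg_E Cs Is N x y = E (f x) (f y))"
      unfolding has_induced_copy_def sg_V_def by (rule exE)
    then have f: "inj_on f (Cs \<union> Is)" "f ` (Cs \<union> Is) \<subseteq> V"
      "\<And>x y. x \<in> Cs \<union> Is \<Longrightarrow> y \<in> Cs \<union> Is \<Longrightarrow> x \<noteq> y \<Longrightarrow> sg_E Cs Is N x y \<longleftrightarrow> E (f x) (f y)"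
      by simp_all
    show thesis
    proof (rule found)
      show "f (Av 1) \<in> V" "f (Av 2) \<in> V" using f(2) \<open>Av 1 \<in> Is\<close> \<open>Av 2 \<in> Is\<close> by auto
      show "f (Av 1) \<noteq> f (Av 2)" using inj_onD[OF f(1), of "Av 1" "Av 2"] \<open>Av 1 \<in> Is\<close> \<open>Av 2 \<in> Is\<close> by auto
      have "\<not> sg_E Cs Is N (Av 1) (Av 2)"
        using \<open>Av 1 \<in> Is\<close> \<open>Av 2 \<in> Is\<close> \<open>Cs \<inter> Is = {}\<close> by (auto simp: sg_E_def)
      then show "\<not> E (f (Av 1)) (f (Av 2))"
        using f(3)[of "Av 1" "Av 2"] \<open>Av 1 \<in> Is\<close> \<open>Av 2 \<in> Is\<close> by auto
    qed
  qed
  show thesis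
    using assms unfolding contains_C3_def
  proof (elim disjE exE conjE)
    assume "has_induced_copy V E (sg_V F0_C F0_I) (sg_E F0_C F0_I F0_N)"
    then show thesis by (rule *) (auto simp: F0_C_def F0_I_def)
  next
    fix k :: nat assume "4 \<le> k"
      "has_induced_copy V E (sg_V (sun_C k) (sun_I k)) (sg_E (sun_C k) (sun_I k) (sun_N k))"
    then show thesis by (elim *) (auto simp: sun_C_def sun_I_def)
  next
    fix k :: nat assume "5 \<le> k"
      "has_induced_copy V E (sg_V (F1_C k) (F1_I k)) (sg_E (F1_C k) (F1_I k) (F1_N k))"
    then show thesis by (elim *) (auto simp: F1_C_def F1_I_def)
  next
    fix k :: nat assume "5 \<le> k"
      "has_induced_copy V E (sg_V (F2_C k) (F2_I k)) (sg_E (F2_C k) (F2_I k) (F2_N k))"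
    then show thesis by (elim *) (auto simp: F2_C_def F2_I_def)
  qed
qed

text \<open>No letter is repeated, so any two letters alternate vacuously.\<close>

lemma uniform_less_two_complete:
  assumes rep: "represents V E w" and uni: "uniform k V w" and k: "k < 2"
    and ab: "a \<in> V" "b \<in> V" "a \<noteq> b"
  shows "E a b"
proof -
  have no: "\<not> (i < j \<and> j < length w \<and> w ! i = v \<and> w ! j = v)" if "v \<in> V" for v i j
  proof
    assume ij: "i < j \<and> j < length w \<and> w ! i = v \<and> w ! j = v"
    have "card {l. l < length w \<and> v = w ! l} = k"
      using uni that by (simp add: uniform_def count_list_eq_length_filter length_filter_conv_card)
    moreover have "card {i, j} \<le> card {l. l < length w \<and> v = w ! l}"
      by (rule card_mono) (use ij in auto)
    ultimately show False using ij k by simp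
  qed
  have "alternate w a b"
    unfolding alternate_iff_between[OF ab(3)] using no ab by blast
  then show ?thesis using rep ab by (simp add: represents_def)
qed

section \<open>The circular arrangement of neighbourhoods\<close>

text \<open>Proper overlap of the half-open intervals from \<open>u\<close> to \<open>u + a\<close>
  and from \<open>v\<close> to \<open>v + b\<close>. The inequalities are strict because a common
  end can be resolved inside its gap without a crossing.\<close>

definition overlap :: "int \<Rightarrow> int \<Rightarrow> int \<Rightarrow> int \<Rightarrow> bool" where
  "overlap u a v b \<longleftrightarrow> u < v \<and> v < u + a \<and> u + a < v + b \<or> v < u \<and> u < v + b \<and> v + b < u + a"

text \<open>\<open>cc\<close> runs through \<open>C\<close> cyclically with period \<open>m\<close>, and a lift of \<open>x\<close> is an integer
  \<open>u \<equiv> s x\<close> modulo \<open>m\<close>: the arc \<open>N(x)\<close> is the image of the half-open interval from \<open>u\<close> to \<open>u + len x\<close>,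
  so lifts and interval ends are gaps between clique vertices.\<close>
locale circular_arcs =
  fixes C I :: "'a set" and E :: "'a \<Rightarrow> 'a \<Rightarrow> bool" and m :: int
    and cc :: "int \<Rightarrow> 'a" and s len :: "'a \<Rightarrow> int"
  assumes m_pos: "0 < m" and finite_I: "finite I" and disj: "C \<inter> I = {}"
    and clique: "is_clique E C" and indep: "is_indep E I"
    and sym: "\<And>a b. a \<in> C \<union> I \<Longrightarrow> b \<in> C \<union> I \<Longrightarrow> E a b \<Longrightarrow> E b a"
    and cc_eq: "\<And>z z'. cc z = cc z' \<longleftrightarrow> m dvd z - z'" and cc_range: "range cc = C"
    and len: "\<And>x. x \<in> I \<Longrightarrow> 0 \<le> len x \<and> len x < m"
    and adj: "\<And>x z. x \<in> I \<Longrightarrow> E x (cc z) \<longleftrightarrow> (\<exists>u. m dvd u - s x \<and> u < z \<and> z \<le> u + len x)"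
    and one_sided: "\<And>x y u v. x \<in> I \<Longrightarrow> y \<in> I \<Longrightarrow> m dvd u - s y \<Longrightarrow> m dvd v - s y \<Longrightarrow>
       overlap (s x) (len x) u (len y) \<Longrightarrow> overlap (s x) (len x) v (len y) \<Longrightarrow> u = v"

lemma cnt_eq_0:
  assumes "\<And>i. i < n \<Longrightarrow> i < length w \<Longrightarrow> w ! i \<noteq> c"
  shows "cnt w c n = 0"
proof -
  have "c \<notin> set (take n w)" using assms by (auto simp: in_set_conv_nth)
  then show ?thesis by (simp add: cnt_def)
qed

text \<open>Enumerating the clique by first occurrences makes the offset of alternation zero for
  every ordered pair. This is the counting form of the fact that the word restricted to
  \<open>C\<close> repeats one permutation.\<close>

lemma clique_enumeration:
  assumes rep: "represents V E w" and CV: "C \<subseteq> V" and cl: "is_clique E C"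
  obtains cs :: "nat \<Rightarrow> 'a" where "bij_betw cs {..<card C} C"
    "\<And>i j n. i < j \<Longrightarrow> j < card C \<Longrightarrow> cnt w (cs j) n \<le> cnt w (cs i) n \<and> cnt w (cs i) n \<le> cnt w (cs j) n + 1"
proof -
  have fin: "finite C" using rep CV by (metis List.finite_set finite_subset represents_def)
  define fo where "fo c = (LEAST i. i < length w \<and> w ! i = c)" for c
  have fo: "fo c < length w \<and> w ! fo c = c" if "c \<in> C" for c
  proof -
    have "\<exists>i. i < length w \<and> w ! i = c"
      using that CV rep by (metis in_set_conv_nth represents_def subsetD)
    from LeastI_ex[OF this] show ?thesis unfolding fo_def .
  qed
  have first: "w ! i \<noteq> c" if "i < fo c" "i < length w" for c i
    using not_less_Least[OF that(1)[unfolded fo_def]] that(2) by blast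
  have inj: "inj_on fo C" by (rule inj_onI) (metis fo)
  define ks where "ks = sorted_list_of_set (fo ` C)"
  have ks: "sorted_wrt (<) ks" "set ks = fo ` C" "distinct ks" "length ks = card C"
    using fin inj by (simp_all add: ks_def card_image)
  define cs where "cs i = w ! (ks ! i)" for i
  have fo_cs: "fo (cs i) = ks ! i \<and> cs i \<in> C" if "i < card C" for i
  proof -
    have "ks ! i \<in> fo ` C" using that ks(2,4) nth_mem by metis
    then show ?thesis using fo by (auto simp: cs_def)
  qed
  have bij: "bij_betw cs {..<card C} C"
    unfolding bij_betw_def
  proof
    show "inj_on cs {..<card C}"
      using fo_cs ks(3,4) by (intro inj_onI) (metis lessThan_iff nth_eq_iff_index_eq)
    show "cs ` {..<card C} = C"
    proof
      show "cs ` {..<card C} \<subseteq> C" using fo_cs by blast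
      show "C \<subseteq> cs ` {..<card C}"
      proof
        fix c assume c: "c \<in> C"
        then obtain i where "i < card C" "ks ! i = fo c" using ks(2,4) by (metis image_eqI in_set_conv_nth)
        then show "c \<in> cs ` {..<card C}" using fo[OF c] by (auto simp: cs_def intro!: image_eqI[of _ _ i])
      qed
    qed
  qed
  show ?thesis
  proof (rule that[OF bij])
    fix i j n assume ij: "i < j" "j < card C"
    let ?c = "cs i" and ?d = "cs j"
    have c: "?c \<in> C" "?d \<in> C" "fo ?c = ks ! i" "fo ?d = ks ! j" using fo_cs ij by simp_all
    have less: "fo ?c < fo ?d" using c ij ks(1,4) by (simp add: sorted_wrt_nth_less)
    then have "?c \<noteq> ?d" by auto
    moreover from this have "E ?c ?d" using c(1,2) cl by (simp add: is_clique_def)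
    ultimately have "alternate w ?c ?d" using c(1,2) rep CV unfolding represents_def by blast
    from this[unfolded alternate_iff_cnt[OF \<open>?c \<noteq> ?d\<close>]] obtain q where q: "\<And>n. cnt w ?d n \<le> cnt w ?c n + q \<and> cnt w ?c n + q \<le> cnt w ?d n + 1" by blast
    \<comment> \<open>Right after the first \<open>cs i\<close> the letter \<open>cs j\<close> is
      still absent, which rules out the offset 1.\<close>
    have d0: "cnt w ?d (Suc (fo ?c)) = 0" using first less by (intro cnt_eq_0) force
    have "take (Suc (fo ?c)) w = take (fo ?c) w @ [?c]"
      using fo[OF c(1)] by (simp add: take_Suc_conv_app_nth)
    then have "cnt w ?c (Suc (fo ?c)) \<ge> 1" by (simp add: cnt_def)
    then have "q = 0" using q[of "Suc (fo ?c)"] q[of 0] d0 by simp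
    then show "cnt w ?d n \<le> cnt w ?c n \<and> cnt w ?c n \<le> cnt w ?d n + 1" using q[of n] by simp
  qed
qed

lemma switch_up:
  fixes a b :: int
  assumes "P a" "\<not> P b" "a < b"
  obtains v where "a \<le> v" "v < b" "\<And>z. a \<le> z \<Longrightarrow> z \<le> v \<Longrightarrow> P z" "\<not> P (v + 1)"
proof -
  define k where "k = (LEAST k. \<not> P (a + int k))"
  have ex: "\<not> P (a + int (nat (b - a)))" using assms by simp
  have k: "\<not> P (a + int k)" unfolding k_def using ex by (rule LeastI)
  have kmin: "P (a + int j)" if "j < k" for j using not_less_Least[OF that[unfolded k_def]] by blast
  have kb: "k \<le> nat (b - a)" unfolding k_def using ex by (rule Least_le)
  have k0: "k \<noteq> 0" using k assms(1) by (metis add_0_right of_nat_0)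
  show ?thesis
  proof (rule that[of "a + int k - 1"])
    fix z assume "a \<le> z" "z \<le> a + int k - 1"
    then show "P z" using kmin[of "nat (z - a)"] by simp
  qed (use k k0 kb assms(3) in auto)
qed

text \<open>If the pattern in, out, in, out does not occur within a period, the set is entered and
  left at most once per turn. The point \<open>z0\<close> outside guarantees a place
  \<open>u\<close> of entry.\<close>

lemma cyclic_interval:
  fixes m :: int
  assumes m: "0 < m" and per: "\<And>z z'. m dvd z - z' \<Longrightarrow> P z = P z'" and ex: "\<not> P z0"
    and pat: "\<And>a b c d. a < b \<Longrightarrow> b < c \<Longrightarrow> c < d \<Longrightarrow> d < a + m \<Longrightarrow> P a \<Longrightarrow> P c \<Longrightarrow> P b \<or> P d"
  obtains u l where "0 \<le> l" "l < m" "\<And>z. P z \<longleftrightarrow> (\<exists>k. m dvd k - u \<and> k < z \<and> z \<le> k + l)"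
proof (cases "\<exists>p. P p")
  case False
  then show ?thesis using m by (intro that[of 0]) auto
next
  case True
  then obtain p where p: "P p" by blast
  \<comment> \<open>A translate of \<open>p\<close> by whole periods that lies beyond
    \<open>z0\<close>, so that some entry happens between \<open>z0\<close> and
    \<open>p'\<close>.\<close>
  define p' where "p' = p + m * (\<bar>z0\<bar> + \<bar>p\<bar> + 1)"
  have "p' \<ge> p + 1 * (\<bar>z0\<bar> + \<bar>p\<bar> + 1)"
    unfolding p'_def using m by (intro add_left_mono mult_right_mono) auto
  then have "z0 < p'" by (smt (verit) mult_1)
  moreover have "P p'" using per[of p' p] p by (simp add: p'_def)
  ultimately obtain u where u: "\<not> P u" "P (u + 1)"
    using switch_up[of "\<lambda>z. \<not> P z" z0 p'] ex by (metis order_refl)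
  have um: "\<not> P (u + m)" using per[of "u + m" u] u by simp
  have "m \<noteq> 1" using u um by auto
  then have "u + 1 < u + m" using m by linarith
  then obtain v where v: "u + 1 \<le> v" "v < u + m" "\<And>z. u + 1 \<le> z \<Longrightarrow> z \<le> v \<Longrightarrow> P z" "\<not> P (v + 1)"
    using switch_up[of P "u + 1" "u + m"] u um by metis
  have win: "P z \<longleftrightarrow> z \<le> v" if "u < z" "z \<le> u + m" for z
  proof
    assume "P z"
    show "z \<le> v"
    proof (rule ccontr)
      assume "\<not> z \<le> v"
      then have "v + 1 < z" "z < u + m" using that \<open>P z\<close> v um by (metis not_less zle_add1_eq_le order_le_less)+
      then show False using pat[of "u + 1" "v + 1" z "u + m"] v u um \<open>P z\<close> by auto
    qed
  qed (use v that in auto)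
  show ?thesis
  proof (rule that[of "v - u" u])
    fix z
    show "P z \<longleftrightarrow> (\<exists>k. m dvd k - u \<and> k < z \<and> z \<le> k + (v - u))"
    proof
      assume "P z"
      define z' where "z' = u + 1 + (z - u - 1) mod m"
      have z': "u < z'" "z' \<le> u + m"
        unfolding z'_def using pos_mod_sign[OF m, of "z - u - 1"] pos_mod_bound[OF m, of "z - u - 1"] by linarith+
      have dv: "m dvd z - z'"
        unfolding z'_def by (metis add.commute diff_diff_eq dvd_minus_mod)
      then have "z' \<le> v" using per[of z z'] \<open>P z\<close> win[OF z'] by simp
      then show "\<exists>k. m dvd k - u \<and> k < z \<and> z \<le> k + (v - u)"
        using z' dv by (intro exI[of _ "u + (z - z')"]) auto
    next
      assume "\<exists>k. m dvd k - u \<and> k < z \<and> z \<le> k + (v - u)"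
      then obtain k where k: "m dvd k - u" "k < z" "z \<le> k + (v - u)" by blast
      have "P (z - k + u)" using v(3)[of "z - k + u"] k by simp
      then show "P z" using per[of z "z - k + u"] k(1) by (simp add: algebra_simps)
    qed
  qed (use v in auto)
qed

text \<open>Think of \<open>G1\<close>, ..., \<open>G4\<close> as normalised counts of clique
  vertices in cyclic order and of \<open>X\<close> as the count of a vertex adjacent to the first
  and the third. The order of the two offsets decides which way round the neighbourhood runs: in the
  first case the offset also serves the second clique vertex, in the other case the fourth.\<close>

lemma bracket_either:
  fixes X :: "nat \<Rightarrow> int"
  assumes G: "\<And>n. G2 n \<le> G1 n \<and> G3 n \<le> G2 n \<and> G4 n \<le> G3 n \<and> G1 n - 1 \<le> G4 n"
    and q1: "\<And>n. G1 n \<le> X n + q1 \<and> X n + q1 \<le> G1 n + 1"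
    and q3: "\<And>n. G3 n \<le> X n + q3 \<and> X n + q3 \<le> G3 n + 1"
  shows "(\<exists>q. \<forall>n. G1 n \<le> X n + q \<and> X n + q \<le> G3 n + 1) \<or> (\<exists>q. \<forall>n. G3 n \<le> X n + q \<and> X n + q \<le> G1 n)"
proof -
  have "q1 \<le> q3 \<or> q1 \<ge> q3 + 1" by linarith
  then show ?thesis
  proof
    assume q: "q1 \<le> q3"
    have "G1 n \<le> X n + q1 \<and> X n + q1 \<le> G3 n + 1" for n
      using q1[of n] q3[of n] G[of n] q by linarith
    then show ?thesis by blast
  next
    assume q: "q1 \<ge> q3 + 1"
    have "G3 n \<le> X n + q3 \<and> X n + q3 \<le> G1 n" for n
      using q1[of n] q3[of n] G[of n] q by linarith
    then show ?thesis by blast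
  qed
qed

lemma circular_arcs_exist:
  assumes rep: "represents V E w" and sg: "simple_graph V E"
    and CI: "C \<union> I = V" "C \<inter> I = {}" and cl: "is_clique E C" and ind: "is_indep E I"
    and C0: "C \<noteq> {}" and maxi: "\<And>x. x \<in> I \<Longrightarrow> \<exists>c\<in>C. \<not> E x c"
  obtains m cc s len where "circular_arcs C I E m cc s len"
proof -
  have finV: "finite V" using sg by (simp add: simple_graph_def)
  have fin: "finite C" "finite I" using finV CI by auto
  obtain cs :: "nat \<Rightarrow> 'a" where bij: "bij_betw cs {..<card C} C"
    and mono: "\<And>i j n. i < j \<Longrightarrow> j < card C \<Longrightarrow>
      cnt w (cs j) n \<le> cnt w (cs i) n \<and> cnt w (cs i) n \<le> cnt w (cs j) n + 1"
    by (rule clique_enumeration[OF rep _ cl]) (use CI in blast)+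
  define m where "m = int (card C)"
  have m: "0 < m" using C0 fin by (simp add: m_def card_gt_0_iff)
  define cc where "cc z = cs (nat (z mod m))" for z
  have idx: "nat (z mod m) < card C" for z
    using m pos_mod_bound[of m z] pos_mod_sign[of m z] by (simp add: m_def nat_less_iff)
  have cc_eq: "cc z = cc z' \<longleftrightarrow> m dvd z - z'" for z z'
  proof -
    have "cc z = cc z' \<longleftrightarrow> nat (z mod m) = nat (z' mod m)"
      using bij idx unfolding cc_def by (metis bij_betw_imp_inj_on inj_on_eq_iff lessThan_iff)
    also have "\<dots> \<longleftrightarrow> z mod m = z' mod m" using m by (simp add: eq_nat_nat_iff)
    finally show ?thesis by (simp add: mod_eq_dvd_iff)
  qed
  have cc_range: "range cc = C"
  proof
    show "range cc \<subseteq> C" using bij idx unfolding cc_def bij_betw_def by blast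
    show "C \<subseteq> range cc"
    proof
      fix c assume "c \<in> C"
      then obtain i where i: "i < card C" "cs i = c" using bij unfolding bij_betw_def by (metis imageE lessThan_iff)
      then have "cc (int i) = c" by (simp add: cc_def m_def)
      then show "c \<in> range cc" by blast
    qed
  qed
  have ccC: "cc z \<in> C" for z using cc_range by blast
  \<comment> \<open>Subtracting the number of completed turns makes the prefix counts antitone in \<open>z\<close> on all of
    the integers, so no rotation of the cycle has to be singled out.\<close>
  define G where "G z n = cnt w (cc z) n - z div m" for z n
  have cmono: "cnt w (cs j) n \<le> cnt w (cs i) n \<and> cnt w (cs i) n \<le> cnt w (cs j) n + 1"
    if "i \<le> j" "j < card C" for i j n
    using that mono[of i j n] by (cases "i = j") auto
  have anti: "G z' n \<le> G z n" if "z \<le> z'" for z z' n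
  proof (cases "z div m = z' div m")
    case True
    then have "z mod m \<le> z' mod m" using that by (metis add_le_cancel_left mult_div_mod_eq)
    then have "nat (z mod m) \<le> nat (z' mod m)" by simp
    then show ?thesis unfolding G_def cc_def using True cmono idx by (metis diff_right_mono)
  next
    case False
    then have d: "z div m + 1 \<le> z' div m" using that m by (metis zdiv_mono1 order_le_less zless_imp_add1_zle)
    have "cnt w (cc z') n \<le> cnt w (cc z) n + 1"
      unfolding cc_def using cmono idx by (metis add_increasing2 linorder_le_cases zero_le_one)
    then show ?thesis unfolding G_def using d by linarith
  qed
  have per: "G (z + m) n = G z n - 1" for z n
  proof -
    have "cc (z + m) = cc z" by (simp add: cc_eq)
    then show ?thesis using m by (simp add: G_def div_add_self2)
  qed
  have lower: "G z n - 1 \<le> G z' n" if "z' \<le> z + m" for z z' n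
    using anti[OF that, of n] per[of z n] by simp
  have alt: "E x (cc z) \<longleftrightarrow> (\<exists>q. \<forall>n. G z n \<le> cnt w x n + q \<and> cnt w x n + q \<le> G z n + 1)"
    if x: "x \<in> I" for x z
  proof -
    have ne: "x \<noteq> cc z" using CI ccC x by blast
    have "E x (cc z) \<longleftrightarrow> alternate w x (cc z)"
      using rep x ccC[of z] ne CI by (auto simp: represents_def)
    also have "\<dots> \<longleftrightarrow> (\<exists>q. \<forall>n. cnt w (cc z) n \<le> cnt w x n + q \<and> cnt w x n + q \<le> cnt w (cc z) n + 1)"
      by (rule alternate_iff_cnt[OF ne])
    also have "\<dots> \<longleftrightarrow> (\<exists>q. \<forall>n. G z n \<le> cnt w x n + q \<and> cnt w x n + q \<le> G z n + 1)"
    proof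
      assume "\<exists>q. \<forall>n. cnt w (cc z) n \<le> cnt w x n + q \<and> cnt w x n + q \<le> cnt w (cc z) n + 1"
      then obtain q where q: "\<And>n. cnt w (cc z) n \<le> cnt w x n + q \<and> cnt w x n + q \<le> cnt w (cc z) n + 1" by blast
      show "\<exists>q. \<forall>n. G z n \<le> cnt w x n + q \<and> cnt w x n + q \<le> G z n + 1"
        by (rule exI[of _ "q - z div m"]) (use q in \<open>simp add: G_def algebra_simps\<close>)
    next
      assume "\<exists>q. \<forall>n. G z n \<le> cnt w x n + q \<and> cnt w x n + q \<le> G z n + 1"
      then obtain q where q: "\<And>n. G z n \<le> cnt w x n + q \<and> cnt w x n + q \<le> G z n + 1" by blast
      show "\<exists>q. \<forall>n. cnt w (cc z) n \<le> cnt w x n + q \<and> cnt w x n + q \<le> cnt w (cc z) n + 1"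
        by (rule exI[of _ "q + z div m"]) (use q in \<open>simp add: G_def algebra_simps\<close>)
    qed
    finally show ?thesis .
  qed
  have chain: "G b n \<le> G a n \<and> G c n \<le> G b n \<and> G d n \<le> G c n \<and> G a n - 1 \<le> G d n"
    if "a < b" "b < c" "c < d" "d < a + m" for a b c d n
    using that anti[of a b n] anti[of b c n] anti[of c d n] lower[of d a n] by simp
  have either: "(\<exists>q. \<forall>n. G a n \<le> cnt w x n + q \<and> cnt w x n + q \<le> G c n + 1) \<or>
      (\<exists>q. \<forall>n. G c n \<le> cnt w x n + q \<and> cnt w x n + q \<le> G a n)"
    if ord: "a < b" "b < c" "c < d" "d < a + m" and x: "x \<in> I" and ac: "E x (cc a)" "E x (cc c)" for a b c d x
  proof -
    obtain q1 q3 where q: "\<And>n. G a n \<le> cnt w x n + q1 \<and> cnt w x n + q1 \<le> G a n + 1"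
      "\<And>n. G c n \<le> cnt w x n + q3 \<and> cnt w x n + q3 \<le> G c n + 1"
      using ac unfolding alt[OF x] by blast
    show ?thesis by (rule bracket_either[OF chain[OF ord] q])
  qed
  have up: "E x (cc b)" if ord: "a < b" "b < c" "c < d" "d < a + m" and x: "x \<in> I"
    and h: "\<exists>q. \<forall>n. G a n \<le> cnt w x n + q \<and> cnt w x n + q \<le> G c n + 1" for a b c d x
    unfolding alt[OF x] using h chain[OF ord] by (meson add_mono dual_order.trans order_refl)
  have down: "E x (cc d)" if ord: "a < b" "b < c" "c < d" "d < a + m" and x: "x \<in> I"
    and h: "\<exists>q. \<forall>n. G c n \<le> cnt w x n + q \<and> cnt w x n + q \<le> G a n" for a b c d x
  proof -
    obtain q where q: "\<And>n. G c n \<le> cnt w x n + q \<and> cnt w x n + q \<le> G a n" using h by blast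
    have "G d n \<le> cnt w x n + q \<and> cnt w x n + q \<le> G d n + 1" for n
      using q[of n] chain[OF ord, of n] by linarith
    then show ?thesis unfolding alt[OF x] by blast
  qed
  have "\<exists>u l. 0 \<le> l \<and> l < m \<and> (\<forall>z. E x (cc z) \<longleftrightarrow> (\<exists>k. m dvd k - u \<and> k < z \<and> z \<le> k + l))" if x: "x \<in> I" for x
  proof -
    \<comment> \<open>Maximality of the clique enters here: it gives the clique vertex outside the
      neighbourhood that \<open>cyclic_interval\<close> requires.\<close>
    obtain c where "c \<in> C" "\<not> E x c" using maxi[OF x] by blast
    then obtain z0 where z0: "\<not> E x (cc z0)" using cc_range by blast
    have per': "E x (cc z) = E x (cc z')" if "m dvd z - z'" for z z' using that cc_eq by metis
    have pat: "E x (cc b) \<or> E x (cc d)"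
      if "a < b" "b < c" "c < d" "d < a + m" "E x (cc a)" "E x (cc c)" for a b c d
      using either[OF that(1-4) x that(5,6)] up[OF that(1-4) x] down[OF that(1-4) x] by blast
    show ?thesis
      by (rule cyclic_interval[of m "\<lambda>z. E x (cc z)" z0, OF m per' z0 pat]) blast+
  qed
  then have "\<forall>x\<in>I. \<exists>p. 0 \<le> snd p \<and> snd p < m \<and>
      (\<forall>z. E x (cc z) \<longleftrightarrow> (\<exists>k. m dvd k - fst p \<and> k < z \<and> z \<le> k + snd p))"
    by (metis fst_conv snd_conv)
  from bchoice[OF this] obtain p where p: "\<forall>x\<in>I. 0 \<le> snd (p x) \<and> snd (p x) < m \<and>
      (\<forall>z. E x (cc z) \<longleftrightarrow> (\<exists>k. m dvd k - fst (p x) \<and> k < z \<and> z \<le> k + snd (p x)))" ..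
  define s where "s x = fst (p x)" for x
  define len where "len x = snd (p x)" for x
  have len: "0 \<le> len x" "len x < m" if "x \<in> I" for x using p that by (auto simp: len_def)
  have adj: "E x (cc z) \<longleftrightarrow> (\<exists>u. m dvd u - s x \<and> u < z \<and> z \<le> u + len x)" if "x \<in> I" for x z
    using p that by (simp add: s_def len_def)
  have adjI: "E x (cc z)" if "x \<in> I" "m dvd u - s x" "u < z" "z \<le> u + len x" for x u z
    using that adj by blast
  have gap: "\<not> E x (cc z)" if x: "x \<in> I" and u: "m dvd u - s x" and z: "u + len x < z" "z \<le> u + m" for x u z
  proof
    assume "E x (cc z)"
    then obtain k where k: "m dvd k - s x" "k < z" "z \<le> k + len x" using adj[OF x] by blast
    have "m dvd k - u" using dvd_diff[OF k(1) u] by simp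
    then obtain j where j: "k - u = m * j" by (elim dvdE)
    have "j \<le> 0"
    proof (rule ccontr)
      assume "\<not> j \<le> 0"
      then have "m * j \<ge> m * 1" using m by (intro mult_left_mono) auto
      then show False using j k z by linarith
    qed
    moreover have "j \<ge> 1"
    proof (rule ccontr)
      assume "\<not> j \<ge> 1"
      then have "m * j \<le> m * 0" using m by (intro mult_left_mono) auto
      then show False using j k z by linarith
    qed
    ultimately show False by simp
  qed
  have no_cover: False
    if xy: "x \<in> I" "y \<in> I" and dx: "m dvd u - s x" and du: "m dvd v - s y" and dv: "m dvd v' - s y"
      and o1: "v < u" "u < v + len y" "v + len y < u + len x" and o2: "v' < u + len x" "u + len x < v' + len y"
      and vv: "v + m \<le> v'"
    for x y u v v'
  proof -
    \<comment> \<open>Positions \<open>?a\<close> and \<open>?c\<close> lie in both arcs,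
      \<open>?b\<close> lies outside \<open>y\<close> and \<open>?d\<close> outside
      \<open>x\<close>. Hence the count of \<open>x\<close> is bracketed along the way from
      \<open>?a\<close> to \<open>?c\<close> and that of \<open>y\<close> along the way back. The
      two brackets fit together to make \<open>x\<close> and \<open>y\<close> alternate, against the
      independence of \<open>I\<close>.\<close>
    let ?a = "u + 1" and ?b = "v + len y + 1" and ?c = "u + len x" and ?d = "u + m"
    have lx: "len x < m" "len y < m" using len xy by simp_all
    have ord: "?a < ?b" "?b < ?c" "?c < ?d" "?d < ?a + m" using o1 o2 vv lx by linarith+
    have "m dvd v' - v" using dvd_diff[OF dv du] by simp
    have vm: "v + m = v'"
    proof (rule ccontr)
      assume "v + m \<noteq> v'"
      then obtain j where j: "v' - v = m * j" using \<open>m dvd v' - v\<close> by (elim dvdE)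
      have "j \<ge> 2"
      proof (rule ccontr)
        assume "\<not> j \<ge> 2"
        then have "m * j \<le> m * 1" using m by (intro mult_left_mono) auto
        then show False using j vv \<open>v + m \<noteq> v'\<close> by linarith
      qed
      then have "m * j \<ge> m * 2" using m by (intro mult_left_mono) auto
      then show False using j o1 o2 lx by linarith
    qed
    have X: "E x (cc ?a)" "E x (cc ?c)" using o1 o2 vv dx by (auto intro!: adjI[OF xy(1), of u])
    have Y: "E y (cc ?a)" "E y (cc ?c)"
      using o1 o2 by (auto intro: adjI[OF xy(2) du] adjI[OF xy(2) dv])
    have X4: "\<not> E x (cc ?d)" using gap[OF xy(1) dx, of ?d] lx by simp
    have Y2: "\<not> E y (cc ?b)" using gap[OF xy(2) du, of ?b] vm o2 o1 lx by simp
    obtain q where q: "\<And>n. G ?a n \<le> cnt w x n + q \<and> cnt w x n + q \<le> G ?c n + 1"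
      using either[OF ord xy(1) X] down[OF ord xy(1)] X4 by blast
    obtain q' where q': "\<And>n. G ?c n \<le> cnt w y n + q' \<and> cnt w y n + q' \<le> G ?a n"
      using either[OF ord xy(2) Y] up[OF ord xy(2)] Y2 by blast
    have "\<forall>n. cnt w y n \<le> cnt w x n + (q - q') \<and> cnt w x n + (q - q') \<le> cnt w y n + 1"
      using q q' by (smt (verit, best))
    moreover have ne: "x \<noteq> y"
      using X4 Y2 ord X Y o1 o2 vv lx du dx gap[OF xy(1) dx, of ?b] adjI[OF xy(1) dx, of ?b] by auto
    ultimately have "alternate w x y" unfolding alternate_iff_cnt[OF ne] by blast
    then have "E x y" using rep ne xy CI by (auto simp: represents_def)
    then show False using ind xy by (auto simp: is_indep_def)
  qed
  have dist: "v + m \<le> v'" if "m dvd v - t" "m dvd v' - t" "v < v'" for v v' t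
  proof -
    have "m dvd v' - v" using dvd_diff[OF that(2,1)] by simp
    then show ?thesis using that(3) zdvd_imp_le[of m "v' - v"] by simp
  qed
  have one_aux: False
    if xy: "x \<in> I" "y \<in> I" and d: "m dvd u - s y" "m dvd v - s y"
      and o: "overlap (s x) (len x) u (len y)" "overlap (s x) (len x) v (len y)" and uv: "u < v" for x y u v
  proof -
    have uv': "u + m \<le> v" using dist[OF d uv] .
    have l: "len x < m" "len y < m" using len xy by simp_all
    have 1: "u < s x" "s x < u + len y" "u + len y < s x + len x"
      using o uv' l unfolding overlap_def by linarith+
    have 2: "v < s x + len x" "s x + len x < v + len y"
      using o uv' l unfolding overlap_def by linarith+
    show False by (rule no_cover[OF xy _ d 1 2 uv']) simp
  qed
  have "circular_arcs C I E m cc s len"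
  proof
    show "\<And>a b. a \<in> C \<union> I \<Longrightarrow> b \<in> C \<union> I \<Longrightarrow> E a b \<Longrightarrow> E b a"
      using sg CI by (auto simp: simple_graph_def)
    show "u = v" if "x \<in> I" "y \<in> I" "m dvd u - s y" "m dvd v - s y"
       "overlap (s x) (len x) u (len y)" "overlap (s x) (len x) v (len y)" for x y u v
      using one_aux[OF that] one_aux[OF that(1,2,4,3,6,5)] by (meson linorder_neq_iff)
  qed (use m fin CI cl ind cc_eq cc_range len adj in auto)
  then show thesis by (rule that)
qed

section \<open>3-uniform words\<close>

context circular_arcs
begin

lemma lift_dist:
  assumes "m dvd u - v" "u < v"
  shows "u + m \<le> v"
proof -
  have "m dvd v - u" using assms(1) by (metis dvd_diff_commute)
  then show ?thesis using assms(2) zdvd_imp_le[of m "v - u"] by simp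
qed

lemma same_lift:
  assumes "m dvd u - t" "m dvd v - t"
  shows "m dvd u - v"
  using dvd_diff[OF assms] by simp

lemma adj_window:
  assumes x: "x \<in> I" and u: "m dvd u - s x" and z: "u < z" "z \<le> u + m"
  shows "E x (cc z) \<longleftrightarrow> z \<le> u + len x"
proof
  assume "E x (cc z)"
  then obtain k where k: "m dvd k - s x" "k < z" "z \<le> k + len x" using adj[OF x] by blast
  have "k = u"
    using lift_dist[OF same_lift[OF k(1) u]] lift_dist[OF same_lift[OF u k(1)]] k z len[OF x]
    by (cases k u rule: linorder_cases) linarith+
  then show "z \<le> u + len x" using k by simp
next
  assume "z \<le> u + len x"
  then show "E x (cc z)" using adj[OF x] u z by blast
qed

lemma one_sided_lift:
  assumes "x \<in> I" "y \<in> I" "m dvd t - s x" "m dvd u - s y" "m dvd v - s y"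
    "overlap t (len x) u (len y)" "overlap t (len x) v (len y)"
  shows "u = v"
proof -
  have "overlap (s x) (len x) (u + (s x - t)) (len y)" "overlap (s x) (len x) (v + (s x - t)) (len y)"
    using assms(6,7) unfolding overlap_def by linarith+
  moreover have "m dvd u + (s x - t) - s y" "m dvd v + (s x - t) - s y"
    using dvd_diff[OF assms(4,3)] dvd_diff[OF assms(5,3)] by (simp_all add: algebra_simps)
  ultimately have "u + (s x - t) = v + (s x - t)" using one_sided[OF assms(1,2)] by blast
  then show ?thesis by simp
qed

definition start :: "'a \<Rightarrow> int" where "start x = s x mod m"
definition fin :: "'a \<Rightarrow> int" where "fin x = start x + len x"

lemma start: "0 \<le> start x" "start x < m" "m dvd start x - s x"
  using m_pos by (simp_all add: start_def mod_eq_dvd_iff[symmetric])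

lemma fin: "x \<in> I \<Longrightarrow> start x \<le> fin x \<and> fin x < start x + m"
  using len[of x] by (simp add: fin_def)

lemma adj_normal:
  assumes x: "x \<in> I" and z: "1 \<le> z" "z \<le> m"
  shows "E x (cc z) \<longleftrightarrow> (if start x < z then z \<le> fin x else z \<le> fin x - m)"
proof -
  have d: "m dvd start x - m - s x" using start(3)[of x] by (metis diff_right_commute dvd_diff dvd_refl)
  show ?thesis
    using adj_window[OF x start(3), of z] adj_window[OF x d, of z] z start[of x] by (auto simp: fin_def)
qed

definition num :: "'a \<Rightarrow> int" where "num c = (SOME z. 1 \<le> z \<and> z \<le> m \<and> cc z = c)"

lemma num:
  assumes "c \<in> C"
  shows "1 \<le> num c" "num c \<le> m" "cc (num c) = c"
proof -
  obtain z where z: "cc z = c" using assms cc_range by blast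
  have "1 \<le> 1 + (z - 1) mod m" "1 + (z - 1) mod m \<le> m"
    using pos_mod_sign[OF m_pos, of "z - 1"] pos_mod_bound[OF m_pos, of "z - 1"] by linarith+
  moreover have "m dvd z - (1 + (z - 1) mod m)"
    by (metis diff_diff_eq dvd_minus_mod)
  then have "cc (1 + (z - 1) mod m) = c" using cc_eq z by metis
  ultimately have "\<exists>z. 1 \<le> z \<and> z \<le> m \<and> cc z = c" by blast
  from someI_ex[OF this] show "1 \<le> num c" "num c \<le> m" "cc (num c) = c"
    unfolding num_def by blast+
qed

lemma num_inj: "c \<in> C \<Longrightarrow> d \<in> C \<Longrightarrow> c \<noteq> d \<Longrightarrow> num c \<noteq> num d"
  using num(3) by metis

lemma finite_C: "finite C"
proof -
  have "C \<subseteq> cc ` {1..m}" using num by (metis atLeastAtMost_iff image_eqI subsetI)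
  then show ?thesis by (rule finite_subset) simp
qed

text \<open>Otherwise the two arcs through the cut would cover the circle between them and overlap
  at both ends.\<close>

lemma wraps_meet:
  assumes x: "x \<in> I" "m < fin x" and y: "y \<in> I" "m < fin y"
  shows "fin x - m \<le> start y"
proof (rule ccontr)
  assume "\<not> fin x - m \<le> start y"
  then have h: "start y < fin x - m" by simp
  have o: "overlap (start x) (len x) (start y) (len y)" "overlap (start x) (len x) (start y + m) (len y)"
    using h x(2) y(2) start(1,2)[of x] start(1,2)[of y] len[OF x(1)] len[OF y(1)]
    unfolding overlap_def fin_def by linarith+
  have d: "m dvd start y + m - s y" using start(3)[of y] by (metis add_diff_eq add.commute dvd_add dvd_refl)
  have "start y = start y + m" by (rule one_sided_lift[OF x(1) y(1) start(3) start(3) d o])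
  then show False using m_pos by simp
qed

text \<open>An arc reaching across the whole complement of \<open>y\<close> would overlap
  \<open>y\<close> at both ends.\<close>

lemma wrap_avoids:
  assumes x: "x \<in> I" "fin x \<le> m" and y: "y \<in> I" "m < fin y"
  shows "fin x \<le> start y \<or> fin y - m \<le> start x"
proof (rule ccontr)
  assume "\<not> ?thesis"
  then have h: "start y < fin x" "start x < fin y - m" by simp_all
  have o: "overlap (start x) (len x) (start y) (len y)" "overlap (start x) (len x) (start y - m) (len y)"
    using h x(2) y(2) start(1,2)[of x] start(1,2)[of y] len[OF x(1)] len[OF y(1)]
    unfolding overlap_def fin_def by linarith+
  have d: "m dvd start y - m - s y" using start(3)[of y] by (metis diff_right_commute dvd_diff dvd_refl)
  have "start y = start y - m" by (rule one_sided_lift[OF x(1) y(1) start(3) start(3) d o])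
  then show False using m_pos by simp
qed

text \<open>A Helly argument: cut open at 0, the complements of the arcs through the cut become
  intervals from \<open>fin x - m\<close> to \<open>start x\<close> that pairwise meet by
  \<open>wraps_meet\<close>, so the largest left end belongs to all of them.\<close>

lemma common_gap:
  "\<exists>t. 0 \<le> t \<and> t < m \<and> (\<forall>x\<in>I. m < fin x \<longrightarrow> fin x - m \<le> t \<and> t \<le> start x \<and> 1 \<le> t)"
proof (cases "\<exists>x\<in>I. m < fin x")
  case False
  then show ?thesis using m_pos by auto
next
  case True
  let ?S = "(\<lambda>x. fin x - m) ` {x \<in> I. m < fin x}"
  have S: "finite ?S" "?S \<noteq> {}" using finite_I True by auto
  have "Max ?S \<in> ?S" by (rule Max_in[OF S])
  then obtain y where y: "y \<in> I" "m < fin y" "Max ?S = fin y - m" by auto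
  have "fin x - m \<le> fin y - m \<and> fin y - m \<le> start x \<and> 1 \<le> fin y - m" if x: "x \<in> I" "m < fin x" for x
  proof -
    have "fin x - m \<le> Max ?S" using x by (intro Max_ge[OF S(1)]) auto
    then show ?thesis using y wraps_meet[OF y(1,2) x] by simp
  qed
  moreover have "0 \<le> fin y - m" "fin y - m < m" using y fin[OF y(1)] start[of y] by auto
  ultimately show ?thesis by blast
qed

lemma representsI:
  assumes "set w = C \<union> I"
    and alt: "\<And>a b. a \<in> C \<union> I \<Longrightarrow> b \<in> C \<union> I \<Longrightarrow> a \<noteq> b \<Longrightarrow> alternate w a b \<longleftrightarrow> A a b"
    and A_sym: "\<And>a b. A a b \<longleftrightarrow> A b a"
    and CC: "\<And>a b. a \<in> C \<Longrightarrow> b \<in> C \<Longrightarrow> a \<noteq> b \<Longrightarrow> A a b"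
    and IC: "\<And>x c. x \<in> I \<Longrightarrow> c \<in> C \<Longrightarrow> E x c \<longleftrightarrow> A x c"
    and II: "\<And>x y. x \<in> I \<Longrightarrow> y \<in> I \<Longrightarrow> x \<noteq> y \<Longrightarrow> \<not> A x y"
  shows "represents (C \<union> I) E w"
  unfolding represents_def
proof (intro conjI ballI impI assms(1))
  fix a b assume ab: "a \<in> C \<union> I" "b \<in> C \<union> I" "a \<noteq> b"
  have "E a b \<longleftrightarrow> E b a" using sym ab by blast
  moreover have "E a b" if "a \<in> C" "b \<in> C" using clique that ab(3) by (simp add: is_clique_def)
  moreover have "\<not> E a b" if "a \<in> I" "b \<in> I" using indep that by (simp add: is_indep_def)
  ultimately show "E a b \<longleftrightarrow> alternate w a b"
    unfolding alt[OF ab] using ab CC[of a b] IC[of a b] IC[of b a] II[of a b] A_sym[of a b] by blast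
qed

lemma three_uniform_word: "\<exists>w. represents (C \<union> I) E w \<and> uniform 3 (C \<union> I) w"
proof -
  obtain t where t: "0 \<le> t" "t < m" "\<And>x. x \<in> I \<Longrightarrow> m < fin x \<Longrightarrow> fin x - m \<le> t \<and> t \<le> start x \<and> 1 \<le> t"
    using common_gap by blast
  obtain f :: "'a \<Rightarrow> nat" where f: "inj_on f I" using finite_imp_inj_to_nat_seg[OF finite_I] by blast
  define r where "r x = 1 + int (f x)" for x
  have r: "1 \<le> r x" for x by (simp add: r_def)
  have r_inj: "r x \<noteq> r y" if "x \<in> I" "y \<in> I" "x \<noteq> y" for x y
    using that f by (auto simp: r_def inj_on_def)
  \<comment> \<open>Clique vertices sit at positions \<open>4z\<close>, gap \<open>g\<close> at \<open>4g + 1\<close> and \<open>4g + 2\<close>. Arcs avoiding the cut use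
    the gaps \<open>fin\<close>, \<open>2m + start\<close>, \<open>3m\<close>, the others \<open>start\<close>, \<open>m + t\<close>, \<open>fin + m\<close>. At the shared gaps
    \<open>3m\<close> and \<open>m + t\<close> the negated components reverse the order of the first occurrences, so that two
    arcs of the same kind never alternate.\<close>
  define k0 :: "'a \<Rightarrow> int \<times> int \<times> int" where "k0 v = (if v \<in> C then (4 * num v, 0, 0) else
    if fin v \<le> m then (4 * fin v + 1, 0, r v) else (4 * start v + 2, 0, r v))" for v
  define k1 :: "'a \<Rightarrow> int \<times> int \<times> int" where "k1 v = (if v \<in> C then (4 * num v + 4 * m, 0, 0) else
    if fin v \<le> m then (8 * m + 4 * start v + 2, 0, r v) else (4 * m + 4 * t + 1, - start v, - r v))" for v
  define k2 :: "'a \<Rightarrow> int \<times> int \<times> int" where "k2 v = (if v \<in> C then (4 * num v + 8 * m, 0, 0) else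
    if fin v \<le> m then (12 * m + 1, - fin v, - r v) else (4 * fin v + 4 * m + 1, 0, r v))" for v
  define kp where "kp v i = (if i = 0 then k0 v else if i = 1 then k1 v else k2 v)" for v and i :: nat
  have all2: "(\<forall>i. Suc i < 3 \<longrightarrow> P i) \<longleftrightarrow> P 0 \<and> P 1" for P
    by (metis One_nat_def Suc_less_eq less_2_cases_iff numeral_2_eq_2 numeral_3_eq_3)
  have ex3: "(\<exists>i<3. P i) \<longleftrightarrow> P 0 \<or> P 1 \<or> P (2::nat)" for P
    by (auto simp: numeral_eq_Suc less_Suc_eq)
  have C_I: "v \<notin> C" if "v \<in> I" for v using disj that by blast
  have alt: "((\<forall>i. Suc i < 3 \<longrightarrow> (\<exists>j<3. kp a i < kp b j \<and> kp b j < kp a (Suc i))) \<and>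
       (\<forall>i. Suc i < 3 \<longrightarrow> (\<exists>j<3. kp b i < kp a j \<and> kp a j < kp b (Suc i)))) \<longleftrightarrow>
     (k0 a < k0 b \<and> k0 b < k1 a \<or> k0 a < k1 b \<and> k1 b < k1 a \<or> k0 a < k2 b \<and> k2 b < k1 a) \<and>
     (k1 a < k0 b \<and> k0 b < k2 a \<or> k1 a < k1 b \<and> k1 b < k2 a \<or> k1 a < k2 b \<and> k2 b < k2 a) \<and>
     (k0 b < k0 a \<and> k0 a < k1 b \<or> k0 b < k1 a \<and> k1 a < k1 b \<or> k0 b < k2 a \<and> k2 a < k1 b) \<and>
     (k1 b < k0 a \<and> k0 a < k2 b \<or> k1 b < k1 a \<and> k1 a < k2 b \<or> k1 b < k2 a \<and> k2 a < k2 b)"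
    (is "_ \<longleftrightarrow> ?alt a b") for a b
    unfolding all2 ex3 by (simp add: kp_def)
  have mono: "k0 v < k1 v" "k1 v < k2 v" if "v \<in> C \<union> I" for v
    using that t m_pos start[of v] fin[of v] num[of v] by (auto simp: k0_def k1_def k2_def C_I)
  have CC: "?alt a b" if "a \<in> C" "b \<in> C" "a \<noteq> b" for a b
    using that num_inj[OF that] num(1,2)[OF that(1)] num(1,2)[OF that(2)] by (auto simp: k0_def k1_def k2_def)
  have IC: "E x c \<longleftrightarrow> ?alt x c" if x: "x \<in> I" and c: "c \<in> C" for x c
  proof -
    note n = num[OF c] and f = fin[OF x] and st = start(1,2)[of x]
    have E: "E x c \<longleftrightarrow> (if start x < num c then num c \<le> fin x else num c \<le> fin x - m)"
      using adj_normal[OF x n(1,2)] n(3) by simp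
    show ?thesis
    proof (cases "fin x \<le> m")
      case True
      then show ?thesis unfolding E k0_def k1_def k2_def less_prod_simp
        using C_I[OF x] c n f st m_pos by (simp; linarith)
    next
      case False
      then show ?thesis unfolding E k0_def k1_def k2_def less_prod_simp
        using C_I[OF x] c n f st m_pos t(1,2) t(3)[OF x] by (simp; linarith)
    qed
  qed
  have II1: "\<not> ?alt x y" if x: "x \<in> I" and y: "y \<in> I" and xy: "x \<noteq> y" "fin x \<le> m" "fin y \<le> m" for x y
    using r_inj[OF x y xy(1)] r[of x] r[of y] fin[OF x] fin[OF y] start(1,2)[of x] start(1,2)[of y] xy(2,3) m_pos
    unfolding k0_def k1_def k2_def less_prod_simp by (simp add: C_I x y; linarith)
  have II2: "\<not> ?alt x y" if x: "x \<in> I" and y: "y \<in> I" and xy: "x \<noteq> y" "m < fin x" "m < fin y" for x y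
    using r_inj[OF x y xy(1)] r[of x] r[of y] fin[OF x] fin[OF y] start(1,2)[of x] start(1,2)[of y] xy(2,3) m_pos
      t(1,2) t(3)[OF x xy(2)] t(3)[OF y xy(3)]
    unfolding k0_def k1_def k2_def less_prod_simp by (simp add: C_I x y; linarith)
  have II12: "\<not> ?alt x y" if x: "x \<in> I" and y: "y \<in> I" and xy: "fin x \<le> m" "m < fin y" for x y
    using r[of x] r[of y] fin[OF x] fin[OF y] start(1,2)[of x] start(1,2)[of y] xy m_pos
      t(1,2) t(3)[OF y xy(2)] wrap_avoids[OF x xy(1) y xy(2)]
    unfolding k0_def k1_def k2_def less_prod_simp by (simp add: C_I x y; linarith)
  have swap: "?alt x y \<longleftrightarrow> ?alt y x" for x y by blast
  have II: "\<not> ?alt x y" if "x \<in> I" "y \<in> I" "x \<noteq> y" for x y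
  proof (cases "fin x \<le> m")
    case True
    then show ?thesis
    proof (cases "fin y \<le> m")
      case True
      from II1[OF that \<open>fin x \<le> m\<close> this] show ?thesis .
    next
      case False
      then have "m < fin y" by simp
      from II12[OF that(1,2) \<open>fin x \<le> m\<close> this] show ?thesis .
    qed
  next
    case False
    then have x: "m < fin x" by simp
    show ?thesis
    proof (cases "fin y \<le> m")
      case True
      from II12[OF that(2,1) this x] show ?thesis by (subst swap)
    next
      case False
      then have "m < fin y" by simp
      from II2[OF that x this] show ?thesis .
    qed
  qed
  show ?thesis
  proof (rule word_of_keys[of "C \<union> I" 3 kp])
    show "finite (C \<union> I)" using finite_C finite_I by simp
    show "kp v i < kp v (Suc i)" if "v \<in> C \<union> I" "Suc i < 3" for v i
      using mono[OF that(1)] that(2) by (cases i) (auto simp: kp_def numeral_eq_Suc)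
    show "kp u i \<noteq> kp v j" if uv: "u \<in> C \<union> I" "v \<in> C \<union> I" "u \<noteq> v" "i < 3" "j < 3" for u v i j
    proof -
      consider "u \<in> C" "v \<in> C" | "u \<in> C" "v \<in> I" | "u \<in> I" "v \<in> C" | "u \<in> I" "v \<in> I" using uv by blast
      then show ?thesis
      proof cases
        case 1
        then show ?thesis
          using num_inj[OF 1 uv(3)] num(1,2)[OF 1(1)] num(1,2)[OF 1(2)] by (auto simp: kp_def k0_def k1_def k2_def)
      next
        case 2
        then show ?thesis using r[of v] by (auto simp: kp_def k0_def k1_def k2_def C_I)
      next
        case 3
        then show ?thesis using r[of u] by (auto simp: kp_def k0_def k1_def k2_def C_I)
      next
        case 4
        then show ?thesis using r[of u] r[of v] r_inj[OF 4 uv(3)] by (auto simp: kp_def k0_def k1_def k2_def C_I)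
      qed
    qed
    fix w assume w: "set w = C \<union> I" "uniform 3 (C \<union> I) w"
      and aw: "\<And>a b. a \<in> C \<union> I \<Longrightarrow> b \<in> C \<union> I \<Longrightarrow> a \<noteq> b \<Longrightarrow> alternate w a b \<longleftrightarrow>
       (\<forall>i. Suc i < 3 \<longrightarrow> (\<exists>j < 3. kp a i < kp b j \<and> kp b j < kp a (Suc i))) \<and>
       (\<forall>i. Suc i < 3 \<longrightarrow> (\<exists>j < 3. kp b i < kp a j \<and> kp a j < kp b (Suc i)))"
    have "represents (C \<union> I) E w"
      by (rule representsI[OF w(1) aw[unfolded alt] swap CC IC II])
    then show ?thesis using w(2) by blast
  qed simp
qed

end

section \<open>Lifting arcs to the double circle\<close>

lemma overlap_commute: "overlap u a v b \<longleftrightarrow> overlap v b u a"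
  by (auto simp: overlap_def)

lemma overlap_shift: "overlap (u + j) a (v + j) b \<longleftrightarrow> overlap u a v b"
  by (auto simp: overlap_def)

context circular_arcs
begin

lemma two_uniform_word:
  assumes t_lift: "\<And>x. x \<in> I \<Longrightarrow> m dvd t x - s x"
    and t_free: "\<And>x y u. x \<in> I \<Longrightarrow> y \<in> I \<Longrightarrow> 2 * m dvd u - t y \<Longrightarrow> \<not> overlap (t x) (len x) u (len y)"
  shows "\<exists>w. represents (C \<union> I) E w \<and> uniform 2 (C \<union> I) w"
proof -
  define T where "T x = t x mod (2 * m)" for x
  define F where "F x = T x + len x" for x
  \<comment> \<open>A lift that runs past \<open>2 * m\<close> is replaced by its complement on the
    double circle. Only the chord between its two ends matters, and that is the same for
    both.\<close>
  define p where "p x = (if F x < 2 * m then T x else F x - 2 * m)" for x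
  define q where "q x = (if F x < 2 * m then F x else T x)" for x
  have T: "0 \<le> T x" "T x < 2 * m" for x using m_pos by (simp_all add: T_def)
  have T_dvd: "2 * m dvd T x - t x" for x
    unfolding T_def by (metis dvd_minus_mod dvd_diff_commute)
  have T_lift: "m dvd T x - s x" if "x \<in> I" for x
  proof -
    have "m dvd T x - t x" using T_dvd[of x] by (metis dvd_mult_right)
    from dvd_add[OF this t_lift[OF that]] show ?thesis by simp
  qed
  have T_free: "\<not> overlap (T x) (len x) u (len y)" if xy: "x \<in> I" "y \<in> I" and u: "2 * m dvd u - T y" for x y u
  proof -
    have "2 * m dvd (u - (T x - t x)) - t y"
      using dvd_diff[OF dvd_add[OF u T_dvd[of y]] T_dvd[of x]] by (simp add: algebra_simps)
    then have "\<not> overlap (t x) (len x) (u - (T x - t x)) (len y)" by (rule t_free[OF xy])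
    then show ?thesis using overlap_shift[of "t x" "T x - t x" "len x" "u - (T x - t x)" "len y"] by simp
  qed
  have pq: "0 \<le> p x" "p x < q x" "q x < 2 * m" if "x \<in> I" "0 < len x" for x
    using that len[OF that(1)] T[of x] by (auto simp: p_def q_def F_def)
  have no_cross: "\<not> (p x < p y \<and> p y < q x \<and> q x < q y)" if xy: "x \<in> I" "y \<in> I" for x y
  proof -
    have "\<not> overlap (T x) (len x) (T y) (len y)" "\<not> overlap (T x) (len x) (T y - 2 * m) (len y)"
      using xy by (intro T_free; simp)+
    then show ?thesis
      using T[of x] T[of y] len[OF xy(1)] len[OF xy(2)]
      unfolding overlap_def p_def q_def F_def by (simp split: if_splits; linarith)
  qed
  \<comment> \<open>A lift is shorter than \<open>m\<close>, so it holds one of the antipodal points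
    of \<open>c\<close> if \<open>c\<close> is a neighbour and none otherwise; the complement then
    holds one or both. Exactly one point therefore means adjacency, whichever of the two intervals
    \<open>p\<close> and \<open>q\<close> bound.\<close>
  have E_iff: "E x c \<longleftrightarrow> (p x < num c \<and> num c \<le> q x) \<noteq> (p x < num c + m \<and> num c + m \<le> q x)"
    if x: "x \<in> I" and c: "c \<in> C" for x c
  proof -
    let ?z = "num c"
    note n = num[OF c]
    have d1: "m dvd T x - m - s x" and d2: "m dvd T x - 2 * m - s x"
      using dvd_diff[OF T_lift[OF x], of m] dvd_diff[OF T_lift[OF x], of "2 * m"]
      by (simp_all add: algebra_simps)
    have "E x c \<longleftrightarrow> (if T x < ?z then ?z \<le> F x else if T x < ?z + m then ?z \<le> F x - m else ?z \<le> F x - 2 * m)"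
      using adj_window[OF x T_lift[OF x], of ?z] adj_window[OF x d1, of ?z] adj_window[OF x d2, of ?z] n T[of x]
      by (auto simp: F_def)
    also have "\<dots> \<longleftrightarrow> (p x < ?z \<and> ?z \<le> q x) \<noteq> (p x < ?z + m \<and> ?z + m \<le> q x)"
      using n(1,2) T[of x] len[OF x] unfolding p_def q_def F_def by (simp; linarith)
    finally show ?thesis .
  qed
  obtain f :: "'a \<Rightarrow> nat" where f: "inj_on f I" using finite_imp_inj_to_nat_seg[OF finite_I] by blast
  define r where "r x = 1 + int (f x)" for x
  have r: "1 \<le> r x" for x by (simp add: r_def)
  have r_inj: "r x \<noteq> r y" if "x \<in> I" "y \<in> I" "x \<noteq> y" for x y
    using that f by (auto simp: r_def inj_on_def)
  \<comment> \<open>Inside a gap, intervals are closed before others are opened, longer ones being opened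
    earlier and closed later; vertices without neighbours are put in front of everything.\<close>
  define k0 :: "'a \<Rightarrow> int \<times> int \<times> int \<times> int" where "k0 v = (if v \<in> C then (2 * num v, 0, 0, 0) else
    if len v = 0 then (- 1, r v, 0, 0) else (2 * p v + 1, 1, - q v, r v))" for v
  define k1 :: "'a \<Rightarrow> int \<times> int \<times> int \<times> int" where "k1 v = (if v \<in> C then (2 * num v + 2 * m, 0, 0, 0) else
    if len v = 0 then (- 1, r v, 1, 0) else (2 * q v + 1, 0, - p v, - r v))" for v
  define kp where "kp v i = (if i = 0 then k0 v else k1 v)" for v and i :: nat
  have all1: "(\<forall>i. Suc i < 2 \<longrightarrow> P i) \<longleftrightarrow> P 0" for P by (auto simp: less_Suc_eq numeral_2_eq_2)
  have ex2: "(\<exists>i<2. P i) \<longleftrightarrow> P 0 \<or> P (1::nat)" for P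
    by (auto simp: numeral_eq_Suc less_Suc_eq)
  have C_I: "v \<notin> C" if "v \<in> I" for v using disj that by blast
  have alt: "((\<forall>i. Suc i < 2 \<longrightarrow> (\<exists>j<2. kp a i < kp b j \<and> kp b j < kp a (Suc i))) \<and>
       (\<forall>i. Suc i < 2 \<longrightarrow> (\<exists>j<2. kp b i < kp a j \<and> kp a j < kp b (Suc i)))) \<longleftrightarrow>
     (k0 a < k0 b \<and> k0 b < k1 a \<or> k0 a < k1 b \<and> k1 b < k1 a) \<and>
     (k0 b < k0 a \<and> k0 a < k1 b \<or> k0 b < k1 a \<and> k1 a < k1 b)"
    (is "_ \<longleftrightarrow> ?alt a b") for a b
    unfolding all1 ex2 by (simp add: kp_def)
  have mono: "k0 v < k1 v" if "v \<in> C \<union> I" for v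
    using that m_pos pq[of v] len[of v] by (cases "v \<in> C") (auto simp: k0_def k1_def)
  have CC: "?alt a b" if "a \<in> C" "b \<in> C" "a \<noteq> b" for a b
    using that num_inj[OF that] num(1,2)[OF that(1)] num(1,2)[OF that(2)] by (auto simp: k0_def k1_def)
  have IC: "E x c \<longleftrightarrow> ?alt x c" if x: "x \<in> I" and c: "c \<in> C" for x c
  proof (cases "len x = 0")
    case True
    then have "\<not> E x c" unfolding E_iff[OF x c] using T[of x] by (auto simp: p_def q_def F_def)
    moreover have "\<not> ?alt x c" unfolding k0_def k1_def less_prod_simp
      using C_I[OF x] c True num(1)[OF c] m_pos by (simp; linarith)
    ultimately show ?thesis by blast
  next
    case False
    have keys: "k0 x < k0 c \<longleftrightarrow> p x < num c" "k0 c < k0 x \<longleftrightarrow> num c \<le> p x"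
      "k0 c < k1 x \<longleftrightarrow> num c \<le> q x" "k1 c < k1 x \<longleftrightarrow> num c + m \<le> q x"
      "k0 x < k1 c \<longleftrightarrow> p x < num c + m" "k1 x < k1 c \<longleftrightarrow> q x < num c + m"
      using C_I[OF x] c False by (auto simp: k0_def k1_def)
    have "0 < len x" using len[OF x] False by simp
    then show ?thesis
      unfolding E_iff[OF x c] keys using pq[OF x] num(1,2)[OF c] m_pos by (smt (verit))
  qed
  have II0: "\<not> (k0 x < k0 y \<and> k0 y < k1 x \<and> k1 x < k1 y)" if x: "x \<in> I" and y: "y \<in> I" and xy: "x \<noteq> y" for x y
  proof (cases "len x = 0 \<or> len y = 0")
    case True
    then show ?thesis
      using pq[OF x] pq[OF y] r_inj[OF x y xy] len[OF x] len[OF y] C_I[OF x] C_I[OF y]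
      by (auto simp: k0_def k1_def)
  next
    case False
    note C = C_I[OF x] C_I[OF y]
    have "p x < p y \<or> p x = p y \<and> (q y < q x \<or> q x = q y \<and> r x < r y)" if "k0 x < k0 y"
      using that False C by (auto simp: k0_def)
    moreover have "p y < q x" if "k0 y < k1 x"
      using that False C by (auto simp: k0_def k1_def)
    moreover have "q x < q y \<or> q x = q y \<and> (p y < p x \<or> p x = p y \<and> r y < r x)" if "k1 x < k1 y"
      using that False C by (auto simp: k1_def)
    ultimately show ?thesis using no_cross[OF x y] by linarith
  qed
  have II: "\<not> ?alt x y" if "x \<in> I" "y \<in> I" "x \<noteq> y" for x y
  proof
    assume "?alt x y"
    then have "k0 x < k0 y \<and> k0 y < k1 x \<and> k1 x < k1 y \<or> k0 y < k0 x \<and> k0 x < k1 y \<and> k1 y < k1 x"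
      by (meson less_asym less_trans)
    then show False using II0[OF that] II0[OF that(2,1) that(3)[symmetric]] by blast
  qed
  have swap: "?alt x y \<longleftrightarrow> ?alt y x" for x y by blast
  show ?thesis
  proof (rule word_of_keys[of "C \<union> I" 2 kp])
    show "finite (C \<union> I)" using finite_C finite_I by simp
    show "kp v i < kp v (Suc i)" if "v \<in> C \<union> I" "Suc i < 2" for v i
      using mono[OF that(1)] that(2) by (simp add: kp_def)
    show "kp u i \<noteq> kp v j" if uv: "u \<in> C \<union> I" "v \<in> C \<union> I" "u \<noteq> v" "i < 2" "j < 2" for u v i j
    proof -
      consider "u \<in> C" "v \<in> C" | "u \<in> C" "v \<in> I" | "u \<in> I" "v \<in> C" | "u \<in> I" "v \<in> I" using uv by blast
      then show ?thesis
      proof cases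
        case 1
        then show ?thesis
          using num_inj[OF 1 uv(3)] num(1,2)[OF 1(1)] num(1,2)[OF 1(2)] by (auto simp: kp_def k0_def k1_def)
      next
        case 2
        then show ?thesis using r[of v] by (auto simp: kp_def k0_def k1_def C_I)
      next
        case 3
        then show ?thesis using r[of u] by (auto simp: kp_def k0_def k1_def C_I)
      next
        case 4
        then show ?thesis using r[of u] r[of v] r_inj[OF 4 uv(3)] by (auto simp: kp_def k0_def k1_def C_I)
      qed
    qed
    fix w assume w: "set w = C \<union> I" "uniform 2 (C \<union> I) w"
      and aw: "\<And>a b. a \<in> C \<union> I \<Longrightarrow> b \<in> C \<union> I \<Longrightarrow> a \<noteq> b \<Longrightarrow> alternate w a b \<longleftrightarrow>
       (\<forall>i. Suc i < 2 \<longrightarrow> (\<exists>j < 2. kp a i < kp b j \<and> kp b j < kp a (Suc i))) \<and>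
       (\<forall>i. Suc i < 2 \<longrightarrow> (\<exists>j < 2. kp b i < kp a j \<and> kp a j < kp b (Suc i)))"
    have "represents (C \<union> I) E w"
      by (rule representsI[OF w(1) aw[unfolded alt] swap CC IC II])
    then show ?thesis using w(2) by blast
  qed simp
qed

text \<open>The integer attached to a vertex is a position on the double circle: passing to an
  overlapping arc forces the antipodal lift, hence the shift by \<open>m\<close>. All lifts can be chosen
  consistently if and only if a closed walk always changes the position by a multiple of \<open>2m\<close>.\<close>
definition step :: "'a \<times> int \<Rightarrow> 'a \<times> int \<Rightarrow> bool" where
  "step a b \<longleftrightarrow> fst a \<in> I \<and> fst b \<in> I \<and> m dvd snd a - s (fst a) \<and> m dvd snd b - s (fst b) \<and>
     overlap (snd a) (len (fst a)) (snd b - m) (len (fst b))"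

text \<open>Going there and back makes two antipodal changes, a full turn of the double circle.
  Positions are therefore meaningful only modulo \<open>2 * m\<close>.\<close>

lemma step_sym:
  assumes "step (x, a) (y, b)"
  shows "step (y, b) (x, a + 2 * m)"
proof -
  have st: "x \<in> I" "y \<in> I" "m dvd a - s x" "m dvd b - s y" "overlap a (len x) (b - m) (len y)"
    using assms by (simp_all add: step_def)
  have "overlap b (len y) (m + a) (len x)"
    using st(5) unfolding overlap_def by linarith
  moreover have "m dvd a + 2 * m - s x"
    using dvd_add[OF st(3), of "2 * m"] by (simp add: algebra_simps)
  ultimately show ?thesis using st by (simp add: step_def)
qed

lemma step_shift:
  assumes "step (x, a) (y, b)" "m dvd j"
  shows "step (x, a + j) (y, b + j)"
proof -
  have st: "x \<in> I" "y \<in> I" "m dvd a - s x" "m dvd b - s y" "overlap a (len x) (b - m) (len y)"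
    using assms by (simp_all add: step_def)
  have "overlap (a + j) (len x) (b + j - m) (len y)"
    using st(5) unfolding overlap_def by linarith
  moreover have "m dvd a + j - s x" "m dvd b + j - s y"
    using dvd_add[OF st(3) assms(2)] dvd_add[OF st(4) assms(2)] by (simp_all add: algebra_simps)
  ultimately show ?thesis using st by (simp add: step_def)
qed

lemma walk_shift: "(step ^^ k) (x, a) (y, b) \<Longrightarrow> m dvd j \<Longrightarrow> (step ^^ k) (x, a + j) (y, b + j)"
proof (induction k arbitrary: y b)
  case (Suc k)
  then obtain z c where "(step ^^ k) (x, a) (z, c)" "step (z, c) (y, b)" by auto
  then show ?case using Suc.IH[of z c] Suc.prems(2) step_shift by auto
qed auto

lemma walk_sym: "(step ^^ k) (x, a) (y, b) \<Longrightarrow> \<exists>j. 2 * m dvd j \<and> (step ^^ k) (y, b) (x, a + j)"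
proof (induction k arbitrary: y b)
  case 0
  then show ?case by (intro exI[of _ 0]) auto
next
  case (Suc k)
  then obtain z c where zc: "(step ^^ k) (x, a) (z, c)" "step (z, c) (y, b)" by auto
  then obtain j where j: "2 * m dvd j" "(step ^^ k) (z, c) (x, a + j)" using Suc.IH by blast
  have "(step ^^ k) (z, c + 2 * m) (x, a + j + 2 * m)" by (rule walk_shift[OF j(2)]) simp
  then have "(step ^^ Suc k) (y, b) (x, a + (j + 2 * m))"
    using step_sym[OF zc(2)] by (intro relpowp_Suc_I2) (auto simp: algebra_simps)
  then show ?case using j(1) by (intro exI[of _ "j + 2 * m"]) auto
qed

lemma walk_lift: "(step ^^ k) (x, a) (y, b) \<Longrightarrow> m dvd a - s x \<Longrightarrow> m dvd b - s y"
  by (cases k) (auto simp: step_def)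

lemma walk_trans: "(step ^^ k) a b \<Longrightarrow> (step ^^ l) b c \<Longrightarrow> (step ^^ (k + l)) a c"
  by (auto simp: relpowp_add)

text \<open>As for two-colourings: each component of the overlap relation gets a root with a fixed
  lift, and a walk from the root prescribes every other lift, unambiguously modulo
  \<open>2 * m\<close> by the assumption.\<close>

lemma two_uniform_word_if_no_odd_walk:
  assumes no_odd: "\<And>x a b k. (step ^^ k) (x, a) (x, b) \<Longrightarrow> 2 * m dvd b - a"
  shows "\<exists>w. represents (C \<union> I) E w \<and> uniform 2 (C \<union> I) w"
proof -
  define R where "R a b \<longleftrightarrow> (\<exists>k. (step ^^ k) a b)" for a b
  define root where "root x = (SOME r. \<exists>a. R (r, s r) (x, a))" for x
  define t where "t x = (SOME a. R (root x, s (root x)) (x, a))" for x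
  have "\<exists>r a. R (r, s r) (x, a)" for x
    unfolding R_def by (metis relpowp_0_I)
  then have "\<exists>a. R (root x, s (root x)) (x, a)" for x
    unfolding root_def by (rule someI_ex)
  then have t: "R (root x, s (root x)) (x, t x)" for x
    unfolding t_def by (rule someI_ex)
  have R_lift: "m dvd a - s x" if "R (r, s r) (x, a)" for r x a
    using that walk_lift unfolding R_def by force
  show ?thesis
  proof (rule two_uniform_word[of t])
    show "m dvd t x - s x" for x using R_lift t by blast
    fix x y u assume xy: "x \<in> I" "y \<in> I" and u: "2 * m dvd u - t y"
    show "\<not> overlap (t x) (len x) u (len y)"
    proof
      assume ov: "overlap (t x) (len x) u (len y)"
      have lx: "m dvd t x - s x" and ly: "m dvd t y - s y" using R_lift t by blast+
      have "m dvd u - t y" using u by (metis dvd_mult_right)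
      from dvd_add[OF this ly] have lu: "m dvd u - s y" by simp
      then have lum: "m dvd u + m - s y" by (metis add_diff_eq add.commute dvd_add dvd_refl)
      have st: "step (x, t x) (y, u + m)" using xy lx lum ov by (simp add: step_def)
      have fwd: "R (r, s r) (y, a + (u + m - t x))" if "R (r, s r) (x, a)" for r a
      proof -
        have "m dvd a - t x" by (rule same_lift[OF R_lift[OF that] lx])
        then have "step (x, t x + (a - t x)) (y, u + m + (a - t x))" by (rule step_shift[OF st])
        then have "step (x, a) (y, a + (u + m - t x))" by (simp add: algebra_simps)
        then show ?thesis using that unfolding R_def by (metis relpowp_Suc_I)
      qed
      have bwd: "\<exists>b. R (r, s r) (x, b)" if "R (r, s r) (y, a)" for r a
      proof -
        have "m dvd a - (u + m)" by (rule same_lift[OF R_lift[OF that] lum])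
        then have "step (y, u + m + (a - (u + m))) (x, t x + 2 * m + (a - (u + m)))"
          by (rule step_shift[OF step_sym[OF st]])
        then have "step (y, a) (x, t x + 2 * m + (a - (u + m)))" by simp
        then show ?thesis using that unfolding R_def by (metis relpowp_Suc_I)
      qed
      \<comment> \<open>Exactly the same roots reach \<open>x\<close> and \<open>y\<close>, so both
        choices are made from one and the same predicate.\<close>
      have same: "root x = root y"
        unfolding root_def using fwd bwd by metis
      obtain k where k: "(step ^^ k) (root y, s (root y)) (y, t y)" using t[of y] by (auto simp: R_def)
      have "R (root x, s (root x)) (y, u + m)" using fwd[OF t[of x]] by simp
      then obtain l where l: "(step ^^ l) (root y, s (root y)) (y, u + m)" using same by (auto simp: R_def)
      obtain j where j: "2 * m dvd j" "(step ^^ k) (y, t y) (root y, s (root y) + j)" using walk_sym[OF k] by blast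
      have "m dvd j" using j(1) by (metis dvd_mult_right)
      \<comment> \<open>Back from \<open>t y\<close> to the root, then out again along the walk
        through \<open>x\<close>: a closed walk whose displacement is \<open>m\<close> modulo
        \<open>2 * m\<close>.\<close>
      from walk_trans[OF j(2) walk_shift[OF l this]] have "2 * m dvd u + m + j - t y" by (rule no_odd)
      from dvd_diff[OF dvd_diff[OF this j(1)] u] have "2 * m dvd m" by simp
      then show False using m_pos zdvd_imp_le[of "2 * m" m] by simp
    qed
  qed
qed

end

text \<open>The lifts \<open>U i\<close> unfold a closed walk of length \<open>n\<close> along the integers; \<open>D / m\<close> is its winding
  number, and oddness means that \<open>n + D / m\<close> is odd.\<close>
locale odd_cycle = circular_arcs +
  fixes n :: int and x :: "int \<Rightarrow> 'a" and U :: "int \<Rightarrow> int" and D :: int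
  assumes n: "3 \<le> n" and x_per: "\<And>i. x (i + n) = x i" and U_per: "\<And>i. U (i + n) = U i + D"
    and D_dvd: "m dvd D" and D_odd: "\<not> 2 * m dvd D + n * m"
    and xI: "\<And>i. x i \<in> I" and U_lift: "\<And>i. m dvd U i - s (x i)"
    and consec: "\<And>i. overlap (U i) (len (x i)) (U (i + 1)) (len (x (i + 1)))"
    and nonadj: "\<And>i j v. i + 2 \<le> j \<Longrightarrow> j \<le> i + n - 2 \<Longrightarrow> m dvd v - s (x j) \<Longrightarrow>
       \<not> overlap (U i) (len (x i)) v (len (x j))"

context circular_arcs
begin

lemma no_self_overlap:
  assumes "y \<in> I" "m dvd u - v"
  shows "\<not> overlap u (len y) v (len y)"
  using lift_dist[OF assms(2)] lift_dist[of v u] assms(2) len[OF assms(1)]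
  by (auto simp: overlap_def dvd_diff_commute)

lemma shortest_odd_walk:
  assumes odd_walk: "(step ^^ k) (y, a) (y, b)" "\<not> 2 * m dvd b - a"
  obtains n x U D where "odd_cycle C I E m cc s len n x U D"
proof -
  define odd_at where "odd_at k \<longleftrightarrow> (\<exists>y a b. (step ^^ k) (y, a) (y, b) \<and> \<not> 2 * m dvd b - a)" for k
  define N where "N = (LEAST k. odd_at k)"
  have "odd_at k" using odd_walk by (auto simp: odd_at_def)
  then have "odd_at N" unfolding N_def by (rule LeastI)
  then obtain y0 a0 b0 where w: "(step ^^ N) (y0, a0) (y0, b0)" "\<not> 2 * m dvd b0 - a0"
    by (auto simp: odd_at_def)
  have minimal: "2 * m dvd b - a" if "(step ^^ k) (y, a) (y, b)" "k < N" for k y a b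
    using not_less_Least[of k odd_at] that unfolding N_def odd_at_def by blast
  obtain f where f: "f 0 = (y0, a0)" "f N = (y0, b0)" "\<And>i. i < N \<Longrightarrow> step (f i) (f (Suc i))"
    using w(1) unfolding relpowp_fun_conv by blast
  define X where "X i = fst (f i)" for i
  define T where "T i = snd (f i)" for i
  have fX: "f i = (X i, T i)" for i by (simp add: X_def T_def)
  have st: "step (X i, T i) (X (Suc i), T (Suc i))" if "i < N" for i using f(3)[OF that] by (simp add: fX)
  have X0: "X N = X 0" and TN: "\<not> 2 * m dvd T N - T 0" using f(1,2) w(2) by (simp_all add: X_def T_def)
  have "N \<noteq> 0" using TN by (cases "N = 0") auto
  then have N0: "0 < N" by simp
  have XI: "X i \<in> I" "m dvd T i - s (X i)" if "i \<le> N" for i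
  proof -
    have "X i \<in> I \<and> m dvd T i - s (X i)"
    proof (cases "i = N")
      case True
      then show ?thesis using st[of "N - 1"] N0 by (simp add: step_def)
    next
      case False
      then show ?thesis using st[of i] that by (simp add: step_def)
    qed
    then show "X i \<in> I" "m dvd T i - s (X i)" by simp_all
  qed
  have sub: "(step ^^ d) (X i, T i) (X (i + d), T (i + d))" if "i + d \<le> N" for i d
    using that
  proof (induction d)
    case (Suc d)
    then show ?case using st[of "i + d"] by auto
  qed simp
  \<comment> \<open>For length 1 an arc would overlap a lift of itself. For length 2 one-sidedness
    makes the second step retrace the first, with displacement exactly \<open>2 * m\<close>.\<close>
  have N3: "3 \<le> N"
  proof (rule ccontr)
    assume "\<not> 3 \<le> N"
    then have "N = 1 \<or> N = 2" using N0 by auto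
    then show False
    proof
      assume N: "N = 1"
      have "overlap (T 0) (len (X 0)) (T 1 - m) (len (X 0))" "m dvd T 0 - s (X 0)" "m dvd T 1 - s (X 0)" "X 0 \<in> I"
        using st[of 0] N X0 by (simp_all add: step_def)
      moreover have "m dvd T 0 - (T 1 - m)"
        using dvd_add[OF same_lift[OF calculation(2,3)], of m] by (simp add: algebra_simps)
      ultimately show False using no_self_overlap by blast
    next
      assume N: "N = 2"
      have s0: "step (X 0, T 0) (X 1, T 1)" and s1: "step (X 1, T 1) (X 0, T 2)"
        using st[of 0] st[of 1] N X0 by (simp_all add: numeral_2_eq_2)
      have I01: "X 0 \<in> I" "X 1 \<in> I" "m dvd T 0 - s (X 0)" "m dvd T 2 - s (X 0)" "m dvd T 1 - s (X 1)"
        using s0 s1 by (simp_all add: step_def)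
      have "overlap (T 1) (len (X 1)) (T 0 + m) (len (X 0))"
        using s0 unfolding step_def overlap_def by simp linarith
      moreover have "overlap (T 1) (len (X 1)) (T 2 - m) (len (X 0))" using s1 by (simp add: step_def)
      moreover have "m dvd T 0 + m - s (X 0)" "m dvd T 2 - m - s (X 0)"
        using dvd_add[OF I01(3), of m] dvd_diff[OF I01(4), of m] by (simp_all add: algebra_simps)
      ultimately have "T 0 + m = T 2 - m" using one_sided_lift[OF I01(2,1,5)] by blast
      then have "T 2 - T 0 = 2 * m" by simp
      then show False using TN N by simp
    qed
  qed
  \<comment> \<open>An overlap of two nonconsecutive arcs is a shortcut that splits the closed walk
    into two shorter ones. By minimality both displacements are multiples of \<open>2 * m\<close>,
    and modulo \<open>2 * m\<close> they add up to that of the whole walk.\<close>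
  have far: "\<not> overlap u (len (X i)) v (len (X j))"
    if ij: "i < j" "j < N" "i + 2 \<le> j" "j + 2 \<le> i + N" and u: "m dvd u - s (X i)" and v: "m dvd v - s (X j)" for i j u v
  proof
    assume o: "overlap u (len (X i)) v (len (X j))"
    have iN: "i \<le> N" and jN: "j \<le> N" using ij by auto
    define T' where "T' = T j + (u - v) + m"
    have dj: "m dvd T j - v" by (rule same_lift[OF XI(2)[OF jN] v])
    have "m dvd T' - s (X i)"
      using dvd_add[OF dvd_add[OF u dj], of m] by (simp add: T'_def algebra_simps)
    moreover have "overlap (T j) (len (X j)) (T' - m) (len (X i))"
      using o unfolding overlap_def T'_def by linarith
    ultimately have ret: "step (X j, T j) (X i, T')"
      using XI[OF iN] XI[OF jN] by (simp add: step_def)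
    have w1: "(step ^^ (j - i)) (X i, T i) (X j, T j)" using sub[of i "j - i"] ij by simp
    have "(step ^^ (Suc (j - i))) (X i, T i) (X i, T')" by (rule relpowp_Suc_I[OF w1 ret])
    then have A: "2 * m dvd T' - T i" by (rule minimal) (use ij in auto)
    have dT: "m dvd T i - T'" by (rule same_lift[OF XI(2)[OF iN] \<open>m dvd T' - s (X i)\<close>])
    have "step (X i, T' + (T i - T')) (X j, T j + 2 * m + (T i - T'))"
      by (rule step_shift[OF step_sym[OF ret] dT])
    then have fwd: "step (X i, T i) (X j, T j + (2 * m + T i - T'))" by (simp add: algebra_simps)
    have w0: "(step ^^ i) (X 0, T 0) (X i, T i)" using sub[of 0 i] ij by simp
    have w2: "(step ^^ (N - j)) (X j, T j) (X N, T N)" using sub[of j "N - j"] ij by simp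
    have "m dvd 2 * m + T i - T'" using dvd_add[OF dT, of "2 * m"] by (simp add: algebra_simps)
    from walk_trans[OF relpowp_Suc_I[OF w0 fwd] walk_shift[OF w2 this]]
    have "(step ^^ (Suc i + (N - j))) (X 0, T 0) (X 0, T N + (2 * m + T i - T'))" by (simp add: X0)
    then have "2 * m dvd T N + (2 * m + T i - T') - T 0" by (rule minimal) (use ij in auto)
    from dvd_diff[OF dvd_add[OF this A], of "2 * m"] have "2 * m dvd T N - T 0" by (simp add: algebra_simps)
    then show False using TN by blast
  qed
  define n where "n = int N"
  \<comment> \<open>Subtracting \<open>m\<close> for every step undoes the antipodal shifts, so that
    consecutive lifts overlap directly; \<open>D\<close> is what then remains of the displacement of
    the walk.\<close>
  define D where "D = T N - T 0 - n * m"
  define x where "x z = X (nat (z mod n))" for z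
  define U where "U z = T (nat (z mod n)) - (z mod n) * m + (z div n) * D" for z
  have npos: "0 < n" using N0 by (simp add: n_def)
  have D_dvd: "m dvd D"
    using same_lift[OF XI(2)[of N] XI(2)[of 0, folded X0]] by (simp add: D_def)
  have at: "x z = X i \<and> U z = T i - int i * m + d * D" if z: "z = int i + d * n" and i: "i \<le> N" for z i d
  proof (cases "i = N")
    case True
    then have "z mod n = 0" "z div n = d + 1" using z npos by (simp_all add: n_def algebra_simps)
    then show ?thesis using True X0 by (simp add: x_def U_def D_def n_def algebra_simps)
  next
    case False
    then have "int i < n" using i by (simp add: n_def)
    then have "z mod n = int i" "z div n = d" using z npos by simp_all
    then show ?thesis by (simp add: x_def U_def)
  qed
  have div_rep: "\<exists>i d. z = int i + d * n \<and> i < N" for z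
  proof (intro exI conjI)
    show "z = int (nat (z mod n)) + (z div n) * n" using npos by simp
    show "nat (z mod n) < N" using npos pos_mod_bound[OF npos, of z] by (simp add: n_def nat_less_iff)
  qed
  have lift: "x z \<in> I \<and> m dvd U z - s (x z)" for z
  proof -
    obtain i d where id: "z = int i + d * n" "i < N" using div_rep by blast
    have "m dvd T i - s (X i) - int i * m + d * D"
      by (rule dvd_add[OF dvd_diff[OF XI(2)]]) (use D_dvd id(2) in simp_all)
    moreover have "T i - s (X i) - int i * m + d * D = U z - s (x z)" "x z = X i"
      using at[OF id(1)] id(2) by simp_all
    ultimately show ?thesis using XI(1)[of i] id(2) by simp
  qed
  have "odd_cycle C I E m cc s len n x U D"
  proof
    show "3 \<le> n" using N3 by (simp add: n_def)
    show "x (z + n) = x z" for z by (simp add: x_def)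
    show "U (z + n) = U z + D" for z using npos by (simp add: U_def div_add_self2 distrib_right)
    show "m dvd D" by fact
    show "\<not> 2 * m dvd D + n * m" using TN by (simp add: D_def)
    show "x z \<in> I" "m dvd U z - s (x z)" for z using lift by blast+
    show "overlap (U z) (len (x z)) (U (z + 1)) (len (x (z + 1)))" for z
    proof -
      obtain i d where id: "z = int i + d * n" "i < N" using div_rep by blast
      have 1: "x z = X i" "U z = T i - int i * m + d * D" using at[OF id(1)] id(2) by simp_all
      have 2: "x (z + 1) = X (Suc i)" "U (z + 1) = T (Suc i) - int (Suc i) * m + d * D"
        using at[of "z + 1" "Suc i" d] id by simp_all
      have "overlap (T i) (len (X i)) (T (Suc i) - m) (len (X (Suc i)))" using st[OF id(2)] by (simp add: step_def)
      then show ?thesis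
        unfolding 1 2 using overlap_shift[of "T i" "d * D - int i * m" "len (X i)" "T (Suc i) - m" "len (X (Suc i))"]
        by (simp add: algebra_simps)
    qed
    show "\<not> overlap (U z) (len (x z)) v (len (x z'))"
      if zz: "z + 2 \<le> z'" "z' \<le> z + n - 2" and v: "m dvd v - s (x z')" for z z' v
    proof -
      obtain i d where id: "z = int i + d * n" "i < N" using div_rep by blast
      obtain j e where je: "z' = int j + e * n" "j < N" using div_rep by blast
      have xz: "x z = X i" "x z' = X j" using at[OF id(1)] at[OF je(1)] id(2) je(2) by simp_all
      have lz: "m dvd U z - s (X i)" using lift[of z] xz by simp
      have ne: "e = d \<or> e = d + 1"
      proof -
        have "\<not> e \<le> d - 1"
        proof
          assume "e \<le> d - 1"
          then have "e * n \<le> (d - 1) * n" using npos by (intro mult_right_mono) auto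
          then show False using id je zz by (simp add: n_def algebra_simps)
        qed
        moreover have "\<not> e \<ge> d + 2"
        proof
          assume "e \<ge> d + 2"
          then have "e * n \<ge> (d + 2) * n" using npos by (intro mult_right_mono) auto
          then show False using id je zz by (simp add: n_def algebra_simps)
        qed
        ultimately show ?thesis by linarith
      qed
      then show ?thesis
      proof
        assume "e = d"
        then have "i < j" "i + 2 \<le> j" "j + 2 \<le> i + N" using id je zz by (auto simp: n_def)
        then show ?thesis unfolding xz using far[of i j "U z" v] je(2) lz v xz by simp
      next
        assume "e = d + 1"
        then have "j < i" "j + 2 \<le> i" "i + 2 \<le> j + N" using id je zz by (auto simp: n_def algebra_simps)
        then show ?thesis unfolding xz overlap_commute[of "U z"] using far[of j i v "U z"] id(2) lz v xz by simp
      qed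
    qed
  qed
  then show thesis by (rule that)
qed

theorem two_uniform_or_odd_cycle:
  "(\<exists>w. represents (C \<union> I) E w \<and> uniform 2 (C \<union> I) w) \<or> (\<exists>n x U D. odd_cycle C I E m cc s len n x U D)"
  using two_uniform_word_if_no_odd_walk shortest_odd_walk by metis

end

section \<open>Recognising the forbidden graphs\<close>

lemma int_chain_less:
  fixes f :: "int \<Rightarrow> int"
  assumes "\<And>i. a \<le> i \<Longrightarrow> i < b \<Longrightarrow> f i < f (i + 1)" "a \<le> i" "i < j" "j \<le> b"
  shows "f i < f j"
  using assms(3,4)
proof (induction j rule: int_gr_induct)
  case base
  then show ?case using assms(1,2) by simp
next
  case (step j)
  then show ?case using assms(1)[of j] assms(2) by simp
qed

text \<open>An interval overlapping the smaller one has an end strictly inside it, hence strictly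
  inside the larger one. It can therefore neither contain nor avoid the larger interval.\<close>

lemma contained_step:
  assumes "a \<le> b" "b + lb \<le> a + la" "overlap b lb c lc" "\<not> overlap a la c lc"
  shows "a \<le> c \<and> c + lc \<le> a + la"
  using assms unfolding overlap_def by linarith

lemma image_pairs:
  fixes A :: "nat set"
  assumes "\<And>i j. i \<in> A \<Longrightarrow> j \<in> A \<Longrightarrow> i < j \<Longrightarrow> Q (f i) (f j)" "\<And>a b. Q a b \<Longrightarrow> Q b a"
    and "a \<in> f ` A" "b \<in> f ` A" "a \<noteq> b"
  shows "Q a b"
proof -
  obtain i j where ij: "a = f i" "b = f j" "i \<in> A" "j \<in> A" using assms(3,4) by blast
  then have "i \<noteq> j" using assms(5) by blast
  then show ?thesis using ij assms(1)[of i j] assms(1)[of j i] assms(2) by (cases i j rule: linorder_cases) auto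
qed

context circular_arcs
begin

text \<open>Only adjacencies between the two sides have to be checked: edges within a side are
  determined by the split partition, and injectivity follows because distinct vertices of a side
  have different adjacencies to the other side.\<close>

lemma induced_copyI:
  assumes "f ` Cs \<subseteq> C" "f ` Is \<subseteq> I" "Cs \<inter> Is = {}"
    and adj: "\<And>a c. a \<in> Is \<Longrightarrow> c \<in> Cs \<Longrightarrow> E (f a) (f c) \<longleftrightarrow> c \<in> N a"
    and sepC: "\<And>c c'. c \<in> Cs \<Longrightarrow> c' \<in> Cs \<Longrightarrow> c \<noteq> c' \<Longrightarrow> \<exists>a\<in>Is. (c \<in> N a) \<noteq> (c' \<in> N a)"
    and sepI: "\<And>a a'. a \<in> Is \<Longrightarrow> a' \<in> Is \<Longrightarrow> a \<noteq> a' \<Longrightarrow> \<exists>c\<in>Cs. (c \<in> N a) \<noteq> (c \<in> N a')"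
  shows "has_induced_copy (C \<union> I) E (sg_V Cs Is) (sg_E Cs Is N)"
proof -
  have injC: "f c \<noteq> f c'" if "c \<in> Cs" "c' \<in> Cs" "c \<noteq> c'" for c c'
  proof
    assume eq: "f c = f c'"
    obtain a where "a \<in> Is" "(c \<in> N a) \<noteq> (c' \<in> N a)" using sepC[OF \<open>c \<in> Cs\<close> \<open>c' \<in> Cs\<close> \<open>c \<noteq> c'\<close>] by blast
    then show False using adj[of a c] adj[of a c'] that eq by simp
  qed
  have injI: "f a \<noteq> f a'" if "a \<in> Is" "a' \<in> Is" "a \<noteq> a'" for a a'
  proof
    assume eq: "f a = f a'"
    obtain c where "c \<in> Cs" "(c \<in> N a) \<noteq> (c \<in> N a')" using sepI[OF \<open>a \<in> Is\<close> \<open>a' \<in> Is\<close> \<open>a \<noteq> a'\<close>] by blast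
    then show False using adj[of a c] adj[of a' c] that eq by simp
  qed
  have fC: "f c \<in> C" if "c \<in> Cs" for c using assms(1) that by blast
  have fI: "f a \<in> I" if "a \<in> Is" for a using assms(2) that by blast
  have injCI: "f a \<noteq> f c" if "a \<in> Is" "c \<in> Cs" for a c 
    using fC[OF that(2)] fI[OF that(1)] disj by (metis disjoint_iff)
  have inj: "inj_on f (Cs \<union> Is)"
  proof (rule inj_onI, rule ccontr)
    fix u v assume uv: "u \<in> Cs \<union> Is" "v \<in> Cs \<union> Is" "f u = f v" "u \<noteq> v"
    then consider "u \<in> Cs" "v \<in> Cs" | "u \<in> Cs" "v \<in> Is" | "u \<in> Is" "v \<in> Cs" | "u \<in> Is" "v \<in> Is" by blast
    then show False
      using injC[of u v] injI[of u v] injCI[of u v] injCI[of v u] uv(3,4) by cases auto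
  qed
  have E: "sg_E Cs Is N u v \<longleftrightarrow> E (f u) (f v)" if uv: "u \<in> Cs \<union> Is" "v \<in> Cs \<union> Is" "u \<noteq> v" for u v
  proof -
    consider "u \<in> Cs" "v \<in> Cs" | "u \<in> Cs" "v \<in> Is" | "u \<in> Is" "v \<in> Cs" | "u \<in> Is" "v \<in> Is" using uv by blast
    then show ?thesis
    proof cases
      case 1
      then have "E (f u) (f v)" using clique fC injC[OF 1 uv(3)] by (simp add: is_clique_def)
      then show ?thesis using 1 uv(3) by (simp add: sg_E_def)
    next
      case 2
      have "E (f u) (f v) \<longleftrightarrow> E (f v) (f u)" using sym fC[OF 2(1)] fI[OF 2(2)] by blast
      then show ?thesis using 2 uv(3) adj[OF 2(2,1)] assms(3) by (auto simp: sg_E_def)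
    next
      case 3
      then show ?thesis using uv(3) adj[OF 3] assms(3) by (auto simp: sg_E_def)
    next
      case 4
      then have "\<not> E (f u) (f v)" using indep fI by (simp add: is_indep_def)
      then show ?thesis using 4 assms(3) by (auto simp: sg_E_def)
    qed
  qed
  show ?thesis
    unfolding has_induced_copy_def sg_V_def
    by (rule exI[of _ f]) (use inj fC fI E in auto)
qed

lemma adj_in_window:
  assumes y: "y \<in> I" "m dvd u - s y" and "B \<le> u" "u + len y \<le> B + m" "B < z" "z \<le> B + m"
  shows "E y (cc z) \<longleftrightarrow> u < z \<and> z \<le> u + len y"
proof (cases "u < z")
  case True
  then show ?thesis using adj_window[OF y] assms by simp
next
  case False
  have "m dvd u - m - s y" using dvd_diff[OF y(2), of m] by (simp add: algebra_simps)
  then show ?thesis using adj_window[OF y(1), of "u - m" z] False assms len[OF y(1)] by simp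
qed

text \<open>The working form of \<open>one_sided\<close>. A second lift of \<open>z\<close> that
  meets the interval of \<open>y\<close> without overlapping it would be nested with it. As lifts of
  \<open>z\<close> are at least \<open>m\<close> apart and all arcs are shorter than
  \<open>m\<close>, this leaves no room for the overlap with the first lift.\<close>

lemma other_lift_disjoint:
  assumes yz: "y \<in> I" "z \<in> I" and l: "m dvd u - s y" "m dvd v - s z" "m dvd v' - s z"
    and o: "overlap u (len y) v (len z)" and ne: "v \<noteq> v'"
  shows "u + len y \<le> v' \<or> v' + len z \<le> u"
proof -
  have no: "\<not> overlap u (len y) v' (len z)"
    using one_sided_lift[OF yz l o] ne by blast
  have "v + m \<le> v' \<or> v' + m \<le> v"
    using lift_dist[OF same_lift[OF l(2,3)]] lift_dist[OF same_lift[OF l(3,2)]] ne by linarith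
  then show ?thesis
    using no o len[OF yz(1)] len[OF yz(2)] unfolding overlap_def by linarith
qed

lemma contains_F0:
  assumes y: "\<And>i. i \<in> {1..3} \<Longrightarrow> y i \<in> I \<and> m dvd l i - s (y (i :: nat))"
    and o: "l 1 < l 2" "l 2 < l 3" "l 3 < l 1 + len (y 1)" "l 1 + len (y 1) < l 2 + len (y 2)"
      "l 2 + len (y 2) < l 3 + len (y 3)"
  shows "contains_C3 (C \<union> I) E"
proof -
  have y': "y 1 \<in> I" "y 2 \<in> I" "y 3 \<in> I" "m dvd l 1 - s (y 1)" "m dvd l 2 - s (y 2)" "m dvd l 3 - s (y 3)"
    using y by auto
  define r where "r i = l i + len (y i)" for i
  have "m dvd l 1 + m - s (y 1)" using dvd_add[OF y'(4), of m] by (simp add: algebra_simps)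
  moreover have "overlap (l 3) (len (y 3)) (l 1) (len (y 1))" using o by (simp add: overlap_def)
  ultimately have "r 3 \<le> l 1 + m"
    using other_lift_disjoint[OF y'(3,1,6,4)] o m_pos len[OF y'(1)] unfolding r_def by fastforce
  note win = adj_in_window[where B = "l 1"]
  \<comment> \<open>The interval ends are ordered \<open>l 1\<close>, \<open>l 2\<close>,
    \<open>l 3\<close>, \<open>r 1\<close>, \<open>r 2\<close>, \<open>r 3\<close>. The clique
    vertices just before the last five of these gaps are \<open>Cv 2\<close>, \<open>Cv 3\<close>,
    \<open>Zero\<close>, \<open>Cv 4\<close>, \<open>Cv 1\<close>, since a position \<open>z\<close>
    names the vertex preceding gap \<open>z\<close>.\<close>
  define e where "e v = (if v = Cv 2 then l 2 else if v = Cv 3 then l 3 else if v = Zero then r 1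
    else if v = Cv 4 then r 2 else r 3)" for v
  have e: "E (y 1) (cc (e c)) \<longleftrightarrow> c \<in> F0_N (Av 1)" "E (y 2) (cc (e c)) \<longleftrightarrow> c \<in> F0_N (Av 2)"
    "E (y 3) (cc (e c)) \<longleftrightarrow> c \<in> F0_N (Av 3)" if c: "c \<in> F0_C" for c
  proof -
    have ec: "l 1 < e c" "e c \<le> l 1 + m"
      using o \<open>r 3 \<le> l 1 + m\<close> by (auto simp: e_def r_def)
    show "E (y 1) (cc (e c)) \<longleftrightarrow> c \<in> F0_N (Av 1)" "E (y 2) (cc (e c)) \<longleftrightarrow> c \<in> F0_N (Av 2)"
      "E (y 3) (cc (e c)) \<longleftrightarrow> c \<in> F0_N (Av 3)"
      using win[OF y'(1,4) _ _ ec] win[OF y'(2,5) _ _ ec] win[OF y'(3,6) _ _ ec] c o \<open>r 3 \<le> l 1 + m\<close>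
      by (auto simp: e_def r_def F0_C_def F0_N_def)
  qed
  define f where "f v = (if v = Av 1 then y 1 else if v = Av 2 then y 2 else if v = Av 3 then y 3 else cc (e v))" for v
  have "has_induced_copy (C \<union> I) E (sg_V F0_C F0_I) (sg_E F0_C F0_I F0_N)"
  proof (rule induced_copyI[of f])
    show "f ` F0_C \<subseteq> C" using cc_range by (auto simp: F0_C_def f_def)
    show "f ` F0_I \<subseteq> I" using y' by (auto simp: F0_I_def f_def)
    show "F0_C \<inter> F0_I = {}" by (auto simp: F0_C_def F0_I_def)
    show "E (f a) (f c) \<longleftrightarrow> c \<in> F0_N a" if "a \<in> F0_I" "c \<in> F0_C" for a c
    proof -
      have "f c = cc (e c)" using that(2) by (auto simp: f_def F0_C_def)
      then show ?thesis using that(1) e[OF that(2)] by (auto simp: F0_I_def f_def)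
    qed
    show "\<exists>a\<in>F0_I. (c \<in> F0_N a) \<noteq> (c' \<in> F0_N a)" if "c \<in> F0_C" "c' \<in> F0_C" "c \<noteq> c'" for c c'
      using that by (auto simp: F0_C_def F0_I_def F0_N_def)
    show "\<exists>c\<in>F0_C. (c \<in> F0_N a) \<noteq> (c \<in> F0_N a')" if "a \<in> F0_I" "a' \<in> F0_I" "a \<noteq> a'" for a a'
      using that by (auto simp: F0_C_def F0_I_def F0_N_def)
  qed
  then show ?thesis by (simp add: contains_C3_def)
qed

lemma contains_sun:
  fixes k :: nat and e :: "int \<Rightarrow> int" and y :: "int \<Rightarrow> 'a"
  assumes k: "even k" "4 \<le> k" and y: "\<And>i. y i \<in> I"
    and adj: "\<And>i j. 1 \<le> i \<Longrightarrow> i \<le> k \<Longrightarrow> 1 \<le> j \<Longrightarrow> j \<le> k \<Longrightarrow>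
      E (y (int i)) (cc (e (int j))) \<longleftrightarrow> j = i \<or> j = Suc i \<or> i = k \<and> j = 1"
  shows "contains_C3 (C \<union> I) E"
proof -
  define f where "f v = (case v of Cv i \<Rightarrow> cc (e (int i)) | Av i \<Rightarrow> y (int i) | _ \<Rightarrow> undefined)" for v
  have "has_induced_copy (C \<union> I) E (sg_V (sun_C k) (sun_I k)) (sg_E (sun_C k) (sun_I k) (sun_N k))"
  proof (rule induced_copyI[of f])
    show "f ` sun_C k \<subseteq> C" using cc_range by (auto simp: sun_C_def f_def)
    show "f ` sun_I k \<subseteq> I" using y by (auto simp: sun_I_def f_def)
    show "sun_C k \<inter> sun_I k = {}" by (auto simp: sun_C_def sun_I_def)
    have N: "Cv j \<in> sun_N k (Av i) \<longleftrightarrow> j = i \<or> j = Suc i \<or> i = k \<and> j = 1" if "i \<in> {1..k}" "j \<in> {1..k}" for i j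
      using that k by (auto simp: sun_N_def)
    show "E (f a) (f c) \<longleftrightarrow> c \<in> sun_N k a" if "a \<in> sun_I k" "c \<in> sun_C k" for a c
      using that adj N by (auto simp: sun_I_def sun_C_def f_def)
    have sepC: "\<exists>a\<in>sun_I k. (Cv i \<in> sun_N k a) \<noteq> (Cv j \<in> sun_N k a)" if "i \<in> {1..k}" "j \<in> {1..k}" "i < j" for i j
    proof (cases "j = Suc i")
      case True
      then show ?thesis
        using that k N[of j i] N[of j j] by (intro bexI[of _ "Av j"]) (auto simp: sun_I_def)
    next
      case False
      then show ?thesis
        using that k N[of i i] N[of i j] by (intro bexI[of _ "Av i"]) (auto simp: sun_I_def)
    qed
    show "\<exists>a\<in>sun_I k. (c \<in> sun_N k a) \<noteq> (c' \<in> sun_N k a)" if "c \<in> sun_C k" "c' \<in> sun_C k" "c \<noteq> c'" for c c'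
      by (rule image_pairs[where f = Cv and Q = "\<lambda>c c'. \<exists>a\<in>sun_I k. (c \<in> sun_N k a) \<noteq> (c' \<in> sun_N k a)", OF sepC _ that[unfolded sun_C_def]]) auto
    have sepI: "\<exists>c\<in>sun_C k. (c \<in> sun_N k (Av i)) \<noteq> (c \<in> sun_N k (Av j))" if "i \<in> {1..k}" "j \<in> {1..k}" "i < j" for i j
    proof (cases "j = k \<and> i = 1")
      case True
      then show ?thesis
        using k N[of 1 2] N[of k 2] by (intro bexI[of _ "Cv 2"]) (auto simp: sun_C_def)
    next
      case False
      then show ?thesis
        using that N[of i i] N[of j i] by (intro bexI[of _ "Cv i"]) (auto simp: sun_C_def)
    qed
    show "\<exists>c\<in>sun_C k. (c \<in> sun_N k a) \<noteq> (c \<in> sun_N k a')" if "a \<in> sun_I k" "a' \<in> sun_I k" "a \<noteq> a'" for a a'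
      by (rule image_pairs[where f = Av and Q = "\<lambda>a a'. \<exists>c\<in>sun_C k. (c \<in> sun_N k a) \<noteq> (c \<in> sun_N k a')", OF sepI _ that[unfolded sun_I_def]]) auto
  qed
  with k show ?thesis unfolding contains_C3_def by blast
qed

lemma contains_F1:
  fixes k :: nat and e :: "int \<Rightarrow> int" and y :: "int \<Rightarrow> 'a"
  assumes k: "odd k" "5 \<le> k" and y: "\<And>i. y i \<in> I" and b: "b1 \<in> I" "b2 \<in> I"
    and adj: "\<And>i j. 1 \<le> i \<Longrightarrow> i \<le> k - 2 \<Longrightarrow> 1 \<le> j \<Longrightarrow> j \<le> k - 1 \<Longrightarrow>
      E (y (int i)) (cc (e (int j))) \<longleftrightarrow> j = i \<or> j = Suc i"
    and adj1: "\<And>j. 1 \<le> j \<Longrightarrow> j \<le> k - 1 \<Longrightarrow> E b1 (cc (e (int j))) \<longleftrightarrow> j \<le> k - 2"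
    and adj2: "\<And>j. 1 \<le> j \<Longrightarrow> j \<le> k - 1 \<Longrightarrow> E b2 (cc (e (int j))) \<longleftrightarrow> 2 \<le> j"
  shows "contains_C3 (C \<union> I) E"
proof -
  define f where "f v = (case v of Cv i \<Rightarrow> cc (e (int i)) | Av i \<Rightarrow> y (int i) | Bv i \<Rightarrow> if i = 1 then b1 else b2
    | _ \<Rightarrow> undefined)" for v
  have "has_induced_copy (C \<union> I) E (sg_V (F1_C k) (F1_I k)) (sg_E (F1_C k) (F1_I k) (F1_N k))"
  proof (rule induced_copyI[of f])
    show "f ` F1_C k \<subseteq> C" using cc_range by (auto simp: F1_C_def f_def)
    show "f ` F1_I k \<subseteq> I" using y b by (auto simp: F1_I_def f_def)
    show "F1_C k \<inter> F1_I k = {}" by (auto simp: F1_C_def F1_I_def)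
    have N: "Cv j \<in> F1_N k (Av i) \<longleftrightarrow> j = i \<or> j = Suc i" if "i \<in> {1..k-2}" "j \<in> {1..k-1}" for i j
      using that k by (auto simp: F1_N_def)
    have NB: "Cv j \<in> F1_N k (Bv 1) \<longleftrightarrow> j \<in> {1..k-2}" "Cv j \<in> F1_N k (Bv 2) \<longleftrightarrow> j \<in> {2..k-1}" for j
      by (auto simp: F1_N_def)
    have memI: "Bv 1 \<in> F1_I k" "Bv 2 \<in> F1_I k" "\<And>i. i \<in> {1..k-2} \<Longrightarrow> Av i \<in> F1_I k" by (auto simp: F1_I_def)
    have memC: "Cv j \<in> F1_C k" if "j \<in> {1..k-1}" for j using that by (auto simp: F1_C_def)
    have casesI: "a = Bv 1 \<or> a = Bv 2 \<or> (\<exists>i\<in>{1..k-2}. a = Av i)" if "a \<in> F1_I k" for a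
      using that by (auto simp: F1_I_def)
    show "E (f a) (f c) \<longleftrightarrow> c \<in> F1_N k a" if a: "a \<in> F1_I k" and c: "c \<in> F1_C k" for a c
    proof -
      obtain j where j: "c = Cv j" "j \<in> {1..k-1}" using c by (auto simp: F1_C_def)
      from casesI[OF a] show ?thesis
      proof (elim disjE bexE)
        assume "a = Bv 1"
        then show ?thesis using j NB(1)[of j] adj1[of j] by (simp add: f_def)
      next
        assume "a = Bv 2"
        then show ?thesis using j NB(2)[of j] adj2[of j] by (simp add: f_def)
      next
        fix i assume i: "i \<in> {1..k-2}" "a = Av i"
        then show ?thesis using j N[OF i(1) j(2)] adj[of i j] by (simp add: f_def)
      qed
    qed
    have sepC: "\<exists>a\<in>F1_I k. (Cv i \<in> F1_N k a) \<noteq> (Cv j \<in> F1_N k a)"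
      if ij: "i \<in> {1..k-1}" "j \<in> {1..k-1}" "i < j" for i j
    proof (cases "j = Suc i")
      case False
      then show ?thesis
        using ij N[of i i] N[of i j] by (intro bexI[of _ "Av i"] memI) auto
    next
      case True
      show ?thesis
      proof (cases "j \<le> k - 2")
        case True
        then show ?thesis
          using ij N[of j i] N[of j j] by (intro bexI[of _ "Av j"] memI) auto
      next
        case False
        then show ?thesis
          using ij NB(1)[of i] NB(1)[of j] \<open>j = Suc i\<close> by (intro bexI[of _ "Bv 1"] memI) auto
      qed
    qed
    show "\<exists>a\<in>F1_I k. (c \<in> F1_N k a) \<noteq> (c' \<in> F1_N k a)" if "c \<in> F1_C k" "c' \<in> F1_C k" "c \<noteq> c'" for c c'
      by (rule image_pairs[where f = Cv and Q = "\<lambda>c c'. \<exists>a\<in>F1_I k. (c \<in> F1_N k a) \<noteq> (c' \<in> F1_N k a)", OF sepC _ that[unfolded F1_C_def]]) auto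
    have sepA: "\<exists>c\<in>F1_C k. (c \<in> F1_N k (Av i)) \<noteq> (c \<in> F1_N k (Av j))"
      if "i \<in> {1..k-2}" "j \<in> {1..k-2}" "i < j" for i j
      using that N[of i i] N[of j i] by (intro bexI[of _ "Cv i"] memC) auto
    have sepB: "\<exists>c\<in>F1_C k. (c \<in> F1_N k (Bv 1)) \<noteq> (c \<in> F1_N k (Bv 2))"
      using k NB[of 1] by (intro bexI[of _ "Cv 1"] memC) auto
    have sepB1: "\<exists>c\<in>F1_C k. (c \<in> F1_N k (Bv 1)) \<noteq> (c \<in> F1_N k (Av i))" if "i \<in> {1..k-2}" for i
    proof (cases "i = 1")
      case True
      then show ?thesis using k that NB(1)[of 3] N[of i 3] by (intro bexI[of _ "Cv 3"] memC) auto
    next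
      case False
      then show ?thesis using k that NB(1)[of 1] N[of i 1] by (intro bexI[of _ "Cv 1"] memC) auto
    qed
    have sepB2: "\<exists>c\<in>F1_C k. (c \<in> F1_N k (Bv 2)) \<noteq> (c \<in> F1_N k (Av i))" if "i \<in> {1..k-2}" for i
    proof (cases "i \<le> 2")
      case True
      then show ?thesis using k that NB(2)[of 4] N[of i 4] by (intro bexI[of _ "Cv 4"] memC) auto
    next
      case False
      then show ?thesis using k that NB(2)[of 2] N[of i 2] by (intro bexI[of _ "Cv 2"] memC) auto
    qed
    have sepAA: "\<exists>c\<in>F1_C k. (c \<in> F1_N k (Av i)) \<noteq> (c \<in> F1_N k (Av j))"
      if "i \<in> {1..k-2}" "j \<in> {1..k-2}" "i \<noteq> j" for i j
      using that sepA[of i j] sepA[of j i] by (cases i j rule: linorder_cases) blast+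
    show "\<exists>c\<in>F1_C k. (c \<in> F1_N k a) \<noteq> (c \<in> F1_N k a')" if a: "a \<in> F1_I k" "a' \<in> F1_I k" "a \<noteq> a'" for a a'
      using casesI[OF a(1)] casesI[OF a(2)] a(3)
      by (elim disjE bexE) (use sepAA sepB sepB1 sepB2 in blast)+
  qed
  with k show ?thesis unfolding contains_C3_def by blast
qed

lemma contains_F2:
  fixes k :: nat and e :: "int \<Rightarrow> int" and y :: "int \<Rightarrow> 'a"
  assumes k: "odd k" "5 \<le> k" and y: "\<And>i. y i \<in> I" and b: "b \<in> I"
    and adj: "\<And>i j. 1 \<le> i \<Longrightarrow> i \<le> k - 1 \<Longrightarrow> 1 \<le> j \<Longrightarrow> j \<le> k \<Longrightarrow>
      E (y (int i)) (cc (e (int j))) \<longleftrightarrow> j = i \<or> j = Suc i"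
    and adj1: "\<And>j. 1 \<le> j \<Longrightarrow> j \<le> k \<Longrightarrow> E b (cc (e (int j))) \<longleftrightarrow> 2 \<le> j \<and> j \<le> k - 1"
  shows "contains_C3 (C \<union> I) E"
proof -
  define f where "f v = (case v of Cv i \<Rightarrow> cc (e (int i)) | Av i \<Rightarrow> y (int i) | Bv i \<Rightarrow> b | _ \<Rightarrow> undefined)" for v
  have "has_induced_copy (C \<union> I) E (sg_V (F2_C k) (F2_I k)) (sg_E (F2_C k) (F2_I k) (F2_N k))"
  proof (rule induced_copyI[of f])
    show "f ` F2_C k \<subseteq> C" using cc_range by (auto simp: F2_C_def f_def)
    show "f ` F2_I k \<subseteq> I" using y b by (auto simp: F2_I_def f_def)
    show "F2_C k \<inter> F2_I k = {}" by (auto simp: F2_C_def F2_I_def)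
    have N: "Cv j \<in> F2_N k (Av i) \<longleftrightarrow> j = i \<or> j = Suc i" if "i \<in> {1..k-1}" "j \<in> {1..k}" for i j
      using that k by (auto simp: F2_N_def)
    have NB: "Cv j \<in> F2_N k (Bv 1) \<longleftrightarrow> j \<in> {2..k-1}" for j
      by (auto simp: F2_N_def)
    have memI: "Bv 1 \<in> F2_I k" "\<And>i. i \<in> {1..k-1} \<Longrightarrow> Av i \<in> F2_I k" by (auto simp: F2_I_def)
    have memC: "Cv j \<in> F2_C k" if "j \<in> {1..k}" for j using that by (auto simp: F2_C_def)
    have casesI: "a = Bv 1 \<or> (\<exists>i\<in>{1..k-1}. a = Av i)" if "a \<in> F2_I k" for a
      using that by (auto simp: F2_I_def)
    show "E (f a) (f c) \<longleftrightarrow> c \<in> F2_N k a" if a: "a \<in> F2_I k" and c: "c \<in> F2_C k" for a c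
    proof -
      obtain j where j: "c = Cv j" "j \<in> {1..k}" using c by (auto simp: F2_C_def)
      from casesI[OF a] show ?thesis
      proof (elim disjE bexE)
        assume "a = Bv 1"
        then show ?thesis using j NB[of j] adj1[of j] by (simp add: f_def)
      next
        fix i assume i: "i \<in> {1..k-1}" "a = Av i"
        then show ?thesis using j N[OF i(1) j(2)] adj[of i j] by (simp add: f_def)
      qed
    qed
    have sepC: "\<exists>a\<in>F2_I k. (Cv i \<in> F2_N k a) \<noteq> (Cv j \<in> F2_N k a)"
      if ij: "i \<in> {1..k}" "j \<in> {1..k}" "i < j" for i j
    proof (cases "j = Suc i")
      case False
      then show ?thesis
        using ij N[of i i] N[of i j] by (intro bexI[of _ "Av i"] memI) auto
    next
      case True
      show ?thesis
      proof (cases "j \<le> k - 1")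
        case True
        then show ?thesis
          using ij N[of j i] N[of j j] by (intro bexI[of _ "Av j"] memI) auto
      next
        case False
        then show ?thesis
          using ij NB[of i] NB[of j] \<open>j = Suc i\<close> k by (intro bexI[of _ "Bv 1"] memI) auto
      qed
    qed
    show "\<exists>a\<in>F2_I k. (c \<in> F2_N k a) \<noteq> (c' \<in> F2_N k a)" if "c \<in> F2_C k" "c' \<in> F2_C k" "c \<noteq> c'" for c c'
      by (rule image_pairs[where f = Cv and Q = "\<lambda>c c'. \<exists>a\<in>F2_I k. (c \<in> F2_N k a) \<noteq> (c' \<in> F2_N k a)", OF sepC _ that[unfolded F2_C_def]]) auto
    have sepA: "\<exists>c\<in>F2_C k. (c \<in> F2_N k (Av i)) \<noteq> (c \<in> F2_N k (Av j))"
      if "i \<in> {1..k-1}" "j \<in> {1..k-1}" "i < j" for i j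
      using that N[of i i] N[of j i] by (intro bexI[of _ "Cv i"] memC) auto
    have sepB: "\<exists>c\<in>F2_C k. (c \<in> F2_N k (Bv 1)) \<noteq> (c \<in> F2_N k (Av i))" if "i \<in> {1..k-1}" for i
    proof (cases "i \<le> 2")
      case True
      then show ?thesis using k that NB[of 4] N[of i 4] by (intro bexI[of _ "Cv 4"] memC) auto
    next
      case False
      then show ?thesis using k that NB[of 2] N[of i 2] by (intro bexI[of _ "Cv 2"] memC) auto
    qed
    have sepAA: "\<exists>c\<in>F2_C k. (c \<in> F2_N k (Av i)) \<noteq> (c \<in> F2_N k (Av j))"
      if "i \<in> {1..k-1}" "j \<in> {1..k-1}" "i \<noteq> j" for i j
      using that sepA[of i j] sepA[of j i] by (cases i j rule: linorder_cases) blast+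
    show "\<exists>c\<in>F2_C k. (c \<in> F2_N k a) \<noteq> (c \<in> F2_N k a')" if a: "a \<in> F2_I k" "a' \<in> F2_I k" "a \<noteq> a'" for a a'
      using casesI[OF a(1)] casesI[OF a(2)] a(3)
      by (elim disjE bexE) (use sepAA sepB in blast)+
  qed
  with k show ?thesis unfolding contains_C3_def by blast
qed

end

section \<open>Shortest odd cycles of arcs\<close>

context odd_cycle
begin

abbreviation L :: "int \<Rightarrow> int" where "L i \<equiv> len (x i)"

definition V :: "int \<Rightarrow> int" where "V i = U i + L i"

text \<open>An arbitrary lift \<open>v\<close> is allowed so that the negation excludes containment
  in every lift. The proof of \<open>nested_all\<close> shows that only \<open>v = U (j + k)\<close>
  can occur.\<close>

definition nested_at :: "int \<Rightarrow> bool" where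
  "nested_at j \<longleftrightarrow> (\<exists>k v. 2 \<le> k \<and> k \<le> n - 2 \<and> m dvd v - s (x (j + k)) \<and> U j \<le> v \<and> v + L (j + k) \<le> V j)"

lemma L: "0 \<le> L i" "L i < m"
  using len[OF xI] by simp_all

lemma nonadj_lifts:
  assumes "i + 2 \<le> j" "j \<le> i + n - 2" "m dvd u - s (x i)" "m dvd v - s (x j)"
  shows "\<not> overlap u (L i) v (L j)"
proof -
  have "m dvd v + (U i - u) - s (x j)"
    using dvd_add[OF assms(4) same_lift[OF U_lift[of i] assms(3)]] by (simp add: algebra_simps)
  from nonadj[OF assms(1,2) this] show ?thesis
    unfolding overlap_def by linarith
qed

lemma consec_cases:
  "U i < U (i + 1) \<and> U (i + 1) < V i \<and> V i < V (i + 1) \<or> U (i + 1) < U i \<and> U i < V (i + 1) \<and> V (i + 1) < V i"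
  using consec[of i] by (auto simp: overlap_def V_def)

lemma lift_shift: "m dvd \<delta> \<Longrightarrow> m dvd U i + \<delta> - s (x i)"
  using dvd_add[OF U_lift[of i], of \<delta>] by (simp add: algebra_simps)

lemma shift_consec: "overlap (U i + \<delta>) (L i) (U (i + 1) + \<delta>) (L (i + 1))"
  using consec[of i] by (simp add: overlap_shift)

text \<open>Overlaps being forbidden outside consecutive arcs, containment of one arc propagates
  along the whole walk up to the two neighbours of the containing arc.\<close>
lemma nested_all:
  assumes "nested_at j"
  shows "\<And>l. 2 \<le> l \<Longrightarrow> l \<le> n - 2 \<Longrightarrow> U j \<le> U (j + l) \<and> V (j + l) \<le> V j" "D = 0"
proof -
  obtain k v where k: "2 \<le> k" "k \<le> n - 2" and v: "m dvd v - s (x (j + k))" "U j \<le> v" "v + L (j + k) \<le> V j"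
    using assms by (auto simp: nested_at_def)
  define \<delta> where "\<delta> = v - U (j + k)"
  have d: "m dvd \<delta>" unfolding \<delta>_def by (rule same_lift[OF v(1) U_lift])
  define P where "P l \<longleftrightarrow> U j \<le> U (j + l) + \<delta> \<and> U (j + l) + \<delta> + L (j + l) \<le> U j + L j" for l
  have no: "\<not> overlap (U j) (L j) (U (j + l) + \<delta>) (L (j + l))" if "2 \<le> l" "l \<le> n - 2" for l
    by (rule nonadj) (use that lift_shift[OF d] in auto)
  have step: "overlap (U (j + l) + \<delta>) (L (j + l)) (U (j + (l + 1)) + \<delta>) (L (j + (l + 1)))" for l
    using shift_consec[of "j + l" \<delta>] by (simp add: add.assoc)
  have up: "P (l + 1)" if "P l" "2 \<le> l" "l + 1 \<le> n - 2" for l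
    unfolding P_def by (rule contained_step[OF _ _ step no]) (use that in \<open>auto simp: P_def\<close>)
  have down: "P l" if "P (l + 1)" "2 \<le> l" "l + 1 \<le> n - 2" for l
    unfolding P_def
    by (rule contained_step[OF _ _ overlap_commute[THEN iffD1, OF step] no])
      (use that in \<open>auto simp: P_def\<close>)
  have Pk: "P k" using v k by (simp add: P_def \<delta>_def V_def)
  have P: "P l" if "2 \<le> l" "l \<le> n - 2" for l
  proof (cases "k \<le> l")
    case True
    then show ?thesis using that(2)
    proof (induction l rule: int_ge_induct)
      case base
      then show ?case using Pk by simp
    next
      case (step l)
      then show ?case using up[of l] k by simp
    qed
  next
    case False
    then have "l \<le> k" by simp
    then show ?thesis using that(1)
    proof (induction l rule: int_le_induct)
      case base
      then show ?case using Pk by simp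
    next
      case (step l)
      then show ?case using down[of "l - 1"] k by simp
    qed
  qed
  have n4: "4 \<le> n" using k by simp
  \<comment> \<open>The shifted arc \<open>j + 1\<close> overlaps the shifted arc
    \<open>j + 2\<close>, which lies inside arc \<open>j\<close>. So it meets arc \<open>j\<close>,
    and the only lift that may do so is \<open>U (j + 1)\<close> itself.\<close>
  have "\<delta> = 0"
  proof (rule ccontr)
    assume "\<delta> \<noteq> 0"
    then have "U j + L j \<le> U (j + 1) + \<delta> \<or> U (j + 1) + \<delta> + L (j + 1) \<le> U j"
      using other_lift_disjoint[OF xI xI U_lift U_lift lift_shift[OF d] consec[of j]] by simp
    moreover have "overlap (U (j + 1) + \<delta>) (L (j + 1)) (U (j + 2) + \<delta>) (L (j + 2))"
      using shift_consec[of "j + 1" \<delta>] by (simp add: add.assoc)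
    ultimately show False using P[of 2] n4 unfolding P_def overlap_def by linarith
  qed
  then show 1: "U j \<le> U (j + l) \<and> V (j + l) \<le> V j" if "2 \<le> l" "l \<le> n - 2" for l
    using P[OF that] by (simp add: P_def V_def)
  \<comment> \<open>The same argument at the predecessor of \<open>j\<close>, reached after almost a
    full period: its lift meets the contained arc \<open>j + n - 2\<close>, so it is the lift that
    overlaps arc \<open>j\<close>.\<close>
  show "D = 0"
  proof (rule ccontr)
    assume D: "D \<noteq> 0"
    let ?i = "j + n - 1"
    have xj: "x (?i + 1) = x j" "U (?i + 1) = U j + D" using x_per[of j] U_per[of j] by simp_all
    have "overlap (U j) (L j) (U ?i - D) (L ?i)"
      using consec[of ?i] unfolding xj overlap_def by linarith
    moreover have "m dvd U ?i - D - s (x ?i)" using lift_shift[of "- D" ?i] D_dvd by simp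
    ultimately have "U j + L j \<le> U ?i \<or> U ?i + L ?i \<le> U j"
      using other_lift_disjoint[OF xI xI U_lift _ U_lift] D by auto
    moreover have "overlap (U (j + (n - 2))) (L (j + (n - 2))) (U ?i) (L ?i)"
      using consec[of "j + (n - 2)"] by (simp add: algebra_simps)
    ultimately show False using 1[of "n - 2"] n4 unfolding V_def overlap_def by linarith
  qed
qed

lemma disjoint_lifts:
  assumes ij: "i + 2 \<le> j" "j \<le> i + n - 2" and nn: "\<not> nested_at i" "\<not> nested_at j"
    and u: "m dvd u - s (x i)" and v: "m dvd v - s (x j)"
  shows "u + L i \<le> v \<or> v + L j \<le> u"
proof (rule ccontr)
  assume "\<not> ?thesis"
  then consider "u \<le> v" "v + L j \<le> u + L i" | "v \<le> u" "u + L i \<le> v + L j"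
    using nonadj_lifts[OF ij u v] unfolding overlap_def by linarith
  then show False
  proof cases
    case 1
    have "m dvd v + (U i - u) - s (x (i + (j - i)))"
      using dvd_add[OF v same_lift[OF U_lift[of i] u]] by (simp add: algebra_simps)
    then have "nested_at i"
      unfolding nested_at_def using 1 ij
      by (intro exI[of _ "j - i"] exI[of _ "v + (U i - u)"]) (simp add: V_def)
    then show False using nn by simp
  next
    case 2
    have xi: "x (j + (n - (j - i))) = x i" using x_per[of i] by (simp add: add.commute)
    have "m dvd u + (U j - v) - s (x i)"
      using dvd_add[OF u same_lift[OF U_lift[of j] v]] by (simp add: algebra_simps)
    then have "nested_at j"
      unfolding nested_at_def using 2 ij xi
      by (intro exI[of _ "n - (j - i)"] exI[of _ "u + (U j - v)"]) (simp add: V_def)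
    then show False using nn by simp
  qed
qed

text \<open>The arcs \<open>i\<close> and \<open>i + 2\<close> are disjoint and both overlap
  \<open>i + 1\<close>, so they sit at opposite ends of it and the walk keeps its direction.\<close>

lemma direction_step:
  assumes "4 \<le> n" "\<not> nested_at i" "\<not> nested_at (i + 2)"
  shows "U i < U (i + 1) \<longleftrightarrow> U (i + 1) < U (i + 2)"
  using consec_cases[of i] consec_cases[of "i + 1"] disjoint_lifts[of i "i + 2", OF _ _ assms(2,3) U_lift U_lift] assms(1)
  unfolding V_def by (simp add: add.assoc; linarith)

lemma rotate: "odd_cycle C I E m cc s len n (\<lambda>i. x (i + k)) (\<lambda>i. U (i + k)) D"
proof
  show "x (i + n + k) = x (i + k)" "U (i + n + k) = U (i + k) + D" for i
    using x_per[of "i + k"] U_per[of "i + k"] by (simp_all add: algebra_simps)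
  show "overlap (U (i + k)) (L (i + k)) (U (i + 1 + k)) (L (i + 1 + k))" for i
    using consec[of "i + k"] by (simp add: algebra_simps)
  show "\<not> overlap (U (i + k)) (L (i + k)) v (L (j + k))"
    if "i + 2 \<le> j" "j \<le> i + n - 2" "m dvd v - s (x (j + k))" for i j v
    using nonadj[of "i + k" "j + k" v] that by simp
qed (use n D_dvd D_odd xI U_lift in auto)

text \<open>Reduces left-moving walks to right-moving ones. Oddness survives because signs of
  multiples of \<open>m\<close> do not matter modulo \<open>2 * m\<close>.\<close>

lemma reverse: "odd_cycle C I E m cc s len n (\<lambda>i. x (k - i)) (\<lambda>i. U (k - i)) (- D)"
proof
  show "x (k - (i + n)) = x (k - i)" "U (k - (i + n)) = U (k - i) + - D" for i
    using x_per[of "k - (i + n)"] U_per[of "k - (i + n)"] by simp_all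
  show "overlap (U (k - i)) (L (k - i)) (U (k - (i + 1))) (L (k - (i + 1)))" for i
    using consec[of "k - i - 1"] by (simp add: overlap_commute algebra_simps)
  show "\<not> overlap (U (k - i)) (L (k - i)) v (L (k - j))"
    if "i + 2 \<le> j" "j \<le> i + n - 2" "m dvd v - s (x (k - j))" for i j v
    using nonadj_lifts[of "k - j" "k - i", OF _ _ that(3) U_lift] that(1,2) by (simp add: overlap_commute)
  show "\<not> 2 * m dvd - D + n * m"
  proof
    assume "2 * m dvd - D + n * m"
    then have "2 * m dvd (2 * m) * n - (- D + n * m)" by (intro dvd_diff) simp_all
    then show False using D_odd by (simp add: algebra_simps)
  qed
qed (use n D_dvd xI U_lift in auto)

text \<open>Steps are shorter than \<open>m\<close>, so two turns in three steps require all of them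
  to go right. One-sidedness then gives \<open>V 1 \<le> U 0 + m\<close> and
  \<open>V 3 \<le> U 2 + m\<close>; the latter yields \<open>U 0 + m \<le> U 2\<close>, which
  contradicts \<open>U 2 < V 1\<close>.\<close>

lemma triangle_shift_less:
  assumes "n = 3"
  shows "D \<noteq> 2 * m"
proof
  assume D: "D = 2 * m"
  have U3: "U 3 = U 0 + 2 * m" "V 3 = V 0 + 2 * m" "x 3 = x 0"
    using U_per[of 0] x_per[of 0] assms D by (simp_all add: V_def)
  have steps: "U 0 < U 1" "U 1 < U 2" "U 2 < U 3" "U 1 < V 0" "U 2 < V 1" "U 3 < V 2"
    using consec_cases[of 0] consec_cases[of 1] consec_cases[of 2] U3(1) L(2)[of 0] L(2)[of 1] L(2)[of 2]
    unfolding V_def by simp_all linarith+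
  have o1: "overlap (U 1) (L 1) (U 0) (L 0)" and o2: "overlap (U 3) (L 3) (U 2) (L 2)"
    using consec[of 0] consec[of 2] by (simp_all add: overlap_commute)
  have "V 1 \<le> U 0 + m"
    using other_lift_disjoint[OF xI xI U_lift U_lift lift_shift[of m 0] o1] m_pos steps L[of 0]
    unfolding V_def by simp
  moreover have "V 3 \<le> U 2 + m"
    using other_lift_disjoint[OF xI xI U_lift U_lift lift_shift[of m 2] o2] m_pos steps L[of 2]
    unfolding V_def by simp
  ultimately show False using U3 steps L(1)[of 0] unfolding V_def by simp
qed

text \<open>Three steps shorter than \<open>m\<close> give fewer than three turns, oddness with
  \<open>n = 3\<close> makes the number of turns even, and two turns are excluded in both
  directions.\<close>

lemma triangle_closed:
  assumes "n = 3"
  shows "D = 0"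
proof -
  have "odd_cycle C I E m cc s len n (\<lambda>i. x (0 - i)) (\<lambda>i. U (0 - i)) (- D)" by (rule reverse)
  then have ne: "D \<noteq> 2 * m" "- D \<noteq> 2 * m"
    using triangle_shift_less[OF assms] odd_cycle.triangle_shift_less[OF _ assms] by blast+
  have "U 3 = U 0 + D" using U_per[of 0] assms by simp
  then have bound: "\<bar>D\<bar> < 3 * m"
    using consec_cases[of 0] consec_cases[of 1] consec_cases[of 2] L(2)[of 0] L(2)[of 1] L(2)[of 2] L(2)[of 3]
    unfolding V_def by (simp; linarith)
  obtain d where d: "D = m * d" using D_dvd by (elim dvdE)
  have "\<bar>d\<bar> < 3"
  proof (rule ccontr)
    assume "\<not> \<bar>d\<bar> < 3"
    then have "m * \<bar>d\<bar> \<ge> m * 3" using m_pos by (intro mult_left_mono) auto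
    then show False using bound d m_pos by (simp add: abs_mult)
  qed
  moreover have "even d"
  proof (rule ccontr)
    assume "odd d"
    then obtain b where "d + 3 = 2 * b" by (metis dvdE even_add odd_numeral)
    then have "D + n * m = 2 * m * b" using assms d by (metis distrib_left mult.assoc mult.commute)
    then show False using D_odd by simp
  qed
  moreover have "d \<noteq> 2" "d \<noteq> - 2" using ne d by auto
  ultimately have "d = 0" by presburger
  then show ?thesis using d by simp
qed

lemma triangle_contains:
  assumes "n = 3"
  shows "contains_C3 (C \<union> I) E"
proof -
  have D: "D = 0" by (rule triangle_closed[OF assms])
  have U3: "U 3 = U 0" "V 3 = V 0" using U_per[of 0] x_per[of 0] assms D by (simp_all add: V_def)
  have F0: "contains_C3 (C \<union> I) E"
    if "U a < U b" "U b < U c" "U c < V a" "V a < V b" "V b < V c" for a b c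
    by (rule contains_F0[of "\<lambda>i. if i = 1 then x a else if i = 2 then x b else x c"
          "\<lambda>i. if i = 1 then U a else if i = 2 then U b else U c"])
      (use that xI U_lift in \<open>auto simp: V_def\<close>)
  have c0: "U 0 < U 1 \<and> U 1 < V 0 \<and> V 0 < V 1 \<or> U 1 < U 0 \<and> U 0 < V 1 \<and> V 1 < V 0"
    and c1: "U 1 < U 2 \<and> U 2 < V 1 \<and> V 1 < V 2 \<or> U 2 < U 1 \<and> U 1 < V 2 \<and> V 2 < V 1"
    and c2: "U 2 < U 0 \<and> U 0 < V 2 \<and> V 2 < V 0 \<or> U 0 < U 2 \<and> U 2 < V 0 \<and> V 0 < V 2"
    using consec_cases[of 0] consec_cases[of 1] consec_cases[of 2] U3 by simp_all
  consider "U 0 < U 1" "U 1 < U 2" | "U 0 < U 2" "U 2 < U 1" | "U 1 < U 0" "U 0 < U 2"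
    | "U 1 < U 2" "U 2 < U 0" | "U 2 < U 0" "U 0 < U 1" | "U 2 < U 1" "U 1 < U 0"
    using c0 c1 c2 by linarith
  then show ?thesis
  proof cases
    case 1
    with c0 c1 c2 show ?thesis by (intro F0[of 0 1 2]) linarith+
  next
    case 2
    with c0 c1 c2 show ?thesis by (intro F0[of 0 2 1]) linarith+
  next
    case 3
    with c0 c1 c2 show ?thesis by (intro F0[of 1 0 2]) linarith+
  next
    case 4
    with c0 c1 c2 show ?thesis by (intro F0[of 1 2 0]) linarith+
  next
    case 5
    with c0 c1 c2 show ?thesis by (intro F0[of 2 0 1]) linarith+
  next
    case 6
    with c0 c1 c2 show ?thesis by (intro F0[of 2 1 0]) linarith+
  qed
qed

end

section \<open>Longer cycles: one turn without containment, one containing arc, two containing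
  arcs\<close>

context odd_cycle
begin

lemma even_n:
  assumes "D = m"
  shows "even n"
proof (rule ccontr)
  assume "odd n"
  then obtain b where "n = 2 * b + 1" by (elim oddE)
  then have "D + n * m = 2 * m * (b + 1)" using assms by (simp add: algebra_simps)
  then show False using D_odd by simp
qed

lemma odd_n:
  assumes "D = 0"
  shows "odd n"
proof
  assume "even n"
  then obtain b where "n = 2 * b" by (elim evenE)
  then have "D + n * m = 2 * m * b" using assms by (simp add: algebra_simps)
  then show False using D_odd by simp
qed

lemma adj_end: "E (x i) (cc (V j)) \<Longrightarrow> \<exists>u. m dvd u - s (x i) \<and> u < V j \<and> V j \<le> u + L i"
  using adj[OF xI] by simp

text \<open>With two or more turns, some arc \<open>j\<close> of the walk would contain the gap
  \<open>U 0 + m\<close> or begin there, and so meet the next lift of arc \<open>0\<close>. Arcs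
  \<open>0\<close>, \<open>1\<close> and \<open>n - 1\<close> cannot be this \<open>j\<close>, and
  every other unnested arc is disjoint from all lifts of arc \<open>0\<close>.\<close>

lemma right_turning_once:
  assumes n4: "4 \<le> n" and nn: "\<And>i. \<not> nested_at i" and right: "\<And>i. U i < U (i + 1)"
  shows "D = m"
proof -
  have st: "U i < U (i + 1) \<and> U (i + 1) < V i \<and> V i < V (i + 1)" for i
    using consec_cases[of i] right[of i] by linarith
  have mono: "U i < U j" if "i < j" for i j
    by (rule int_chain_less[of i j U]) (use right that in auto)
  have "U n = U 0 + D" using U_per[of 0] by simp
  then have "0 < D" using mono[of 0 n] n4 by simp
  then have Dm: "m \<le> D" using zdvd_imp_le[OF D_dvd] by simp
  show "D = m"
  proof (rule ccontr)
    assume "D \<noteq> m"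
    then have D2: "D \<ge> 2 * m"
      using lift_dist[of m D] Dm D_dvd by (simp add: dvd_diff)
    have "U 0 \<le> U 0 + m" "\<not> U n \<le> U 0 + m" "(0::int) < n"
      using m_pos \<open>U n = U 0 + D\<close> D2 n4 by auto
    then obtain j where j: "0 \<le> j" "j < n" "U j \<le> U 0 + m" "\<not> U (j + 1) \<le> U 0 + m"
      by (rule switch_up[of "\<lambda>i. U i \<le> U 0 + m" 0 n]) auto
    have "j \<noteq> 0" using j(4) st[of 0] L(2)[of 0] by (auto simp: V_def)
    moreover have "j \<noteq> 1"
    proof
      assume j1: "j = 1"
      have "overlap (U 1) (L 1) (U 0) (L 0)" using consec[of 0] by (simp add: overlap_commute)
      then have "V 1 \<le> U 0 + m"
        using other_lift_disjoint[OF xI xI U_lift U_lift lift_shift[of m 0]] m_pos st[of 0] L[of 0]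
        unfolding V_def by fastforce
      then show False using j(4) j1 st[of 1] by simp
    qed
    moreover have "j \<noteq> n - 1"
      using st[of "n - 1"] L(2)[of "n - 1"] j(3) \<open>U n = U 0 + D\<close> D2 unfolding V_def by auto
    ultimately have "0 + 2 \<le> j" "j \<le> 0 + n - 2" using j by simp_all
    from disjoint_lifts[OF this nn nn lift_shift[of m 0] U_lift]
    have "U 0 + m + L 0 \<le> U j \<or> U j + L j \<le> U 0 + m" by simp
    then show False using j st[of j] st[of 0] unfolding V_def by linarith
  qed
qed

lemma right_contains_sun:
  assumes n4: "4 \<le> n" and nn: "\<And>i. \<not> nested_at i" and right: "\<And>i. U i < U (i + 1)"
  shows "contains_C3 (C \<union> I) E"
proof -
  have st: "U i < U (i + 1) \<and> U (i + 1) < V i \<and> V i < V (i + 1)" for i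
    using consec_cases[of i] right[of i] by linarith
  have D: "D = m" by (rule right_turning_once[OF assms])
  \<comment> \<open>\<open>V j\<close> lies in the arcs \<open>j\<close> and \<open>j + 1\<close>.
    An arc that is not consecutive to one of these two, called \<open>k\<close>, is disjoint from it
    in every lift and thus cannot contain \<open>V j\<close>.\<close>
  have far: "\<not> E (x i) (cc (V j))" if h: "i + 2 \<le> k \<and> k \<le> i + n - 2 \<or> k + 2 \<le> i \<and> i \<le> k + n - 2"
    and k: "k = j \<or> k = j + 1" for i j k
  proof
    assume "E (x i) (cc (V j))"
    then obtain u where u: "m dvd u - s (x i)" "u < V j" "V j \<le> u + L i" using adj_end by blast
    have k': "U k < V j" "V j \<le> U k + L k" using k st[of j] by (auto simp: V_def)
    from h have "u + L i \<le> U k \<or> U k + L k \<le> u"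
      using disjoint_lifts[OF _ _ nn nn u(1) U_lift, of k] disjoint_lifts[OF _ _ nn nn U_lift u(1), of k] by blast
    then show False using u k' by linarith
  qed
  have ends: "E (x i) (cc (V i))" "E (x (i + 1)) (cc (V i))" for i
    using adj_window[OF xI U_lift, of i "V i"] adj_window[OF xI U_lift, of "i + 1" "V i"] st[of i] L(1,2)[of i] L(2)[of "i + 1"]
    by (simp_all add: V_def)
  have last: "E (x n) (cc (V 0))"
    using ends(1)[of 0] x_per[of 0] by simp
  have adj': "E (x i) (cc (V (j - 1))) \<longleftrightarrow> j = i \<or> j = i + 1 \<or> i = n \<and> j = 1"
    if ij: "1 \<le> i" "i \<le> n" "1 \<le> j" "j \<le> n" for i j
  proof
    assume "j = i \<or> j = i + 1 \<or> i = n \<and> j = 1"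
    then show "E (x i) (cc (V (j - 1)))" using ends(1)[of i] ends(2)[of "i - 1"] last by auto
  next
    assume E: "E (x i) (cc (V (j - 1)))"
    show "j = i \<or> j = i + 1 \<or> i = n \<and> j = 1"
    proof (rule ccontr)
      assume ne: "\<not> ?thesis"
      consider "i + 2 \<le> j - 1" | "j - 1 = i + 1" | "j + 1 \<le> i" "i \<le> j + n - 3" | "j + 1 \<le> i" "i = j + n - 2"
        using ne ij by linarith
      then show False
        by cases (use far[of i "j - 1" "j - 1"] far[of i j "j - 1"] E ij n4 in auto)
    qed
  qed
  show ?thesis
  proof (rule contains_sun[of "nat n" x "\<lambda>j. V (j - 1)"])
    show "even (nat n)" using even_n[OF D] n4 by (simp add: even_nat_iff)
    show "4 \<le> nat n" using n4 by simp
    show "x i \<in> I" for i by (rule xI)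
    show "E (x (int i)) (cc (V (int j - 1))) \<longleftrightarrow> j = i \<or> j = Suc i \<or> i = nat n \<and> j = 1"
      if "1 \<le> i" "i \<le> nat n" "1 \<le> j" "j \<le> nat n" for i j
      using adj'[of "int i" "int j"] that n4 by auto
  qed
qed

lemma unnested_contains:
  assumes n4: "4 \<le> n" and nn: "\<And>i. \<not> nested_at i"
  shows "contains_C3 (C \<union> I) E"
proof -
  have step: "U i < U (i + 1) \<longleftrightarrow> U (i + 1) < U (i + 1 + 1)" for i
    using direction_step[OF n4 nn nn, of i] by (simp add: add.assoc)
  have const: "U i < U (i + 1) \<longleftrightarrow> U 0 < U 1" for i
  proof (induction i rule: int_induct[where k = 0])
    case base
    then show ?case by simp
  next
    case (step1 i)
    then show ?case using step[of i] by simp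
  next
    case (step2 i)
    then show ?case using step[of "i - 1"] by simp
  qed
  show ?thesis
  proof (cases "U 0 < U 1")
    case True
    then show ?thesis using right_contains_sun[OF n4 nn] const by blast
  next
    case False
    interpret R: odd_cycle C I E m cc s len n "\<lambda>i. x (0 - i)" "\<lambda>i. U (0 - i)" "- D" by (rule reverse)
    have VR: "R.V i = V (0 - i)" for i unfolding R.V_def V_def ..
    have "\<not> R.nested_at i" for i
    proof
      assume "R.nested_at i"
      then obtain k v where k: "2 \<le> k" "k \<le> n - 2" "m dvd v - s (x (0 - (i + k)))" "U (0 - i) \<le> v"
        "v + L (0 - (i + k)) \<le> V (0 - i)"
        unfolding R.nested_at_def VR by blast
      have "x (- i + (n - k)) = x (0 - (i + k))" using x_per[of "0 - (i + k)"] by (simp add: algebra_simps)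
      then have "nested_at (- i)"
        unfolding nested_at_def using k by (intro exI[of _ "n - k"] exI[of _ v]) simp
      then show False using nn by blast
    qed
    moreover have "U (0 - i) < U (0 - (i + 1))" for i
      using const[of "- i - 1"] False consec_cases[of "- i - 1"] by simp
    ultimately show ?thesis using R.right_contains_sun[OF n4] by blast
  qed
qed

lemma right_contains_F2:
  assumes n5: "5 \<le> n" and D: "D = 0" and inside: "\<And>l. 2 \<le> l \<Longrightarrow> l \<le> n - 2 \<Longrightarrow> U 0 \<le> U l \<and> V l \<le> V 0"
    and nn: "\<And>i. 1 \<le> i \<Longrightarrow> i \<le> n - 1 \<Longrightarrow> \<not> nested_at i"
    and right: "\<And>i. 1 \<le> i \<Longrightarrow> i \<le> n - 2 \<Longrightarrow> U i < U (i + 1)"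
  shows "contains_C3 (C \<union> I) E"
proof -
  have per: "U n = U 0" "x n = x 0" "V n = V 0" using U_per[of 0] x_per[of 0] D by (simp_all add: V_def)
  have st: "U i < U (i + 1) \<and> U (i + 1) < V i \<and> V i < V (i + 1)" if "1 \<le> i" "i \<le> n - 2" for i
    using consec_cases[of i] right[OF that] by linarith
  have U_mono: "U i < U j" if "1 \<le> i" "i < j" "j \<le> n - 1" for i j
    by (rule int_chain_less[of 1 "n - 1" U]) (use st that in auto)
  have V_mono: "V i < V j" if "1 \<le> i" "i < j" "j \<le> n - 1" for i j
    by (rule int_chain_less[of 1 "n - 1" V]) (use st that in auto)
  have gap: "V i \<le> U (i + 2)" if "1 \<le> i" "i + 2 \<le> n - 1" for i
  proof -
    have "U i + L i \<le> U (i + 2) \<or> U (i + 2) + L (i + 2) \<le> U i"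
      by (rule disjoint_lifts) (use that n5 nn U_lift in auto)
    then show ?thesis using st[of i] st[of "i + 1"] that U_mono[of i "i + 2"] V_mono[of i "i + 2"] L(1)[of "i + 2"]
      unfolding V_def by auto
  qed
  have first: "U 1 < U 0" "U 0 < V 1" "V 1 < V 0"
    using consec_cases[of 0] st[of 1] inside[of 2] n5 by auto
  have last: "U 0 < U (n - 1)" "U (n - 1) < V 0" "V 0 < V (n - 1)"
    using consec_cases[of "n - 1"] st[of "n - 2"] inside[of "n - 2"] n5 per by auto
  have "U 1 + m + L 1 \<le> U (n - 1) \<or> U (n - 1) + L (n - 1) \<le> U 1 + m"
    by (rule disjoint_lifts) (use n5 nn U_lift lift_shift[of m 1] in auto)
  then have win: "V (n - 1) \<le> U 1 + m"
    using last first L(2)[of 0] unfolding V_def by linarith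
  \<comment> \<open>\<open>U 0\<close> is the vertex just before the containing arc
    \<open>0\<close>; of the path only arc \<open>1\<close> reaches back to it. The other vertices
    are right ends, of which arc \<open>0\<close> misses just the last. By \<open>win\<close> all
    this fits into one period.\<close>
  define e where "e j = (if j = 1 then U 0 else V (j - 1))" for j
  have e_win: "U 1 < e j" "e j \<le> U 1 + m" if "1 \<le> j" "j \<le> n" for j
  proof -
    have "V 1 \<le> V (j - 1)" "V (j - 1) \<le> V (n - 1)" if "j \<noteq> 1"
      using V_mono[of 1 "j - 1"] V_mono[of "j - 1" "n - 1"] \<open>1 \<le> j\<close> \<open>j \<le> n\<close> that n5
      by (cases "j = 2"; cases "j = n"; auto)+
    then show "U 1 < e j" "e j \<le> U 1 + m" using first last win by (auto simp: e_def)
  qed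
  have adj_i: "E (x i) (cc (e j)) \<longleftrightarrow> U i < e j \<and> e j \<le> V i"
    if "0 \<le> i" "i \<le> n - 1" "1 \<le> j" "j \<le> n" for i j
  proof -
    have "U 1 \<le> U i \<and> V i \<le> V (n - 1)"
    proof (cases "i = 0")
      case True
      then show ?thesis using first last by simp
    next
      case False
      then show ?thesis using U_mono[of 1 i] V_mono[of i "n - 1"] that n5 by (cases "i = 1"; cases "i = n - 1"; auto)
    qed
    then show ?thesis
      using adj_in_window[OF xI U_lift, of "U 1" i "e j"] e_win[OF that(3,4)] win unfolding V_def by simp
  qed
  have path: "E (x i) (cc (e j)) \<longleftrightarrow> j = i \<or> j = i + 1" if ij: "1 \<le> i" "i \<le> n - 1" "1 \<le> j" "j \<le> n" for i j
  proof -
    have a: "E (x i) (cc (e j)) \<longleftrightarrow> U i < e j \<and> e j \<le> V i" using adj_i ij by simp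
    show ?thesis
    proof (cases "j = 1")
      case True
      have "U 0 \<le> U i" if "i \<noteq> 1"
        using that ij inside[of i] last by (cases "i = n - 1") auto
      then show ?thesis using a first True ij by (cases "i = 1") (auto simp: e_def)
    next
      case False
      then have ej: "e j = V (j - 1)" by (simp add: e_def)
      consider "j = i + 1" | "j = i" | "j + 1 \<le> i" | "i + 2 \<le> j" by linarith
      then show ?thesis
      proof cases
        case 1
        have "U i < V i"
          using st[of i] st[of "i - 1"] ij n5 by (cases "i = n - 1") auto
        then show ?thesis using a ej 1 by simp
      next
        case 2
        then show ?thesis using a ej st[of "j - 1"] ij False by simp
      next
        case 3
        have "V (j - 1) \<le> U (j + 1)" using gap[of "j - 1"] ij 3 False by (simp add: add.commute)
        also have "\<dots> \<le> U i" using U_mono[of "j + 1" i] 3 ij by (cases "i = j + 1") auto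
        finally show ?thesis using a ej 3 by simp
      next
        case 4
        then show ?thesis using a ej V_mono[of i "j - 1"] ij by simp
      qed
    qed
  qed
  have big: "E (x 0) (cc (e j)) \<longleftrightarrow> 2 \<le> j \<and> j \<le> n - 1" if j: "1 \<le> j" "j \<le> n" for j
  proof -
    have a: "E (x 0) (cc (e j)) \<longleftrightarrow> U 0 < e j \<and> e j \<le> V 0" using adj_i j n5 by simp
    consider "j = 1" | "j = n" | "j = 2" | "3 \<le> j" "j \<le> n - 1" using j by linarith
    then show ?thesis
    proof cases
      case 4
      then show ?thesis
        using a inside[of "j - 1"] st[of "j - 1"] by (simp add: e_def)
    qed (use a first last n5 in \<open>auto simp: e_def\<close>)
  qed
  show ?thesis
  proof (rule contains_F2[of "nat n" x "x 0" e])
    show "odd (nat n)" using odd_n[OF D] n5 by (simp add: even_nat_iff)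
    show "5 \<le> nat n" using n5 by simp
    show "x i \<in> I" "x 0 \<in> I" for i by (rule xI)+
    show "E (x (int i)) (cc (e (int j))) \<longleftrightarrow> j = i \<or> j = Suc i"
      if "1 \<le> i" "i \<le> nat n - 1" "1 \<le> j" "j \<le> nat n" for i j
      using path[of "int i" "int j"] that n5 by auto
    show "E (x 0) (cc (e (int j))) \<longleftrightarrow> 2 \<le> j \<and> j \<le> nat n - 1" if "1 \<le> j" "j \<le> nat n" for j
      using big[of "int j"] that n5 by auto
  qed
qed

lemma right_contains_F1:
  assumes n5: "5 \<le> n" and D: "D = 0" and in0: "\<And>l. 2 \<le> l \<Longrightarrow> l \<le> n - 2 \<Longrightarrow> U 0 \<le> U l \<and> V l \<le> V 0"
    and in1: "\<And>l. 3 \<le> l \<Longrightarrow> l \<le> n - 1 \<Longrightarrow> U 1 \<le> U l \<and> V l \<le> V 1"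
    and nn: "\<And>i. 2 \<le> i \<Longrightarrow> i \<le> n - 1 \<Longrightarrow> \<not> nested_at i"
    and right: "\<And>i. 2 \<le> i \<Longrightarrow> i \<le> n - 2 \<Longrightarrow> U i < U (i + 1)"
  shows "contains_C3 (C \<union> I) E"
proof -
  have per: "U n = U 0" "x n = x 0" "V n = V 0" using U_per[of 0] x_per[of 0] D by (simp_all add: V_def)
  have st: "U i < U (i + 1) \<and> U (i + 1) < V i \<and> V i < V (i + 1)" if "2 \<le> i" "i \<le> n - 2" for i
    using consec_cases[of i] right[OF that] by linarith
  have U_mono: "U i < U j" if "2 \<le> i" "i < j" "j \<le> n - 1" for i j
    by (rule int_chain_less[of 2 "n - 1" U]) (use st that in auto)
  have V_mono: "V i < V j" if "2 \<le> i" "i < j" "j \<le> n - 1" for i j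
    by (rule int_chain_less[of 2 "n - 1" V]) (use st that in auto)
  have gap: "V i \<le> U (i + 2)" if "2 \<le> i" "i + 2 \<le> n - 1" for i
  proof -
    have "U i + L i \<le> U (i + 2) \<or> U (i + 2) + L (i + 2) \<le> U i"
      by (rule disjoint_lifts) (use that n5 nn U_lift in auto)
    then show ?thesis using st[of i] st[of "i + 1"] that U_mono[of i "i + 2"] V_mono[of i "i + 2"] L(1)[of "i + 2"]
      unfolding V_def by auto
  qed
  have c1: "U 1 < U 2 \<and> U 2 < V 1 \<and> V 1 < V 2 \<or> U 2 < U 1 \<and> U 1 < V 2 \<and> V 2 < V 1"
    using consec_cases[of 1] by simp
  have c2: "U 2 < U 3 \<and> U 3 < V 2 \<and> V 2 < V 3" using st[of 2] n5 by simp
  have first: "U 2 < U 1" "U 1 < V 2" "V 2 < V 1"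
    using c1 c2 in1[of 3] n5 by auto
  have last: "U 0 < U (n - 1)" "U (n - 1) < V 0" "V 0 < V (n - 1)"
    using consec_cases[of "n - 1"] st[of "n - 2"] in0[of "n - 2"] n5 per by auto
  have mid: "U 0 < U 1" "U 1 < V 0" "V 0 < V 1"
    using consec_cases[of 0] first in0[of 2] n5 by auto
  have "overlap (U 1) (L 1) (U 0) (L 0)" using consec[of 0] by (simp add: overlap_commute)
  then have "U 1 + L 1 \<le> U 0 + m \<or> U 0 + m + L 0 \<le> U 1"
    using other_lift_disjoint[OF xI xI U_lift U_lift lift_shift[of m 0]] m_pos by simp
  then have win: "V 1 \<le> U 0 + m"
    using mid L[of 0] m_pos unfolding V_def by linarith
  \<comment> \<open>\<open>U 1\<close> lies just outside arc \<open>1\<close> but in the arcs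
    \<open>0\<close> and \<open>2\<close>. The path begins with arc \<open>2\<close>, so right ends
    are taken from \<open>V 2\<close> on: arc \<open>0\<close> misses only \<open>V (n - 1)\<close>,
    and arc \<open>1\<close> misses only \<open>U 1\<close>.\<close>
  define e where "e j = (if j = 1 then U 1 else V j)" for j
  have V_in: "U 1 < V j \<and> V j \<le> V 1" if "2 \<le> j" "j \<le> n - 1" for j
    using first in1[of j] st[of "j - 1"] that by (cases "j = 2") auto
  have e_win: "U 0 < e j" "e j \<le> U 0 + m" if "1 \<le> j" "j \<le> n - 1" for j
    using V_in[of j] that mid win first by (auto simp: e_def)
  have adj_i: "E (x i) (cc (e j)) \<longleftrightarrow> U i < e j \<and> e j \<le> V i"
    if ij: "0 \<le> i" "i \<le> n - 1" "1 \<le> j" "j \<le> n - 1" for i j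
  proof -
    consider "i = 0" | "i = 1" | "2 \<le> i" "i \<le> n - 2" | "i = n - 1" using ij by linarith
    then have "U 0 \<le> U i \<and> V i \<le> V 1"
      by cases (use in0[of i] in1[of "n - 1"] mid last n5 in auto)
    then show ?thesis
      using adj_in_window[OF xI U_lift, of "U 0" i "e j"] e_win[OF ij(3,4)] win unfolding V_def by simp
  qed
  have path: "E (x (i + 1)) (cc (e j)) \<longleftrightarrow> j = i \<or> j = i + 1"
    if ij: "1 \<le> i" "i \<le> n - 2" "1 \<le> j" "j \<le> n - 1" for i j
  proof -
    have a: "E (x (i + 1)) (cc (e j)) \<longleftrightarrow> U (i + 1) < e j \<and> e j \<le> V (i + 1)" using adj_i ij by simp
    show ?thesis
    proof (cases "j = 1")
      case True
      have "U 1 \<le> U (i + 1)" if "i \<noteq> 1" using that ij in1[of "i + 1"] by auto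
      then show ?thesis using a first True ij by (cases "i = 1") (auto simp: e_def)
    next
      case False
      then have ej: "e j = V j" by (simp add: e_def)
      consider "j = i + 1" | "j = i" | "j + 1 \<le> i" | "i + 2 \<le> j" by linarith
      then show ?thesis
      proof cases
        case 1
        have "U (i + 1) < V (i + 1)"
          using st[of "i + 1"] st[of i] first ij n5 by (cases "i = 1"; auto)
        then show ?thesis using a ej 1 by simp
      next
        case 2
        then show ?thesis using a ej st[of j] ij False by simp
      next
        case 3
        have "V j \<le> U (j + 2)" using gap[of j] ij 3 False by simp
        also have "\<dots> \<le> U (i + 1)" using U_mono[of "j + 2" "i + 1"] 3 ij by (cases "i = j + 1") (auto simp: add.assoc)
        finally show ?thesis using a ej 3 by simp
      next
        case 4
        then show ?thesis using a ej V_mono[of "i + 1" j] ij by simp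
      qed
    qed
  qed
  have b1: "E (x 0) (cc (e j)) \<longleftrightarrow> j \<le> n - 2" if j: "1 \<le> j" "j \<le> n - 1" for j
  proof -
    have a: "E (x 0) (cc (e j)) \<longleftrightarrow> U 0 < e j \<and> e j \<le> V 0" using adj_i j n5 by simp
    consider "j = 1" | "j = n - 1" | "2 \<le> j" "j \<le> n - 2" using j by linarith
    then show ?thesis
    proof cases
      case 3
      then show ?thesis using a in0[of j] e_win[OF j] by (simp add: e_def)
    qed (use a mid last n5 in \<open>auto simp: e_def\<close>)
  qed
  have b2: "E (x 1) (cc (e j)) \<longleftrightarrow> 2 \<le> j" if j: "1 \<le> j" "j \<le> n - 1" for j
  proof -
    have a: "E (x 1) (cc (e j)) \<longleftrightarrow> U 1 < e j \<and> e j \<le> V 1" using adj_i j n5 by simp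
    then show ?thesis using V_in[of j] j by (cases "j = 1") (auto simp: e_def)
  qed
  show ?thesis
  proof (rule contains_F1[of "nat n" "\<lambda>i. x (i + 1)" "x 0" "x 1" e])
    show "odd (nat n)" using odd_n[OF D] n5 by (simp add: even_nat_iff)
    show "5 \<le> nat n" using n5 by simp
    show "x (i + 1) \<in> I" "x 0 \<in> I" "x 1 \<in> I" for i by (rule xI)+
    show "E (x (int i + 1)) (cc (e (int j))) \<longleftrightarrow> j = i \<or> j = Suc i"
      if "1 \<le> i" "i \<le> nat n - 2" "1 \<le> j" "j \<le> nat n - 1" for i j
      using path[of "int i" "int j"] that n5 by auto
    show "E (x 0) (cc (e (int j))) \<longleftrightarrow> j \<le> nat n - 2" if "1 \<le> j" "j \<le> nat n - 1" for j
      using b1[of "int j"] that n5 by auto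
    show "E (x 1) (cc (e (int j))) \<longleftrightarrow> 2 \<le> j" if "1 \<le> j" "j \<le> nat n - 1" for j
      using b2[of "int j"] that n5 by auto
  qed
qed

end

section \<open>Which arcs can contain others, and reduction to right-moving paths\<close>

context odd_cycle
begin

lemma nested_at_backwards:
  "(\<exists>k v. 2 \<le> k \<and> k \<le> n - 2 \<and> m dvd v - s (x (j - k)) \<and> U j \<le> v \<and> v + L (j - k) \<le> V j) \<longleftrightarrow> nested_at j"
proof -
  have per: "x (j - k) = x (j + (n - k))" for k using x_per[of "j - k"] by (simp add: algebra_simps)
  show ?thesis
  proof
    assume "\<exists>k v. 2 \<le> k \<and> k \<le> n - 2 \<and> m dvd v - s (x (j - k)) \<and> U j \<le> v \<and> v + L (j - k) \<le> V j"
    then obtain k v where "2 \<le> k" "k \<le> n - 2" "m dvd v - s (x (j + (n - k)))" "U j \<le> v" "v + L (j + (n - k)) \<le> V j"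
      unfolding per by blast
    then show "nested_at j" unfolding nested_at_def by (intro exI[of _ "n - k"] exI[of _ v]) simp
  next
    assume "nested_at j"
    then obtain k v where k: "2 \<le> k" "k \<le> n - 2" "m dvd v - s (x (j + k))" "U j \<le> v" "v + L (j + k) \<le> V j"
      unfolding nested_at_def by blast
    then show "\<exists>k v. 2 \<le> k \<and> k \<le> n - 2 \<and> m dvd v - s (x (j - k)) \<and> U j \<le> v \<and> v + L (j - k) \<le> V j"
      unfolding per by (intro exI[of _ "n - k"] exI[of _ v]) simp
  qed
qed

text \<open>The arcs \<open>0\<close> and \<open>j\<close> would contain each other and coincide. A
  walk neighbour of arc \<open>0\<close> would then overlap arc \<open>j\<close> although it is not
  consecutive to it: arc \<open>1\<close>, or arc \<open>n - 1\<close> when \<open>j = 2\<close>,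
  where oddness of \<open>n\<close> excludes \<open>n = 4\<close>.\<close>

lemma no_inner_nesting:
  assumes n4: "4 \<le> n" and nest: "nested_at 0" and j: "2 \<le> j" "j \<le> n - 2"
  shows "\<not> nested_at j"
proof
  assume nj: "nested_at j"
  have D: "D = 0" by (rule nested_all(2)[OF nest])
  have per: "U n = U 0" "x n = x 0" "V n = V 0" using U_per[of 0] x_per[of 0] D by (simp_all add: V_def)
  have "U j \<le> U n \<and> V n \<le> V j" using nested_all(1)[OF nj, of "n - j"] j by simp
  moreover have "U 0 \<le> U j \<and> V j \<le> V 0" using nested_all(1)[OF nest, of j] j by simp
  ultimately have eq: "U j = U 0" "L j = L 0" using per by (auto simp: V_def)
  show False
  proof (cases "j = 2")
    case False
    then have "\<not> overlap (U 1) (L 1) (U j) (L j)" using j by (intro nonadj U_lift) auto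
    then show False using consec[of 0] eq by (simp add: overlap_commute)
  next
    case True
    have odd: "odd n" by (rule odd_n[OF D])
    have "n \<noteq> 4" using odd by auto
    then have "\<not> overlap (U 2) (L 2) (U (n - 1)) (L (n - 1))" using n4 by (intro nonadj U_lift) auto
    then show False using consec[of "n - 1"] eq True per by (simp add: overlap_commute)
  qed
qed

lemma direction_const:
  assumes n4: "4 \<le> n" and nn: "\<And>i. a \<le> i \<Longrightarrow> i \<le> n - 1 \<Longrightarrow> \<not> nested_at i" and i: "a \<le> i" "i \<le> n - 2"
  shows "U i < U (i + 1) \<longleftrightarrow> U a < U (a + 1)"
  using i
proof (induction i rule: int_ge_induct)
  case (step i)
  then show ?case
    using direction_step[OF n4 nn nn, of i] by (simp add: add.assoc)
qed simp

lemma nested_twice_contains: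
  assumes n4: "4 \<le> n" and nest: "nested_at 0" "nested_at 1"
  shows "contains_C3 (C \<union> I) E"
proof -
  have D: "D = 0" by (rule nested_all(2)[OF nest(1)])
  have "odd n" by (rule odd_n[OF D])
  then have "n \<noteq> 4" by auto
  then have n5: "5 \<le> n" using n4 by simp
  have per: "U (i + n) = U i" "V (i + n) = V i" for i using U_per[of i] x_per[of i] D by (simp_all add: V_def)
  have in0: "U 0 \<le> U l \<and> V l \<le> V 0" if "2 \<le> l" "l \<le> n - 2" for l
    using nested_all(1)[OF nest(1) that] by simp
  have in1: "U 1 \<le> U l \<and> V l \<le> V 1" if "3 \<le> l" "l \<le> n - 1" for l
    using nested_all(1)[OF nest(2), of "l - 1"] that by simp
  \<comment> \<open>Otherwise the arcs \<open>1\<close> and \<open>n - 1\<close> would contain each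
    other and coincide, and arc \<open>2\<close> would overlap the nonconsecutive arc
    \<open>n - 1\<close>.\<close>
  have "\<not> nested_at (n - 1)"
  proof
    assume "nested_at (n - 1)"
    from nested_all(1)[OF this, of 2] have "U (n - 1) \<le> U (1 + n) \<and> V (1 + n) \<le> V (n - 1)"
      using n5 by (simp add: algebra_simps)
    then have "U (n - 1) = U 1" "L (n - 1) = L 1"
      using in1[of "n - 1"] n5 per[of 1] by (auto simp: V_def)
    moreover have "\<not> overlap (U 2) (L 2) (U (n - 1)) (L (n - 1))" using n5 by (intro nonadj U_lift) auto
    ultimately show False using consec[of 1] by (simp add: overlap_commute)
  qed
  then have nn: "\<not> nested_at i" if "2 \<le> i" "i \<le> n - 1" for i
    using no_inner_nesting[OF n4 nest(1), of i] that by (cases "i = n - 1") auto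
  note const = direction_const[OF n4 nn]
  show ?thesis
  proof (cases "U 2 < U (2 + 1)")
    case True
    then show ?thesis using right_contains_F1[OF n5 D in0 in1 nn] const by blast
  next
    case False
    \<comment> \<open>The reflection that exchanges the two containing arcs \<open>0\<close> and
      \<open>1\<close>, up to a full period.\<close>
    let ?k = "1 + n"
    interpret R: odd_cycle C I E m cc s len n "\<lambda>i. x (?k - i)" "\<lambda>i. U (?k - i)" "- D" by (rule reverse)
    have VR: "R.V i = V (?k - i)" for i unfolding R.V_def V_def ..
    have shift: "?k - i - l = ?k - (i + l)" for i l by simp
    have NR: "R.nested_at i \<longleftrightarrow> nested_at (?k - i)" for i
      unfolding R.nested_at_def VR nested_at_backwards[of "?k - i", symmetric] shift ..
    have U0: "U (?k - 0) = U 1" "V (?k - 0) = V 1" "U (?k - 1) = U 0" "V (?k - 1) = V 0"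
      using per[of 0] per[of 1] by simp_all
    show ?thesis
    proof (rule R.right_contains_F1[OF n5])
      show "- D = 0" using D by simp
      show "U (?k - 0) \<le> U (?k - l) \<and> R.V l \<le> R.V 0" if "2 \<le> l" "l \<le> n - 2" for l
        unfolding VR U0 using in1[of "?k - l"] that by simp
      show "U (?k - 1) \<le> U (?k - l) \<and> R.V l \<le> R.V 1" if "3 \<le> l" "l \<le> n - 1" for l
        unfolding VR U0 using in0[of "?k - l"] that by simp
      show "\<not> R.nested_at i" if "2 \<le> i" "i \<le> n - 1" for i
        unfolding NR using nn[of "?k - i"] that by simp
      show "U (?k - i) < U (?k - (i + 1))" if "2 \<le> i" "i \<le> n - 2" for i
        using const[of 2 "n - i"] consec_cases[of "n - i"] False that by (simp add: algebra_simps)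
    qed
  qed
qed

lemma nested_once_contains:
  assumes n4: "4 \<le> n" and nest: "nested_at 0" "\<not> nested_at 1" "\<not> nested_at (n - 1)"
  shows "contains_C3 (C \<union> I) E"
proof -
  have D: "D = 0" by (rule nested_all(2)[OF nest(1)])
  have "odd n" by (rule odd_n[OF D])
  then have "n \<noteq> 4" by auto
  then have n5: "5 \<le> n" using n4 by simp
  have per: "U n = U 0" "V n = V 0" using U_per[of 0] x_per[of 0] D by (simp_all add: V_def)
  have in0: "U 0 \<le> U l \<and> V l \<le> V 0" if "2 \<le> l" "l \<le> n - 2" for l
    using nested_all(1)[OF nest(1) that] by simp
  have nn: "\<not> nested_at i" if "1 \<le> i" "i \<le> n - 1" for i
    using no_inner_nesting[OF n4 nest(1), of i] that nest(2,3) by (cases "i = n - 1"; cases "i = 1") auto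
  note const = direction_const[OF n4 nn]
  show ?thesis
  proof (cases "U 1 < U (1 + 1)")
    case True
    then show ?thesis using right_contains_F2[OF n5 D in0 nn] const by blast
  next
    case False
    interpret R: odd_cycle C I E m cc s len n "\<lambda>i. x (n - i)" "\<lambda>i. U (n - i)" "- D" by (rule reverse)
    have VR: "R.V i = V (n - i)" for i unfolding R.V_def V_def ..
    have shift: "n - i - l = n - (i + l)" for i l by simp
    have NR: "R.nested_at i \<longleftrightarrow> nested_at (n - i)" for i
      unfolding R.nested_at_def VR nested_at_backwards[of "n - i", symmetric] shift ..
    have U0: "U (n - 0) = U 0" "V (n - 0) = V 0" using per by simp_all
    show ?thesis
    proof (rule R.right_contains_F2[OF n5])
      show "- D = 0" using D by simp
      show "U (n - 0) \<le> U (n - l) \<and> R.V l \<le> R.V 0" if "2 \<le> l" "l \<le> n - 2" for l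
        unfolding VR U0 using in0[of "n - l"] that by simp
      show "\<not> R.nested_at i" if "1 \<le> i" "i \<le> n - 1" for i
        unfolding NR using nn[of "n - i"] that by simp
      show "U (n - i) < U (n - (i + 1))" if "1 \<le> i" "i \<le> n - 2" for i
        using const[of 1 "n - i - 1"] consec_cases[of "n - i - 1"] False that by (simp add: algebra_simps)
    qed
  qed
qed

lemma nested_contains:
  assumes n4: "4 \<le> n" and nest: "nested_at 0"
  shows "contains_C3 (C \<union> I) E"
proof -
  consider "nested_at 1" | "\<not> nested_at 1" "\<not> nested_at (n - 1)" | "nested_at (n - 1)" by blast
  then show ?thesis
  proof cases
    case 1
    then show ?thesis using nested_twice_contains[OF n4 nest] by blast
  next
    case 2
    then show ?thesis using nested_once_contains[OF n4 nest] by blast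
  next
    case 3
    interpret R: odd_cycle C I E m cc s len n "\<lambda>i. x (n - i)" "\<lambda>i. U (n - i)" "- D" by (rule reverse)
    have VR: "R.V i = V (n - i)" for i unfolding R.V_def V_def ..
    have shift: "n - i - l = n - (i + l)" for i l by simp
    have NR: "R.nested_at i \<longleftrightarrow> nested_at (n - i)" for i
      unfolding R.nested_at_def VR nested_at_backwards[of "n - i", symmetric] shift ..
    have D: "D = 0" by (rule nested_all(2)[OF nest])
    have per: "x (n + i) = x i" "U n = U 0" "V n = V 0" for i
      using U_per[of 0] x_per[of 0] x_per[of i] D by (simp_all add: V_def add.commute)
    have "nested_at (n - 0)" using nest unfolding nested_at_def by (simp add: per)
    then show ?thesis using R.nested_twice_contains[OF n4] 3 unfolding NR by blast
  qed
qed

theorem odd_cycle_contains_C3: "contains_C3 (C \<union> I) E"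
proof (cases "n = 3")
  case True
  then show ?thesis by (rule triangle_contains)
next
  case False
  then have n4: "4 \<le> n" using n by simp
  show ?thesis
  proof (cases "\<exists>j. nested_at j")
    case False
    then show ?thesis using unnested_contains[OF n4] by blast
  next
    case True
    then obtain j where j: "nested_at j" by blast
    interpret R: odd_cycle C I E m cc s len n "\<lambda>i. x (i + j)" "\<lambda>i. U (i + j)" D by (rule rotate)
    have "R.V 0 = V (0 + j)" unfolding R.V_def V_def ..
    then have "R.nested_at 0" using j unfolding R.nested_at_def nested_at_def by (simp add: add.commute)
    then show ?thesis by (rule R.nested_contains[OF n4])
  qed
qed

end

text \<open>Among all split partitions one with a largest clique is taken: a vertex of
  \<open>I\<close> adjacent to all of \<open>C\<close> could be moved into the clique.\<close>

lemma maximal_clique_partition: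
  assumes sg: "simple_graph V E" and sp: "split_graph V E"
  obtains C I where "C \<union> I = V" "C \<inter> I = {}" "is_clique E C" "is_indep E I"
    "\<And>x. x \<in> I \<Longrightarrow> \<exists>c\<in>C. \<not> E x c"
proof -
  have fin: "finite V" using sg by (simp add: simple_graph_def)
  define S where "S = {C. C \<subseteq> V \<and> is_clique E C \<and> is_indep E (V - C)}"
  have finS: "finite S" unfolding S_def by (rule finite_subset[of _ "Pow V"]) (use fin in auto)
  obtain C0 I0 where CI0: "C0 \<union> I0 = V" "C0 \<inter> I0 = {}" "is_clique E C0" "is_indep E I0"
    using sp unfolding split_graph_def by blast
  have "V - C0 = I0" using CI0 by blast
  then have "C0 \<in> S" using CI0 by (auto simp: S_def)
  then have ne: "card ` S \<noteq> {}" by blast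
  have "Max (card ` S) \<in> card ` S" by (rule Max_in) (use finS ne in auto)
  then obtain C where C: "C \<in> S" "Max (card ` S) = card C" by blast
  have Cmax: "card C' \<le> card C" if "C' \<in> S" for C'
    using Max_ge[of "card ` S" "card C'"] finS that C(2) by simp
  show ?thesis
  proof (rule that[of C "V - C"])
    fix x assume x: "x \<in> V - C"
    show "\<exists>c\<in>C. \<not> E x c"
    proof (rule ccontr)
      assume "\<not> ?thesis"
      then have adj: "E x c \<and> E c x" if "c \<in> C" for c
        using that x C(1) sg unfolding S_def simple_graph_def by blast
      have "insert x C \<in> S"
        using C(1) x adj unfolding S_def is_clique_def is_indep_def by blast
      then have "card (insert x C) \<le> card C" by (rule Cmax)
      moreover have "finite C" using C(1) fin unfolding S_def by (blast intro: finite_subset)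
      ultimately show False using x by simp
    qed
  qed (use C(1) in \<open>auto simp: S_def\<close>)
qed

theorem theorem6:
  fixes V :: "'a set" and E :: "'a \<Rightarrow> 'a \<Rightarrow> bool"
  assumes "simple_graph V E"
    and "split_graph V E"
    and "word_representable V E"
  shows "rep_num V E = 3 \<longleftrightarrow> contains_C3 V E"
proof (cases "V = {}")
  \<comment> \<open>The empty graph is treated apart because the period, the size of the clique,
    must be positive.\<close>
  case True
  then have "represents V E [] \<and> uniform 0 V []" by (simp add: represents_def uniform_def)
  then have "rep_num V E \<le> 0" unfolding rep_num_def by (intro Least_le) blast
  moreover have "\<not> contains_C3 V E" using True contains_C3_nonadjacent by (metis empty_iff)
  ultimately show ?thesis by simp
next
  case False
  obtain w where w: "represents V E w" using assms(3) by (auto simp: word_representable_def)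
  obtain C I where CI: "C \<union> I = V" "C \<inter> I = {}" "is_clique E C" "is_indep E I"
    "\<And>x. x \<in> I \<Longrightarrow> \<exists>c\<in>C. \<not> E x c"
    by (rule maximal_clique_partition[OF assms(1,2)]) blast
  have C0: "C \<noteq> {}" using CI False by blast
  obtain m cc s len where arcs: "circular_arcs C I E m cc s len"
    by (rule circular_arcs_exist[OF w assms(1) CI(1-4) C0 CI(5)])
  interpret circular_arcs C I E m cc s len by (rule arcs)
  have three: "\<exists>w. represents V E w \<and> uniform 3 V w" using three_uniform_word by (simp add: CI(1))
  show ?thesis
  proof
    assume rn: "rep_num V E = 3"
    show "contains_C3 V E"
    proof (rule ccontr)
      assume "\<not> contains_C3 V E"
      then have "\<not> odd_cycle C I E m cc s len n x U D" for n x U D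
        using odd_cycle.odd_cycle_contains_C3[of C I E m cc s len n x U D] CI(1) by auto
      then have "\<exists>w. represents V E w \<and> uniform 2 V w"
        using two_uniform_or_odd_cycle unfolding CI(1) by blast
      then have "rep_num V E \<le> 2" unfolding rep_num_def by (rule Least_le)
      then show False using rn by simp
    qed
  next
    assume c3: "contains_C3 V E"
    obtain a b where ab: "a \<in> V" "b \<in> V" "a \<noteq> b" "\<not> E a b"
      by (rule contains_C3_nonadjacent[OF c3])
    show "rep_num V E = 3"
      unfolding rep_num_def
    proof (rule Least_equality)
      show "\<exists>w. represents V E w \<and> uniform 3 V w" by (rule three)
    next
      fix k assume "\<exists>w. represents V E w \<and> uniform k V w"
      then obtain u where u: "represents V E u" "uniform k V u" by blast
      have "\<not> k < 2" using uniform_less_two_complete[OF u _ ab(1-3)] ab(4) by blast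
      moreover have "k \<noteq> 2" using contains_C3_not_two_uniform[OF c3 u(1)] u(2) by blast
      ultimately show "3 \<le> k" by simp
    qed
  qed
qed

end
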